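(* Let $(M,g)$ be a compact simply connected oriented 2-dimensional manifold with corners with a smooth Riemannian metric $g$, and let $\mathcal{T}_h$ be a smooth triangulation of $M$. Let $v$ be a continuous function on $M$ such that $v|_T\in C^2(T)$ for all triangles $T\subseteq M$ of $\mathcal{T}_h$, and let $\{g(t):t\in[0,1]\}$ be a family of Regge metrics for $\mathcal{T}_h$ such that $t\mapsto g(t)|_T$ is smooth for each triangle $T$. Then $$\frac{\partial}{\partial t}\Big[\langle\langle\alpha|_{\partial M,\mathrm{dist}}(g(t)),v\rangle\rangle-\langle\langle KdA_{\mathrm{dist}}(g(t)),v\rangle\rangle\Big]=-\frac12\,b_h(g(t);\dot g(t),v),$$ where for a Regge metric $g$ for $\mathcal{T}_h$ and a piecewise smooth symmetric $(0,2)$-tensor field $\sigma$ with single-valued tangential-tangential components along edges, $$b_h(g;\sigma,v):=\sum_{T\subseteq M}\langle\mathbb{S}\sigma,\nabla\nabla v\rangle_{L^2(T,g)}-\sum_{e\subset M}\langle(\mathbb{S}\sigma)(n,n),dv([\![n]\!])\rangle_{L^2(e,g)},\qquad \mathbb{S}\sigma=\sigma-\mathrm{tr}(\sigma)g,$$ with $n$ the unit normal to $e$ with respect to $g$.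
   Context: Conventions. $T$, $e$, $p$ denote triangles, edges and vertices of $\mathcal{T}_h$; $\mathring M$ is the interior of $M$. A smooth triangulation is a cover of $M$ by smoothly embedded closed simplices (of dimensions 0,1,2), closed under taking faces, any two meeting in a common face or not at all, and such that a simplex whose relative interior meets a stratum of $\partial M$ lies in that stratum. A Regge metric for $\mathcal{T}_h$ is a smooth Riemannian metric on each simplex, compatible with pullback to faces (equivalently, smooth on each triangle with single-valued tangential-tangential component along each edge). Traces, $\nabla$, and norms in $b_h(g;\cdot,\cdot)$ are taken with respect to the metric $g$ in its first argument, on each triangle. Jumps. Along an interior edge $e=T^+\cap T^-$, $[\![X]\!]=X^+-X^-$, where $X^\pm$ is evaluated using the metric on $T^\pm$, with the corresponding induced boundary orientations. Thus $dv([\![n]\!])=dv|_{T^+}(n_+)+dv|_{T^-}(n_-)$, where $n_\pm$ is the unit normal to $e$ pointing out of $T^\pm$ (for the metric on $T^\pm$), and $\int_e v[\![k\,ds]\!]=\int_e v\,(k^++k^-)\,ds$, where $k^\pm$ is the geodesic curvature of $e$ as part of $\partial T^\pm$. On an edge $e\subset\partial M$, $[\![X]\!]=X^+$ (the value from the only adjacent triangle, with outward normal). At a vertex $p$ on $\partial M$, $[\![\mu]\!]|_p$ is the value of $\mu$ on the counterclockwise side of $p$ minus its value on the clockwise side. Distributional Gauss curvature. For a Regge metric $g_h$ (with Gauss curvature $K_h$, area form $dA_h$, geodesic curvature $k_h$, arclength $ds_h$, and $\theta_T(p)$ the interior angle of $T$ at $p$, all measured by $g_h$): $$\langle\langle KdA_{\mathrm{dist}}(g_h),v\rangle\rangle=\sum_{T\subseteq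 M}\int_TvK_h\,dA_h+\sum_{\mathring e\subset\mathring M}\int_ev[\![k_hds_h]\!]+\sum_{p\in\mathring M}v(p)\Big(2\pi-\sum_{T\ni p}\theta_T(p)\Big).$$ Distributional boundary connection form: $$\langle\langle\alpha|_{\partial M,\mathrm{dist}}(g_h),v\rangle\rangle=\sum_{e\subset\partial M}\int_ev\,(d\mu-k_hds_h)-\sum_{p\in\partial M}v(p)\Big(\pi-[\![\mu]\!]|_p-\sum_{T\ni p}\theta_T(p)\Big).$$ Here $(e_1,e_2)$ is a smooth orthonormal frame for the fixed smooth metric $g$ on $M$ whose connection 1-form $\langle\nabla e_2,e_1\rangle$ is co-exact, and $\mu$ is the angle that $e_1$ makes with the outward normal vector of $\partial M$ as measured by the fixed smooth metric $g$; in particular $\mu$ does not depend on $t$. *)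

theory Defs
  imports "HOL-Analysis.Analysis"
begin

section \<open>Smooth functions on subsets of Euclidean space\<close>

text \<open>Iterated differentiability within \<open>S\<close> with continuous top-order derivatives. It is used only for
  sets on which derivatives within the set are unique (relatively open subsets of a quadrant, a closed
  triangle, a compact interval, and the product of the latter two); there it amounts to the existence
  of a local \<open>C\<^sup>k\<close> extension to an open set. The \<open>D i\<close> are the partial derivatives.\<close>

primrec Ck_on :: "nat \<Rightarrow> 'a::euclidean_space set \<Rightarrow> ('a \<Rightarrow> 'b::real_normed_vector) \<Rightarrow> bool" where
  "Ck_on 0 S f \<longleftrightarrow> continuous_on S f"
| "Ck_on (Suc k) S f \<longleftrightarrow>
     (\<exists>D. (\<forall>x\<in>S. (f has_derivative (\<lambda>h. \<Sum>i\<in>Basis. (h \<bullet> i) *\<^sub>R D i x)) (at x within S)) \<and>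
          (\<forall>i\<in>Basis. Ck_on k S (D i)))"

definition smooth_on :: "'a::euclidean_space set \<Rightarrow> ('a \<Rightarrow> 'b::real_normed_vector) \<Rightarrow> bool" where
  "smooth_on S f \<longleftrightarrow> (\<forall>k. Ck_on k S f)"

definition pd :: "(real^2) set \<Rightarrow> 2 \<Rightarrow> (real^2 \<Rightarrow> 'b::real_normed_vector) \<Rightarrow> real^2 \<Rightarrow> 'b" where
  "pd S i f x = frechet_derivative f (at x within S) (axis i 1)"

definition jac :: "(real^2) set \<Rightarrow> (real^2 \<Rightarrow> real^2) \<Rightarrow> real^2 \<Rightarrow> real^2^2" where
  "jac S f x = matrix (frechet_derivative f (at x within S))"


section \<open>Riemannian geometry in coordinates\<close>

text \<open>A metric on a coordinate domain \<open>S\<close> is its matrix of components \<open>g x $ i $ j\<close>.\<close>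

definition pos_def :: "real^2^2 \<Rightarrow> bool" where
  "pos_def A \<longleftrightarrow> transpose A = A \<and> (\<forall>w. w \<noteq> 0 \<longrightarrow> w \<bullet> (A *v w) > 0)"

definition smooth_metric_on :: "(real^2) set \<Rightarrow> (real^2 \<Rightarrow> real^2^2) \<Rightarrow> bool" where
  "smooth_metric_on S g \<longleftrightarrow> smooth_on S g \<and> (\<forall>x\<in>S. pos_def (g x))"

definition bil :: "real^2^2 \<Rightarrow> real^2 \<Rightarrow> real^2 \<Rightarrow> real" where
  "bil A u w = u \<bullet> (A *v w)"

definition len :: "real^2^2 \<Rightarrow> real^2 \<Rightarrow> real" where
  "len A u = sqrt (bil A u u)"

definition christoffel :: "(real^2) set \<Rightarrow> (real^2 \<Rightarrow> real^2^2) \<Rightarrow> 2 \<Rightarrow> 2 \<Rightarrow> real^2 \<Rightarrow> real^2" where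
  "christoffel S g i j x =
     (\<chi> k. 1/2 * (\<Sum>l\<in>UNIV. matrix_inv (g x) $ k $ l *
        (pd S i g x $ j $ l + pd S j g x $ i $ l - pd S l g x $ i $ j)))"

text \<open>Components of \<open>R(\<partial>\<^sub>1,\<partial>\<^sub>2)\<partial>\<^sub>2 = \<nabla>\<^sub>1\<nabla>\<^sub>2\<partial>\<^sub>2 - \<nabla>\<^sub>2\<nabla>\<^sub>1\<partial>\<^sub>2\<close>.\<close>

definition curv_vec :: "(real^2) set \<Rightarrow> (real^2 \<Rightarrow> real^2^2) \<Rightarrow> real^2 \<Rightarrow> real^2" where
  "curv_vec S g x =
     pd S 1 (christoffel S g 2 2) x - pd S 2 (christoffel S g 1 2) x
     + (\<Sum>m\<in>UNIV. christoffel S g 2 2 x $ m *\<^sub>R christoffel S g 1 m x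
                - christoffel S g 1 2 x $ m *\<^sub>R christoffel S g 2 m x)"

definition gauss_curvature :: "(real^2) set \<Rightarrow> (real^2 \<Rightarrow> real^2^2) \<Rightarrow> real^2 \<Rightarrow> real" where
  "gauss_curvature S g x = bil (g x) (curv_vec S g x) (axis 1 1) / det (g x)"

definition area_density :: "(real^2 \<Rightarrow> real^2^2) \<Rightarrow> real^2 \<Rightarrow> real" where
  "area_density g x = sqrt (det (g x))"

definition hessian :: "(real^2) set \<Rightarrow> (real^2 \<Rightarrow> real^2^2) \<Rightarrow> (real^2 \<Rightarrow> real) \<Rightarrow> real^2 \<Rightarrow> real^2^2" where
  "hessian S g f x =
     (\<chi> i j. pd S i (pd S j f) x - (\<Sum>k\<in>UNIV. christoffel S g i j x $ k * pd S k f x))"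

text \<open>Trace and inner product of \<open>(0,2)\<close>-tensors with respect to a metric with matrix \<open>A\<close>.\<close>

definition tr_g :: "real^2^2 \<Rightarrow> real^2^2 \<Rightarrow> real" where
  "tr_g A B = (\<Sum>i\<in>UNIV. \<Sum>j\<in>UNIV. matrix_inv A $ i $ j * B $ i $ j)"

definition inner_g :: "real^2^2 \<Rightarrow> real^2^2 \<Rightarrow> real^2^2 \<Rightarrow> real" where
  "inner_g A B C = (\<Sum>i\<in>UNIV. \<Sum>j\<in>UNIV. \<Sum>a\<in>UNIV. \<Sum>b\<in>UNIV.
     matrix_inv A $ i $ a * matrix_inv A $ j $ b * B $ i $ j * C $ a $ b)"

definition S_op :: "real^2^2 \<Rightarrow> real^2^2 \<Rightarrow> real^2^2" where
  "S_op A B = B - tr_g A B *\<^sub>R A"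

text \<open>The \<open>A\<close>-unit vector that is \<open>A\<close>-orthogonal to \<open>d\<close> and lies to the right of \<open>d\<close>: it is the
  normalized vector dual to the covector \<open>w \<mapsto> w\<^sub>1 d\<^sub>2 - w\<^sub>2 d\<^sub>1\<close>, see the lemma below. When \<open>d\<close> is a
  counterclockwise tangent of a domain, this is the outward unit normal.\<close>

definition right_normal :: "real^2^2 \<Rightarrow> real^2 \<Rightarrow> real^2" where
  "right_normal A d =
     (let w = matrix_inv A *v (vector [d $ 2, - d $ 1]) in w /\<^sub>R len A w)"

lemma right_normal:
  assumes A: "pos_def A" and d: "d \<noteq> 0"
  defines "n \<equiv> right_normal A d"
  shows "bil A n n = 1" "bil A n d = 0" "n $ 1 * d $ 2 - n $ 2 * d $ 1 > 0"
proof -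
  define om :: "real^2" where "om = vector [d $ 2, - d $ 1]"
  define w where "w = matrix_inv A *v om"
  have om0: "om \<noteq> 0"
    using d by (auto simp: om_def vec_eq_iff forall_2 vector_2)
  have inj: "A *v u = 0 \<Longrightarrow> u = 0" for u
    using A by (auto simp: pos_def_def dest!: spec[of _ u])
  have "invertible A"
    by (metis inj invertible_left_inverse matrix_left_invertible_ker)
  then have "A ** matrix_inv A = mat 1"
    unfolding matrix_inv_def invertible_def by (rule someI2_ex) simp
  then have Aw: "A *v w = om"
    by (simp add: w_def matrix_vector_mul_assoc)
  then have w0: "w \<noteq> 0" using om0 by auto
  then have pos: "bil A w w > 0" using A by (simp add: bil_def pos_def_def)
  have n: "n = w /\<^sub>R len A w"
    by (simp add: n_def right_normal_def w_def om_def Let_def)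
  have lp: "len A w > 0" using pos by (simp add: len_def)
  have l2: "len A w * len A w = bil A w w" using pos by (simp add: len_def)
  have "bil A n n = bil A w w / (len A w * len A w)"
    by (simp add: n bil_def matrix_vector_mult_scaleR divide_simps)
  then show "bil A n n = 1" using l2 pos by simp
  have "bil A w u = u \<bullet> (A *v w)" for u
    using A unfolding bil_def pos_def_def
    by (metis dot_lmul_matrix inner_commute transpose_matrix_vector)
  then have wu: "bil A w u = u $ 1 * d $ 2 - u $ 2 * d $ 1" for u
    by (simp add: Aw om_def inner_vec_def sum_2 vector_2)
  have "bil A n d = bil A w d / len A w"
    by (simp add: n bil_def divide_inverse mult.commute)
  then show "bil A n d = 0" by (simp add: wu)
  have "n $ 1 * d $ 2 - n $ 2 * d $ 1 = bil A w w / len A w"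
    by (simp add: n wu[of w] divide_inverse algebra_simps)
  then show "n $ 1 * d $ 2 - n $ 2 * d $ 1 > 0" using pos lp by simp
qed

definition velocity :: "(real \<Rightarrow> real^2) \<Rightarrow> real \<Rightarrow> real^2" where
  "velocity c s = vector_derivative c (at s within {0..1})"

definition cov_accel :: "(real^2) set \<Rightarrow> (real^2 \<Rightarrow> real^2^2) \<Rightarrow> (real \<Rightarrow> real^2) \<Rightarrow> real \<Rightarrow> real^2" where
  "cov_accel S g c s = velocity (velocity c) s
     + (\<Sum>i\<in>UNIV. \<Sum>j\<in>UNIV. (velocity c s $ i * velocity c s $ j) *\<^sub>R christoffel S g i j (c s))"

text \<open>Geodesic curvature of a counterclockwise boundary curve in an arbitrary regular parametrization.
  The sign makes convex domains have nonnegative curvature; the tangential part of the acceleration is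
  removed by pairing with the normal.\<close>

definition geodesic_curvature :: "(real^2) set \<Rightarrow> (real^2 \<Rightarrow> real^2^2) \<Rightarrow> (real \<Rightarrow> real^2) \<Rightarrow> real \<Rightarrow> real" where
  "geodesic_curvature S g c s =
     - bil (g (c s)) (cov_accel S g c s) (right_normal (g (c s)) (velocity c s))
     / bil (g (c s)) (velocity c s) (velocity c s)"


section \<open>Oriented surfaces with corners\<close>

definition quadrant :: "(real^2) set" where
  "quadrant = {x. \<forall>i. 0 \<le> x $ i}"

text \<open>A chart is a pair of a domain and a coordinate map, whose values off the domain are irrelevant.\<close>

type_synonym 'm chart = "'m set \<times> ('m \<Rightarrow> real^2)"

definition chart_inv :: "'m chart \<Rightarrow> real^2 \<Rightarrow> 'm" where
  "chart_inv c = inv_into (fst c) (snd c)"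

definition chart_on :: "'m::topological_space set \<Rightarrow> 'm chart \<Rightarrow> bool" where
  "chart_on M c \<longleftrightarrow>
     openin (top_of_set M) (fst c) \<and>
     openin (top_of_set quadrant) (snd c ` fst c) \<and>
     homeomorphism (fst c) (snd c ` fst c) (snd c) (chart_inv c)"

definition overlap :: "'m chart \<Rightarrow> 'm chart \<Rightarrow> (real^2) set" where
  "overlap c c' = snd c ` (fst c \<inter> fst c')"

definition transition :: "'m chart \<Rightarrow> 'm chart \<Rightarrow> real^2 \<Rightarrow> real^2" where
  "transition c c' = snd c' \<circ> chart_inv c"

definition oriented_corner_surface :: "'m::t2_space set \<Rightarrow> 'm chart set \<Rightarrow> bool" where
  "oriented_corner_surface M \<A> \<longleftrightarrow>
     (\<forall>c\<in>\<A>. chart_on M c) \<and> M = (\<Union>c\<in>\<A>. fst c) \<and>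
     (\<forall>c\<in>\<A>. \<forall>c'\<in>\<A>.
        smooth_on (overlap c c') (transition c c') \<and>
        (\<forall>x\<in>overlap c c'. det (jac (overlap c c') (transition c c') x) > 0))"

definition depth_set :: "'m chart set \<Rightarrow> nat \<Rightarrow> 'm set" where
  "depth_set \<A> d = {p. \<exists>c\<in>\<A>. p \<in> fst c \<and> card {i. snd c p $ i = 0} = d}"

definition mboundary :: "'m chart set \<Rightarrow> 'm set" where
  "mboundary \<A> = depth_set \<A> 1 \<union> depth_set \<A> 2"

definition boundary_strata :: "'m::topological_space chart set \<Rightarrow> 'm set set" where
  "boundary_strata \<A> = components (depth_set \<A> 1) \<union> components (depth_set \<A> 2)"

text \<open>Tensor fields on the surface are given by their components in each chart, as functions on
  the image of that chart, subject to the transformation law.\<close>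

definition smooth_vector_field :: "'m chart set \<Rightarrow> ('m chart \<Rightarrow> real^2 \<Rightarrow> real^2) \<Rightarrow> bool" where
  "smooth_vector_field \<A> X \<longleftrightarrow>
     (\<forall>c\<in>\<A>. smooth_on (snd c ` fst c) (X c)) \<and>
     (\<forall>c\<in>\<A>. \<forall>c'\<in>\<A>. \<forall>x\<in>overlap c c'.
        X c' (transition c c' x) = jac (overlap c c') (transition c c') x *v X c x)"

definition smooth_riemannian_metric :: "'m chart set \<Rightarrow> ('m chart \<Rightarrow> real^2 \<Rightarrow> real^2^2) \<Rightarrow> bool" where
  "smooth_riemannian_metric \<A> g \<longleftrightarrow>
     (\<forall>c\<in>\<A>. smooth_metric_on (snd c ` fst c) (g c)) \<and>
     (\<forall>c\<in>\<A>. \<forall>c'\<in>\<A>. \<forall>x\<in>overlap c c'.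
        g c x = (let J = jac (overlap c c') (transition c c') x
                 in transpose J ** g c' (transition c c' x) ** J))"

definition smooth_function :: "'m chart set \<Rightarrow> ('m \<Rightarrow> real) \<Rightarrow> bool" where
  "smooth_function \<A> f \<longleftrightarrow> (\<forall>c\<in>\<A>. smooth_on (snd c ` fst c) (f \<circ> chart_inv c))"

definition oriented_orthonormal_frame ::
  "'m chart set \<Rightarrow> ('m chart \<Rightarrow> real^2 \<Rightarrow> real^2^2) \<Rightarrow>
   ('m chart \<Rightarrow> real^2 \<Rightarrow> real^2) \<Rightarrow> ('m chart \<Rightarrow> real^2 \<Rightarrow> real^2) \<Rightarrow> bool" where
  "oriented_orthonormal_frame \<A> g e1 e2 \<longleftrightarrow>
     smooth_vector_field \<A> e1 \<and> smooth_vector_field \<A> e2 \<and>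
     (\<forall>c\<in>\<A>. \<forall>x\<in>snd c ` fst c.
        bil (g c x) (e1 c x) (e1 c x) = 1 \<and> bil (g c x) (e2 c x) (e2 c x) = 1 \<and>
        bil (g c x) (e1 c x) (e2 c x) = 0 \<and>
        e1 c x $ 1 * e2 c x $ 2 - e1 c x $ 2 * e2 c x $ 1 > 0)"

text \<open>The connection 1-form \<open>X \<mapsto> \<langle>\<nabla>\<^sub>X e2, e1\<rangle>\<close>, in coordinates on \<open>S\<close>.\<close>

definition connection_form ::
  "(real^2) set \<Rightarrow> (real^2 \<Rightarrow> real^2^2) \<Rightarrow> (real^2 \<Rightarrow> real^2) \<Rightarrow> (real^2 \<Rightarrow> real^2) \<Rightarrow> real^2 \<Rightarrow> real^2" where
  "connection_form S g e1 e2 x =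
     (\<chi> i. bil (g x) (pd S i e2 x + (\<Sum>j\<in>UNIV. e2 x $ j *\<^sub>R christoffel S g i j x)) (e1 x))"

text \<open>Hodge star of a 1-form on an oriented surface: \<open>(\<star>\<omega>)(Y) = dA(\<omega>\<^sup>\<sharp>, Y)\<close>.\<close>

definition hodge1 :: "real^2^2 \<Rightarrow> real^2 \<Rightarrow> real^2" where
  "hodge1 A om = (let w = matrix_inv A *v om in sqrt (det A) *\<^sub>R vector [- w $ 2, w $ 1])"

text \<open>Every 2-form is \<open>f dA\<close> for a function \<open>f\<close>, and its codifferential is \<open>- \<star> df\<close>.
  Co-exactness means being the codifferential of a smooth 2-form; no boundary condition is imposed.\<close>

definition coexact_connection ::
  "'m chart set \<Rightarrow> ('m chart \<Rightarrow> real^2 \<Rightarrow> real^2^2) \<Rightarrow>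
   ('m chart \<Rightarrow> real^2 \<Rightarrow> real^2) \<Rightarrow> ('m chart \<Rightarrow> real^2 \<Rightarrow> real^2) \<Rightarrow> bool" where
  "coexact_connection \<A> g e1 e2 \<longleftrightarrow>
     (\<exists>f. smooth_function \<A> f \<and>
        (\<forall>c\<in>\<A>. \<forall>x\<in>snd c ` fst c.
           connection_form (snd c ` fst c) (g c) (e1 c) (e2 c) x
           = - hodge1 (g c x) (\<chi> i. pd (snd c ` fst c) i (f \<circ> chart_inv c) x)))"


section \<open>Smooth triangulations\<close>

text \<open>Vertices \<open>(0,0), (1,0), (0,1)\<close> of the reference triangle are indexed by \<open>0, 1, 2\<close> in the type
  \<open>3\<close>, whose addition is modulo 3. The edge with index \<open>k\<close> is opposite to vertex \<open>k\<close> and is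
  traversed counterclockwise by \<open>ref_path k\<close>.\<close>

definition ref_vertex :: "3 \<Rightarrow> real^2" where
  "ref_vertex k = (if k = 1 then axis 1 1 else if k = 2 then axis 2 1 else 0)"

definition ref_tri :: "(real^2) set" where
  "ref_tri = convex hull (range ref_vertex)"

definition ref_path :: "3 \<Rightarrow> real \<Rightarrow> real^2" where
  "ref_path k = linepath (ref_vertex (k + 1)) (ref_vertex (k + 2))"

text \<open>A triangulation is a set \<open>\<T>\<close> of triangles, which are subsets of the surface, with a
  parametrization \<open>\<phi> T\<close> of each triangle \<open>T\<close> by the reference triangle. Its simplices are all faces of
  the triangles; \<open>tri_face \<phi> T K\<close> is the face of \<open>T\<close> spanned by the vertices in \<open>K\<close>.\<close>

definition tri_face :: "('m set \<Rightarrow> real^2 \<Rightarrow> 'm) \<Rightarrow> 'm set \<Rightarrow> 3 set \<Rightarrow> 'm set" where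
  "tri_face \<phi> T K = \<phi> T ` (convex hull (ref_vertex ` K))"

definition tri_face_interior :: "('m set \<Rightarrow> real^2 \<Rightarrow> 'm) \<Rightarrow> 'm set \<Rightarrow> 3 set \<Rightarrow> 'm set" where
  "tri_face_interior \<phi> T K = \<phi> T ` rel_interior (convex hull (ref_vertex ` K))"

definition smooth_triangle :: "'m::t2_space set \<Rightarrow> 'm chart set \<Rightarrow> (real^2 \<Rightarrow> 'm) \<Rightarrow> bool" where
  "smooth_triangle M \<A> f \<longleftrightarrow>
     f ` ref_tri \<subseteq> M \<and> continuous_on ref_tri f \<and> inj_on f ref_tri \<and>
     (\<forall>c\<in>\<A>. smooth_on (ref_tri \<inter> f -` fst c) (snd c \<circ> f) \<and>
            (\<forall>x\<in>ref_tri \<inter> f -` fst c. det (jac ref_tri (snd c \<circ> f) x) > 0))"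

definition smooth_triangulation ::
  "'m::t2_space set \<Rightarrow> 'm chart set \<Rightarrow> 'm set set \<Rightarrow> ('m set \<Rightarrow> real^2 \<Rightarrow> 'm) \<Rightarrow> bool" where
  "smooth_triangulation M \<A> \<T> \<phi> \<longleftrightarrow>
     finite \<T> \<and> \<Union>\<T> = M \<and>
     (\<forall>T\<in>\<T>. smooth_triangle M \<A> (\<phi> T) \<and> \<phi> T ` ref_tri = T) \<and>
     (\<forall>T\<in>\<T>. \<forall>T'\<in>\<T>. \<forall>K K'. tri_face \<phi> T K \<inter> tri_face \<phi> T' K' = {} \<or>
        (\<exists>L\<subseteq>K. \<exists>L'\<subseteq>K'. tri_face \<phi> T K \<inter> tri_face \<phi> T' K' = tri_face \<phi> T L \<and>
                          tri_face \<phi> T L = tri_face \<phi> T' L')) \<and>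
     (\<forall>T\<in>\<T>. \<forall>K. \<forall>S\<in>boundary_strata \<A>.
        tri_face_interior \<phi> T K \<inter> S \<noteq> {} \<longrightarrow> tri_face \<phi> T K \<subseteq> closure S)"

definition edges :: "'m set set \<Rightarrow> ('m set \<Rightarrow> real^2 \<Rightarrow> 'm) \<Rightarrow> 'm set set" where
  "edges \<T> \<phi> = {tri_face \<phi> T (- {k}) | T k. T \<in> \<T>}"

definition verts :: "'m set set \<Rightarrow> ('m set \<Rightarrow> real^2 \<Rightarrow> 'm) \<Rightarrow> 'm set" where
  "verts \<T> \<phi> = {\<phi> T (ref_vertex k) | T k. T \<in> \<T>}"

text \<open>The sides of an edge \<open>e\<close> are the pairs of a triangle containing \<open>e\<close> and the index of \<open>e\<close> in it.
  There are two for an interior edge and one for a boundary edge, so that the jump across \<open>e\<close> of a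
  quantity that changes sign with the orientation of the boundary is the sum over the sides of \<open>e\<close>.\<close>

definition sides :: "'m set set \<Rightarrow> ('m set \<Rightarrow> real^2 \<Rightarrow> 'm) \<Rightarrow> 'm set \<Rightarrow> ('m set \<times> 3) set" where
  "sides \<T> \<phi> e = {(T, k). T \<in> \<T> \<and> tri_face \<phi> T (- {k}) = e}"

definition angles_at :: "'m set set \<Rightarrow> ('m set \<Rightarrow> real^2 \<Rightarrow> 'm) \<Rightarrow> 'm \<Rightarrow> ('m set \<times> 3) set" where
  "angles_at \<T> \<phi> p = {(T, k). T \<in> \<T> \<and> \<phi> T (ref_vertex k) = p}"

definition boundary_edges :: "'m chart set \<Rightarrow> 'm set set \<Rightarrow> ('m set \<Rightarrow> real^2 \<Rightarrow> 'm) \<Rightarrow> 'm set set" where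
  "boundary_edges \<A> \<T> \<phi> = {e \<in> edges \<T> \<phi>. e \<subseteq> mboundary \<A>}"

definition interior_edges ::
  "'m set \<Rightarrow> 'm chart set \<Rightarrow> 'm set set \<Rightarrow> ('m set \<Rightarrow> real^2 \<Rightarrow> 'm) \<Rightarrow> 'm set set" where
  "interior_edges M \<A> \<T> \<phi> =
     {tri_face \<phi> T (- {k}) | T k. T \<in> \<T> \<and> tri_face_interior \<phi> T (- {k}) \<subseteq> M - mboundary \<A>}"

definition tri_point :: "('m set \<Rightarrow> real^2 \<Rightarrow> 'm) \<Rightarrow> 'm set \<Rightarrow> 'm \<Rightarrow> real^2" where
  "tri_point \<phi> T = inv_into ref_tri (\<phi> T)"


section \<open>Regge metrics and distributional curvature\<close>

text \<open>A piecewise smooth \<open>(0,2)\<close>-tensor field is a family \<open>g T\<close> of component matrices on the reference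
  triangle, namely the pullback of the tensor field on \<open>T\<close> under \<open>\<phi> T\<close>. Along an edge \<open>e\<close> with sides
  \<open>(T,k)\<close> and \<open>(T',k')\<close>, the pullbacks of \<open>g T\<close> and \<open>g T'\<close> to \<open>e\<close> are compared in the parametrization of
  \<open>e\<close> induced by \<open>T\<close>.\<close>

definition single_valued_tt ::
  "'m set set \<Rightarrow> ('m set \<Rightarrow> real^2 \<Rightarrow> 'm) \<Rightarrow> ('m set \<Rightarrow> real^2 \<Rightarrow> real^2^2) \<Rightarrow> bool" where
  "single_valued_tt \<T> \<phi> g \<longleftrightarrow>
     (\<forall>e\<in>edges \<T> \<phi>. \<forall>(T, k)\<in>sides \<T> \<phi> e. \<forall>(T', k')\<in>sides \<T> \<phi> e. \<forall>s\<in>{0..1}.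
        let c = ref_path k; c' = tri_point \<phi> T' \<circ> \<phi> T \<circ> ref_path k in
        bil (g T (c s)) (velocity c s) (velocity c s)
        = bil (g T' (c' s)) (velocity c' s) (velocity c' s))"

definition regge_metric ::
  "'m set set \<Rightarrow> ('m set \<Rightarrow> real^2 \<Rightarrow> 'm) \<Rightarrow> ('m set \<Rightarrow> real^2 \<Rightarrow> real^2^2) \<Rightarrow> bool" where
  "regge_metric \<T> \<phi> g \<longleftrightarrow>
     (\<forall>T\<in>\<T>. smooth_metric_on ref_tri (g T)) \<and> single_valued_tt \<T> \<phi> g"

definition tri_integral :: "(real^2 \<Rightarrow> real^2^2) \<Rightarrow> (real^2 \<Rightarrow> real) \<Rightarrow> real" where
  "tri_integral g f = integral ref_tri (\<lambda>x. f x * area_density g x)"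

definition side_speed :: "(real^2 \<Rightarrow> real^2^2) \<Rightarrow> 3 \<Rightarrow> real \<Rightarrow> real" where
  "side_speed g k s = len (g (ref_path k s)) (velocity (ref_path k) s)"

definition side_curvature :: "(real^2 \<Rightarrow> real^2^2) \<Rightarrow> 3 \<Rightarrow> real \<Rightarrow> real" where
  "side_curvature g k = geodesic_curvature ref_tri g (ref_path k)"

text \<open>Outward unit normal at a point \<open>x\<close> of the edge \<open>k\<close> of the reference triangle.\<close>

definition side_normal :: "(real^2 \<Rightarrow> real^2^2) \<Rightarrow> 3 \<Rightarrow> real^2 \<Rightarrow> real^2" where
  "side_normal g k x = right_normal (g x) (ref_vertex (k + 2) - ref_vertex (k + 1))"

definition vertex_angle :: "(real^2 \<Rightarrow> real^2^2) \<Rightarrow> 3 \<Rightarrow> real" where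
  "vertex_angle g k =
     (let A = g (ref_vertex k);
          u = ref_vertex (k + 1) - ref_vertex k; w = ref_vertex (k + 2) - ref_vertex k
      in arccos (bil A u w / (len A u * len A w)))"

definition K_dist ::
  "'m set \<Rightarrow> 'm chart set \<Rightarrow> 'm set set \<Rightarrow> ('m set \<Rightarrow> real^2 \<Rightarrow> 'm) \<Rightarrow>
   ('m set \<Rightarrow> real^2 \<Rightarrow> real^2^2) \<Rightarrow> ('m \<Rightarrow> real) \<Rightarrow> real" where
  "K_dist M \<A> \<T> \<phi> g v =
     (\<Sum>T\<in>\<T>. tri_integral (g T) (\<lambda>x. v (\<phi> T x) * gauss_curvature ref_tri (g T) x))
   + (\<Sum>e\<in>interior_edges M \<A> \<T> \<phi>. \<Sum>(T, k)\<in>sides \<T> \<phi> e.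
        integral {0..1} (\<lambda>s. v (\<phi> T (ref_path k s)) * (side_curvature (g T) k s * side_speed (g T) k s)))
   + (\<Sum>p\<in>verts \<T> \<phi> - mboundary \<A>.
        v p * (2 * pi - (\<Sum>(T, k)\<in>angles_at \<T> \<phi> p. vertex_angle (g T) k)))"

text \<open>The pullback of the metric \<open>g\<close> of the surface to the triangle \<open>T\<close>, computed in the chart \<open>c\<close>.\<close>

definition pulled_metric ::
  "('m set \<Rightarrow> real^2 \<Rightarrow> 'm) \<Rightarrow> ('m chart \<Rightarrow> real^2 \<Rightarrow> real^2^2) \<Rightarrow> 'm chart \<Rightarrow> 'm set \<Rightarrow>
   real^2 \<Rightarrow> real^2^2" where
  "pulled_metric \<phi> g c T x =
     (let J = jac ref_tri (snd c \<circ> \<phi> T) x in transpose J ** g c (snd c (\<phi> T x)) ** J)"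

text \<open>\<open>\<mu> e\<close> is a smooth branch, along the closed boundary edge \<open>e\<close>, of the angle from \<open>e1\<close> to the
  outward unit normal \<open>n = cos \<mu> e1 + sin \<mu> e2\<close>. With this sign, \<open>d\<mu> - k ds\<close> is the restriction of the
  connection form \<open>\<langle>\<nabla> e2, e1\<rangle>\<close> to the boundary.\<close>

definition normal_angle ::
  "'m chart set \<Rightarrow> 'm set set \<Rightarrow> ('m set \<Rightarrow> real^2 \<Rightarrow> 'm) \<Rightarrow> ('m chart \<Rightarrow> real^2 \<Rightarrow> real^2^2) \<Rightarrow>
   ('m chart \<Rightarrow> real^2 \<Rightarrow> real^2) \<Rightarrow> ('m chart \<Rightarrow> real^2 \<Rightarrow> real^2) \<Rightarrow> ('m set \<Rightarrow> 'm \<Rightarrow> real) \<Rightarrow> bool" where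
  "normal_angle \<A> \<T> \<phi> g e1 e2 \<mu> \<longleftrightarrow>
     (\<forall>e\<in>boundary_edges \<A> \<T> \<phi>. \<forall>(T, k)\<in>sides \<T> \<phi> e.
        smooth_on {0..1} (\<lambda>s. \<mu> e (\<phi> T (ref_path k s))) \<and>
        (\<forall>s\<in>{0..1}. \<forall>c\<in>\<A>. let x = ref_path k s; p = \<phi> T x in
           p \<in> fst c \<longrightarrow>
           jac ref_tri (snd c \<circ> \<phi> T) x *v side_normal (pulled_metric \<phi> g c T) k x
           = cos (\<mu> e p) *\<^sub>R e1 c (snd c p) + sin (\<mu> e p) *\<^sub>R e2 c (snd c p)))"

text \<open>The boundary edges that start and end at the boundary vertex \<open>p\<close>, in the boundary orientation;
  they lie on the counterclockwise and clockwise side of \<open>p\<close>, respectively.\<close>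

definition ccw_edge :: "'m chart set \<Rightarrow> 'm set set \<Rightarrow> ('m set \<Rightarrow> real^2 \<Rightarrow> 'm) \<Rightarrow> 'm \<Rightarrow> 'm set" where
  "ccw_edge \<A> \<T> \<phi> p = (THE e. e \<in> boundary_edges \<A> \<T> \<phi> \<and>
     (\<exists>(T, k)\<in>sides \<T> \<phi> e. \<phi> T (ref_path k 0) = p))"

definition cw_edge :: "'m chart set \<Rightarrow> 'm set set \<Rightarrow> ('m set \<Rightarrow> real^2 \<Rightarrow> 'm) \<Rightarrow> 'm \<Rightarrow> 'm set" where
  "cw_edge \<A> \<T> \<phi> p = (THE e. e \<in> boundary_edges \<A> \<T> \<phi> \<and>
     (\<exists>(T, k)\<in>sides \<T> \<phi> e. \<phi> T (ref_path k 1) = p))"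

text \<open>Angles are defined modulo \<open>2 * pi\<close>, and the branches on different edges are unrelated. Hence the
  jump at \<open>p\<close> is a real representative of the difference of the one-sided values. Both the
  difference of the chosen branches and its representative in \<open>(-pi, pi]\<close> are allowed.\<close>

definition angle_jump ::
  "'m chart set \<Rightarrow> 'm set set \<Rightarrow> ('m set \<Rightarrow> real^2 \<Rightarrow> 'm) \<Rightarrow> ('m set \<Rightarrow> 'm \<Rightarrow> real) \<Rightarrow> ('m \<Rightarrow> real) \<Rightarrow> bool" where
  "angle_jump \<A> \<T> \<phi> \<mu> \<mu>J \<longleftrightarrow>
     (\<forall>p\<in>verts \<T> \<phi> \<inter> mboundary \<A>. \<exists>m::int.
        \<mu>J p = \<mu> (ccw_edge \<A> \<T> \<phi> p) p - \<mu> (cw_edge \<A> \<T> \<phi> p) p + 2 * pi * of_int m)"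

definition alpha_dist ::
  "'m chart set \<Rightarrow> 'm set set \<Rightarrow> ('m set \<Rightarrow> real^2 \<Rightarrow> 'm) \<Rightarrow> ('m set \<Rightarrow> 'm \<Rightarrow> real) \<Rightarrow> ('m \<Rightarrow> real) \<Rightarrow>
   ('m set \<Rightarrow> real^2 \<Rightarrow> real^2^2) \<Rightarrow> ('m \<Rightarrow> real) \<Rightarrow> real" where
  "alpha_dist \<A> \<T> \<phi> \<mu> \<mu>J g v =
     (\<Sum>e\<in>boundary_edges \<A> \<T> \<phi>. \<Sum>(T, k)\<in>sides \<T> \<phi> e.
        integral {0..1} (\<lambda>s. v (\<phi> T (ref_path k s)) *
          (vector_derivative (\<lambda>r. \<mu> e (\<phi> T (ref_path k r))) (at s within {0..1})
           - side_curvature (g T) k s * side_speed (g T) k s)))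
   - (\<Sum>p\<in>verts \<T> \<phi> \<inter> mboundary \<A>.
        v p * (pi - \<mu>J p - (\<Sum>(T, k)\<in>angles_at \<T> \<phi> p. vertex_angle (g T) k)))"


section \<open>The bilinear form\<close>

text \<open>The value \<open>(S \<sigma>)(n, n)\<close> at a point \<open>q\<close> of an edge, evaluated from the side \<open>(T,k)\<close>. Since
  \<open>(S \<sigma>)(n, n) = - \<sigma>(\<tau>, \<tau>)\<close> for a unit tangent \<open>\<tau>\<close>, it does not depend on the side if the
  tangential-tangential components of \<open>g\<close> and \<open>\<sigma>\<close> are single-valued.\<close>

definition S_nn ::
  "('m set \<Rightarrow> real^2 \<Rightarrow> 'm) \<Rightarrow> ('m set \<Rightarrow> real^2 \<Rightarrow> real^2^2) \<Rightarrow> ('m set \<Rightarrow> real^2 \<Rightarrow> real^2^2) \<Rightarrow>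
   'm set \<times> 3 \<Rightarrow> 'm \<Rightarrow> real" where
  "S_nn \<phi> g \<sigma> = (\<lambda>(T, k) q. let x = tri_point \<phi> T q; n = side_normal (g T) k x in
     bil (S_op (g T x) (\<sigma> T x)) n n)"

definition dv_jump ::
  "'m set set \<Rightarrow> ('m set \<Rightarrow> real^2 \<Rightarrow> 'm) \<Rightarrow> ('m set \<Rightarrow> real^2 \<Rightarrow> real^2^2) \<Rightarrow> ('m \<Rightarrow> real) \<Rightarrow>
   'm set \<Rightarrow> 'm \<Rightarrow> real" where
  "dv_jump \<T> \<phi> g v e q = (\<Sum>(T, k)\<in>sides \<T> \<phi> e. let x = tri_point \<phi> T q in
     frechet_derivative (v \<circ> \<phi> T) (at x within ref_tri) (side_normal (g T) k x))"

text \<open>Integration of a function along an edge with respect to arclength, in the parametrization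
  coming from the side \<open>(T,k)\<close>.\<close>

definition edge_integral ::
  "('m set \<Rightarrow> real^2 \<Rightarrow> 'm) \<Rightarrow> ('m set \<Rightarrow> real^2 \<Rightarrow> real^2^2) \<Rightarrow> 'm set \<times> 3 \<Rightarrow> ('m \<Rightarrow> real) \<Rightarrow> real" where
  "edge_integral \<phi> g = (\<lambda>(T, k) F.
     integral {0..1} (\<lambda>s. F (\<phi> T (ref_path k s)) * side_speed (g T) k s))"

definition b_form ::
  "'m set set \<Rightarrow> ('m set \<Rightarrow> real^2 \<Rightarrow> 'm) \<Rightarrow> ('m set \<Rightarrow> real^2 \<Rightarrow> real^2^2) \<Rightarrow>
   ('m set \<Rightarrow> real^2 \<Rightarrow> real^2^2) \<Rightarrow> ('m \<Rightarrow> real) \<Rightarrow> real" where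
  "b_form \<T> \<phi> g \<sigma> v =
     (\<Sum>T\<in>\<T>. tri_integral (g T)
        (\<lambda>x. inner_g (g T x) (S_op (g T x) (\<sigma> T x)) (hessian ref_tri (g T) (v \<circ> \<phi> T) x)))
   - (\<Sum>e\<in>edges \<T> \<phi>. let side = (SOME side. side \<in> sides \<T> \<phi> e) in
        edge_integral \<phi> g side (\<lambda>q. S_nn \<phi> g \<sigma> side q * dv_jump \<T> \<phi> g v e q))"


section \<open>Families of Regge metrics\<close>

text \<open>A smooth curve of smooth tensor fields on a closed triangle is the same as a jointly smooth
  function of time and position.\<close>

definition smooth_regge_family ::
  "'m set set \<Rightarrow> ('m set \<Rightarrow> real^2 \<Rightarrow> 'm) \<Rightarrow> (real \<Rightarrow> 'm set \<Rightarrow> real^2 \<Rightarrow> real^2^2) \<Rightarrow> bool" where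
  "smooth_regge_family \<T> \<phi> G \<longleftrightarrow>
     (\<forall>t\<in>{0..1}. regge_metric \<T> \<phi> (G t)) \<and>
     (\<forall>T\<in>\<T>. smooth_on ({0..1} \<times> ref_tri) (\<lambda>(t, x). G t T x))"

definition time_derivative ::
  "(real \<Rightarrow> 'm set \<Rightarrow> real^2 \<Rightarrow> real^2^2) \<Rightarrow> real \<Rightarrow> 'm set \<Rightarrow> real^2 \<Rightarrow> real^2^2" where
  "time_derivative G t T x = vector_derivative (\<lambda>r. G r T x) (at t within {0..1})"

end

theory Submission
  imports Defs
begin

text \<open>The statement is local. Each edge is either a boundary edge or an interior edge, so the edge terms of
\<open>alpha_dist\<close> and \<open>K_dist\<close> together run exactly once over all pairs of a triangle and one of its
sides, and the angle terms run once over all corners of triangles. Hence \<open>alpha_dist - K_dist\<close> is, up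
to a constant that does not involve the Regge metric, minus the sum over the triangles \<open>T\<close> of

\<open>\<integral>\<^bsub>T\<^esub> V K dA + \<Sum>\<^bsub>k\<^esub> \<integral> V k ds - \<Sum>\<^bsub>k\<^esub> V(p\<^sub>k) \<theta>\<^sub>k\<close>,

where \<open>V\<close> is \<open>v\<close> in the coordinates of the reference triangle (\<open>triangle_functional\<close>, \<open>alpha_minus_K\<close>).
It remains to differentiate this functional for one triangle with a smooth family of metrics.

The second derivatives of the metric in \<open>K\<close> are removed first. Let \<open>\<beta>\<close> be the connection form
\<open>\<langle>\<nabla> e\<^sub>2, e\<^sub>1\<rangle>\<close> of the oriented orthonormal frame with \<open>e\<^sub>2 = \<partial>\<^sub>2 / |\<partial>\<^sub>2|\<close>. Then \<open>K dA = d\<beta>\<close>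
(\<open>gauss_curvature_exact\<close>), and along a side \<open>k ds + \<beta> = d\<vartheta>\<close>, where \<open>\<vartheta>\<close> is the angle from \<open>\<partial>\<^sub>2\<close> to the
side (\<open>has_derivative_coangle_side\<close>). Green's theorem and integration by parts along the sides turn the
functional into

\<open>- \<integral>\<^bsub>T\<^esub> dV \<and> \<beta> - \<Sum> \<integral> \<vartheta> dV\<close> + corner terms

(\<open>triangle_functional_eq\<close>); the factor multiplying \<open>V(p\<^sub>k)\<close> is an angle sum whose value does not
change with time (\<open>corner_defect_derivative\<close>).

Now let the metric \<open>g\<close> move with velocity \<open>\<sigma>\<close>, and let \<open>rot d\<close> be the rate at which a fixed direction
\<open>d\<close> turns. With the rotation \<open>J\<close> by a right angle, the 1-form
\<open>\<eta> = 1/2 \<sigma>(\<cdot>, J \<nabla>V) - rot \<partial>\<^sub>2 dV\<close> satisfies two pointwise identities: on the triangle,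
\<open>- dV \<and> \<beta>' = 1/2 \<langle>S \<sigma>, \<nabla>\<nabla>V\<rangle> dA + d\<eta>\<close> for the time derivative \<open>\<beta>'\<close> (\<open>interior_identity\<close>), and on a
side with tangent \<open>d\<close>, \<open>\<eta>(d) - (rot d - rot \<partial>\<^sub>2) dV(d) = - 1/2 (S \<sigma>)(n, n) dV(n) |d|\<close>
(\<open>boundary_identity\<close>). A second application of Green's theorem gives half the contribution of the
triangle to \<open>b_h\<close> (\<open>triangle_functional_derivative\<close>).

Summing over triangles produces \<open>b_h\<close> because \<open>(S \<sigma>)(n, n) = - \<sigma>(d, d) / g(d, d)\<close> and the arclength only
depend on tangential-tangential components. The parametrizations of an edge by its two sides differ by
a differentiable change of variables, under which these quantities transform correctly
(\<open>side_reparametrization\<close>, \<open>side_transfer\<close>).\<close>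

section \<open>Partial derivatives on convex sets\<close>

abbreviation has_partials :: "('a::euclidean_space \<Rightarrow> 'b::real_normed_vector) \<Rightarrow> ('a \<Rightarrow> 'a \<Rightarrow> 'b) \<Rightarrow> 'a \<Rightarrow> 'a set \<Rightarrow>
    bool" where
  "has_partials f D x S \<equiv> (f has_derivative (\<lambda>h. \<Sum>i\<in>Basis. (h \<bullet> i) *\<^sub>R D i x)) (at x within S)"

text \<open>At a corner of the set the derivative is only tested along directions pointing into the set. These
are the vectors \<open>y - x\<close> with \<open>y\<close> in the set; they contain a ball around some vector and thus span the space.\<close>

lemma has_derivative_unique_on_convex:
  fixes f :: "'a::euclidean_space \<Rightarrow> 'b::real_normed_vector"
  assumes S: "convex S" "interior S \<noteq> {}" "x \<in> S"
    and f': "(f has_derivative f') (at x within S)"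
    and f'': "(f has_derivative f'') (at x within S)"
  shows "f' = f''"
proof -
  define L where "L h = f' h - f'' h" for h
  have L: "((\<lambda>y. f y - f y) has_derivative L) (at x within S)"
    unfolding L_def by (intro has_derivative_diff f' f'')
  then have linL: "linear L" by (rule has_derivative_linear)
  have zero: "L (y - x) = 0" if "y \<in> S" for y
  proof -
    let ?p = "\<lambda>s::real. x + s *\<^sub>R (y - x)"
    have p: "(?p has_derivative (\<lambda>s. s *\<^sub>R (y - x))) (at 0 within {0..1})"
      by (auto intro!: derivative_eq_intros)
    have sub: "?p ` {0..1} \<subseteq> S"
    proof (rule image_subsetI)
      fix s :: real assume s: "s \<in> {0..1}"
      have "(1 - s) *\<^sub>R x + s *\<^sub>R y \<in> S"
        using S(1) \<open>x \<in> S\<close> \<open>y \<in> S\<close> s by (intro convexD) auto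
      then show "?p s \<in> S" by (simp add: algebra_simps)
    qed
    have L0: "((\<lambda>y. f y - f y) has_derivative L) (at (?p 0) within ?p ` {0..1})"
      using has_derivative_subset[OF L sub] by simp
    have "((\<lambda>s. f (?p s) - f (?p s)) has_derivative (\<lambda>s. L (s *\<^sub>R (y - x)))) (at 0 within {0..1})"
      using has_derivative_in_compose[OF p L0] by simp
    then have "((\<lambda>s::real. 0) has_derivative (\<lambda>s. s *\<^sub>R L (y - x))) (at 0 within {0..1})"
      by (simp add: linear_scale[OF linL])
    then have "((\<lambda>s::real. 0) has_vector_derivative L (y - x)) (at 0 within {0..1})"
      by (simp add: has_vector_derivative_def)
    moreover have "((\<lambda>s::real. 0) has_vector_derivative (0::'b)) (at 0 within {0..1})"
      by (rule has_vector_derivative_const)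
    ultimately show ?thesis
      by (rule vector_derivative_unique_within[rotated]) (simp add: trivial_limit_within)
  qed
  obtain z e where e: "e > 0" "ball z e \<subseteq> S"
    using S(2) by (metis all_not_in_conv mem_interior)
  have "L h = 0" for h
  proof (cases "h = 0")
    case False
    define c where "c = e / (2 * norm h)"
    have c: "c > 0" using e False by (simp add: c_def)
    have "norm (c *\<^sub>R h) < e" using e False by (simp add: c_def)
    then have "z + c *\<^sub>R h \<in> S" "z \<in> S"
      using e by (auto simp: dist_norm subset_iff)
    then have "L (z + c *\<^sub>R h - x) - L (z - x) = 0" by (simp add: zero)
    then have "L (c *\<^sub>R h) = 0" by (simp flip: linear_diff[OF linL])
    then have "c *\<^sub>R L h = 0" by (simp add: linear_scale[OF linL])
    then show ?thesis using c by simp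
  qed (simp add: linear_0[OF linL])
  then show ?thesis by (auto simp: L_def fun_eq_iff)
qed

text \<open>The second difference is symmetric in the two variables, while the right-hand side is a mixed partial
derivative taken in a definite order. This gives the symmetry of mixed partial derivatives.\<close>

lemma second_difference_mean_value:
  fixes F F' G' :: "real \<Rightarrow> real \<Rightarrow> real"
  assumes h: "0 < h"
    and F': "\<And>s r. 0 \<le> s \<Longrightarrow> s \<le> h \<Longrightarrow> 0 \<le> r \<Longrightarrow> r \<le> h \<Longrightarrow> ((\<lambda>s. F s r) has_real_derivative F' s r) (at s)"
    and G': "\<And>s r. 0 \<le> s \<Longrightarrow> s \<le> h \<Longrightarrow> 0 \<le> r \<Longrightarrow> r \<le> h \<Longrightarrow> (F' s has_real_derivative G' s r) (at r)"
  shows "\<exists>s r. 0 < s \<and> s < h \<and> 0 < r \<and> r < h \<and> F h h - F h 0 - F 0 h + F 0 0 = h * h * G' s r"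
proof -
  have "\<exists>s>0. s < h \<and> (F h h - F h 0) - (F 0 h - F 0 0) = (h - 0) * (F' s h - F' s 0)"
    by (rule MVT2[OF h, where f = "\<lambda>s. F s h - F s 0"]) (auto intro!: DERIV_diff F' simp: h less_imp_le)
  then obtain s where s: "0 < s" "s < h" "(F h h - F h 0) - (F 0 h - F 0 0) = h * (F' s h - F' s 0)" by auto
  have "\<exists>r>0. r < h \<and> F' s h - F' s 0 = (h - 0) * G' s r"
    by (rule MVT2[OF h]) (use s in \<open>auto intro!: G'\<close>)
  then obtain r where "0 < r" "r < h" "F' s h - F' s 0 = h * G' s r" by auto
  with s show ?thesis by (intro exI[of _ s] exI[of _ r]) auto
qed

lemma has_derivative_along_line:
  fixes f :: "'a::real_normed_vector \<Rightarrow> real"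
  assumes f: "(f has_derivative f') (at (y + s *\<^sub>R i))"
  shows "((\<lambda>r. f (y + r *\<^sub>R i)) has_real_derivative f' i) (at s)"
proof -
  have "((\<lambda>r::real. y + r *\<^sub>R i) has_derivative (\<lambda>r. r *\<^sub>R i)) (at s)"
    by (auto intro!: derivative_eq_intros)
  from has_derivative_compose[OF this f]
  have "((\<lambda>r. f (y + r *\<^sub>R i)) has_derivative (\<lambda>r. f' (r *\<^sub>R i))) (at s)" .
  then show ?thesis
    using linear_scale[OF has_derivative_linear[OF f]]
    by (simp add: has_field_derivative_def mult.commute[of _ "f' i"])
qed

lemma sum_Basis_coordinate:
  fixes F :: "'a::euclidean_space \<Rightarrow> 'b::real_normed_vector"
  assumes "b \<in> Basis"
  shows "(\<Sum>i\<in>Basis. (b \<bullet> i) *\<^sub>R F i) = F b"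
proof -
  have "(\<Sum>i\<in>Basis. (b \<bullet> i) *\<^sub>R F i) = (\<Sum>i\<in>Basis. if b = i then F i else 0)"
    by (rule sum.cong) (auto simp: inner_Basis assms)
  then show ?thesis using assms by simp
qed

lemma mixed_partials_commute_interior:
  fixes f :: "'a::euclidean_space \<Rightarrow> real"
  assumes i: "i \<in> Basis" and j: "j \<in> Basis" and x: "x \<in> interior U"
    and D: "\<And>x. x \<in> U \<Longrightarrow> has_partials f D x U"
    and DD: "\<And>x i. x \<in> U \<Longrightarrow> i \<in> Basis \<Longrightarrow> has_partials (D i) (DD i) x U"
    and cont: "\<And>i j. i \<in> Basis \<Longrightarrow> j \<in> Basis \<Longrightarrow> continuous_on U (DD i j)"
  shows "DD i j x = DD j i x"
proof (rule ccontr)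
  assume neq: "DD i j x \<noteq> DD j i x"
  define e where "e = \<bar>DD i j x - DD j i x\<bar> / 2"
  have e: "e > 0" using neq by (simp add: e_def)
  have cI: "isCont (DD a b) x" if "a \<in> Basis" "b \<in> Basis" for a b
    using cont[OF that] x by (rule continuous_on_interior)
  obtain d1 where d1: "d1 > 0" "\<And>y. dist y x < d1 \<Longrightarrow> dist (DD i j y) (DD i j x) < e"
    using cI[OF i j] e unfolding continuous_at_eps_delta by blast
  obtain d2 where d2: "d2 > 0" "\<And>y. dist y x < d2 \<Longrightarrow> dist (DD j i y) (DD j i x) < e"
    using cI[OF j i] e unfolding continuous_at_eps_delta by blast
  obtain d3 where d3: "d3 > 0" "ball x d3 \<subseteq> interior U"
    using x open_interior openE by blast
  define d where "d = min d1 (min d2 d3)"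
  have d: "d > 0" using d1 d2 d3 by (simp add: d_def)
  \<comment> \<open>Both steps of length \<open>h\<close> together stay inside the ball of radius \<open>d\<close>.\<close>
  define h where "h = d / 3"
  have h: "h > 0" using d by (simp add: h_def)
  have near: "dist (x + s *\<^sub>R a + r *\<^sub>R b) x < d"
    if "0 \<le> s" "s \<le> h" "0 \<le> r" "r \<le> h" "a \<in> Basis" "b \<in> Basis" for s r and a b :: 'a
  proof -
    have "dist (x + s *\<^sub>R a + r *\<^sub>R b) x = norm (s *\<^sub>R a + r *\<^sub>R b)" by (simp add: dist_norm)
    also have "\<dots> \<le> norm (s *\<^sub>R a) + norm (r *\<^sub>R b)" by (rule norm_triangle_ineq)
    also have "\<dots> = s + r" using that by simp
    finally show ?thesis using that d by (simp add: h_def)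
  qed
  have int: "y \<in> interior U" if "dist y x < d" for y
    using d3(2) that by (auto simp: d_def dist_commute subset_iff)
  have D': "(f has_derivative (\<lambda>h. \<Sum>i\<in>Basis. (h \<bullet> i) *\<^sub>R D i y)) (at y)" if "y \<in> interior U" for y
    using D[OF subsetD[OF interior_subset that]] unfolding at_within_interior[OF that] .
  have DD': "(D i has_derivative (\<lambda>h. \<Sum>j\<in>Basis. (h \<bullet> j) *\<^sub>R DD i j y)) (at y)"
    if "y \<in> interior U" "i \<in> Basis" for y i
    using DD[OF subsetD[OF interior_subset that(1)] that(2)] unfolding at_within_interior[OF that(1)] .
  have key: "\<exists>y. dist y x < d \<and>
      f (x + h *\<^sub>R a + h *\<^sub>R b) - f (x + h *\<^sub>R a) - f (x + h *\<^sub>R b) + f x = h * h * DD a b y"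
    if ab: "a \<in> Basis" "b \<in> Basis" for a b
  proof -
    have "\<exists>s r. 0 < s \<and> s < h \<and> 0 < r \<and> r < h \<and>
        f (x + h *\<^sub>R a + h *\<^sub>R b) - f (x + h *\<^sub>R a + 0 *\<^sub>R b) - f (x + 0 *\<^sub>R a + h *\<^sub>R b)
        + f (x + 0 *\<^sub>R a + 0 *\<^sub>R b) = h * h * DD a b (x + s *\<^sub>R a + r *\<^sub>R b)"
    proof (rule second_difference_mean_value[OF h, where F = "\<lambda>s r. f (x + s *\<^sub>R a + r *\<^sub>R b)"
          and F' = "\<lambda>s r. D a (x + s *\<^sub>R a + r *\<^sub>R b)"])
      fix s r assume sr: "0 \<le> s" "s \<le> h" "0 \<le> r" "r \<le> h"
      have y: "x + s *\<^sub>R a + r *\<^sub>R b \<in> interior U" using near[OF sr ab] int by blast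
      have "((\<lambda>s. f ((x + r *\<^sub>R b) + s *\<^sub>R a)) has_real_derivative
          (\<Sum>i\<in>Basis. (a \<bullet> i) *\<^sub>R D i ((x + r *\<^sub>R b) + s *\<^sub>R a))) (at s)"
        by (rule has_derivative_along_line) (use D'[OF y] in \<open>simp add: algebra_simps\<close>)
      then show "((\<lambda>s. f (x + s *\<^sub>R a + r *\<^sub>R b)) has_real_derivative D a (x + s *\<^sub>R a + r *\<^sub>R b)) (at s)"
        unfolding sum_Basis_coordinate[OF ab(1)] by (simp add: add_ac)
      have "((\<lambda>r. D a ((x + s *\<^sub>R a) + r *\<^sub>R b)) has_real_derivative
          (\<Sum>j\<in>Basis. (b \<bullet> j) *\<^sub>R DD a j ((x + s *\<^sub>R a) + r *\<^sub>R b))) (at r)"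
        by (rule has_derivative_along_line) (use DD'[OF y ab(1)] in \<open>simp add: algebra_simps\<close>)
      then show "((\<lambda>r. D a (x + s *\<^sub>R a + r *\<^sub>R b)) has_real_derivative DD a b (x + s *\<^sub>R a + r *\<^sub>R b)) (at r)"
        unfolding sum_Basis_coordinate[OF ab(2)] by (simp add: add_ac)
    qed
    then obtain s r where sr: "0 < s" "s < h" "0 < r" "r < h" and eq:
      "f (x + h *\<^sub>R a + h *\<^sub>R b) - f (x + h *\<^sub>R a) - f (x + h *\<^sub>R b) + f x
        = h * h * DD a b (x + s *\<^sub>R a + r *\<^sub>R b)" by auto
    then show ?thesis using near[of s r a b] ab
      by (intro exI[of _ "x + s *\<^sub>R a + r *\<^sub>R b"]) auto
  qed
  obtain y where y: "dist y x < d" "f (x + h *\<^sub>R i + h *\<^sub>R j) - f (x + h *\<^sub>R i) - f (x + h *\<^sub>R j) + f x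
      = h * h * DD i j y"
    using key[OF i j] by blast
  obtain z where z: "dist z x < d" "f (x + h *\<^sub>R j + h *\<^sub>R i) - f (x + h *\<^sub>R j) - f (x + h *\<^sub>R i) + f x
      = h * h * DD j i z"
    using key[OF j i] by blast
  have swap: "x + h *\<^sub>R j + h *\<^sub>R i = x + h *\<^sub>R i + h *\<^sub>R j" by simp
  have "h * h * DD i j y = h * h * DD j i z" using y(2) z(2)[unfolded swap] by linarith
  then have "DD i j y = DD j i z" using h by simp
  moreover have "dist (DD i j y) (DD i j x) < e" "dist (DD j i z) (DD j i x) < e"
    using d1(2)[of y] d2(2)[of z] y z by (auto simp: d_def)
  ultimately show False by (simp add: e_def dist_real_def abs_if split: if_splits)
qed

text \<open>Smoothness on a closed triangle refers to derivatives up to the boundary. There the symmetry follows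
by continuity, the interior being dense in a convex set with interior points.\<close>

lemma mixed_partials_commute:
  fixes f :: "'a::euclidean_space \<Rightarrow> real"
  assumes U: "convex U" "interior U \<noteq> {}"
    and i: "i \<in> Basis" and j: "j \<in> Basis" and x: "x \<in> U"
    and D: "\<And>x. x \<in> U \<Longrightarrow> has_partials f D x U"
    and DD: "\<And>x i. x \<in> U \<Longrightarrow> i \<in> Basis \<Longrightarrow> has_partials (D i) (DD i) x U"
    and cont: "\<And>i j. i \<in> Basis \<Longrightarrow> j \<in> Basis \<Longrightarrow> continuous_on U (DD i j)"
  shows "DD i j x = DD j i x"
proof -
  have "x \<in> closure (interior U)"
    using convex_closure_interior[OF U] x closure_subset by blast
  then obtain y where y: "\<And>n. y n \<in> interior U" "y \<longlonglongrightarrow> x"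
    using closure_sequential by blast
  have "(\<lambda>n. DD a b (y n)) \<longlonglongrightarrow> DD a b x" if "a \<in> Basis" "b \<in> Basis" for a b
    using cont[OF that] x y interior_subset unfolding continuous_on_sequentially comp_def by blast
  from LIMSEQ_unique[OF this[OF i j]] this[OF j i]
  show ?thesis using mixed_partials_commute_interior[OF i j y(1) D DD cont] by auto
qed

section \<open>The reference triangle and calculus of its partial derivatives\<close>

lemma Basis_real2: "(Basis :: (real^2) set) = {axis 1 1, axis 2 1}"
  by (auto simp: Basis_vec_def exhaust_2) (metis exhaust_2)

lemma axis_1_neq_axis_2: "axis 1 (1::real) \<noteq> (axis 2 1 :: real^2)"
  by (simp add: axis_eq_axis)

lemma sum_Basis_real2: "(\<Sum>i\<in>(Basis :: (real^2) set). F i) = F (axis 1 1) + F (axis 2 1)"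
  by (simp add: Basis_real2 axis_1_neq_axis_2)

lemma range_ref_vertex: "range ref_vertex = {0, axis 1 1, axis 2 1}"
proof -
  have "range ref_vertex = ref_vertex ` {1, 2, 3}" by (simp add: UNIV_3)
  then show ?thesis by (auto simp: ref_vertex_def)
qed

lemma mem_ref_tri: "x \<in> ref_tri \<longleftrightarrow> 0 \<le> x $ 1 \<and> 0 \<le> x $ 2 \<and> x $ 1 + x $ 2 \<le> 1"
proof
  assume "x \<in> ref_tri"
  then obtain a b c where "0 \<le> a" "0 \<le> b" "0 \<le> c" "a + b + c = 1"
    "x = a *\<^sub>R 0 + b *\<^sub>R axis 1 1 + c *\<^sub>R axis 2 1"
    by (auto simp: ref_tri_def range_ref_vertex convex_hull_3)
  then show "0 \<le> x $ 1 \<and> 0 \<le> x $ 2 \<and> x $ 1 + x $ 2 \<le> 1" by (simp add: axis_def)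
next
  assume x: "0 \<le> x $ 1 \<and> 0 \<le> x $ 2 \<and> x $ 1 + x $ 2 \<le> 1"
  have "x = (1 - x $ 1 - x $ 2) *\<^sub>R 0 + (x $ 1) *\<^sub>R axis 1 1 + (x $ 2) *\<^sub>R axis 2 1"
    by (simp add: vec_eq_iff forall_2 axis_def)
  then show "x \<in> ref_tri"
    using x unfolding ref_tri_def range_ref_vertex convex_hull_3
    by (intro CollectI exI[of _ "1 - x $ 1 - x $ 2"] exI[of _ "x $ 1"] exI[of _ "x $ 2"]) auto
qed

lemma convex_ref_tri: "convex ref_tri"
  by (simp add: ref_tri_def)

lemma compact_ref_tri: "compact ref_tri"
  by (simp add: ref_tri_def range_ref_vertex finite_imp_compact compact_convex_hull)

lemma interior_ref_tri: "interior ref_tri \<noteq> {}"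
proof -
  have "open {x::real^2. 0 < x $ 1 \<and> 0 < x $ 2 \<and> x $ 1 + x $ 2 < 1}"
    by (intro open_Collect_conj open_Collect_less continuous_intros)
  then have "{x::real^2. 0 < x $ 1 \<and> 0 < x $ 2 \<and> x $ 1 + x $ 2 < 1} \<subseteq> interior ref_tri"
    by (intro interior_maximal) (auto simp: mem_ref_tri)
  moreover have "(vector [1/4, 1/4] :: real^2) \<in> {x. 0 < x $ 1 \<and> 0 < x $ 2 \<and> x $ 1 + x $ 2 < 1}"
    by simp
  ultimately show ?thesis by blast
qed

lemma ref_vertex_in_ref_tri: "ref_vertex k \<in> ref_tri"
  by (auto simp: ref_tri_def intro: hull_inc)

lemma ref_path_in_ref_tri: "s \<in> {0..1} \<Longrightarrow> ref_path k s \<in> ref_tri"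
  using convex_ref_tri ref_vertex_in_ref_tri[of "k+1"] ref_vertex_in_ref_tri[of "k+2"]
  unfolding ref_path_def linepath_def by (auto intro!: convexD)

text \<open>On the triangle any representation of the derivative computes \<open>pd\<close>. All rules for \<open>pd\<close> below hold up to
the vertices for this reason.\<close>

lemma pd_eqI:
  assumes "x \<in> ref_tri" "(f has_derivative f') (at x within ref_tri)"
  shows "pd ref_tri i f x = f' (axis i 1)"
proof -
  have "(f has_derivative frechet_derivative f (at x within ref_tri)) (at x within ref_tri)"
    using assms frechet_derivative_works differentiableI by blast
  from has_derivative_unique_on_convex[OF convex_ref_tri interior_ref_tri assms(1) this assms(2)]
  show ?thesis by (simp add: pd_def)
qed

lemma has_derivative_pd:
  fixes f :: "real^2 \<Rightarrow> 'b::real_normed_vector"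
  assumes "f differentiable (at x within ref_tri)"
  shows "(f has_derivative (\<lambda>h. h $ 1 *\<^sub>R pd ref_tri 1 f x + h $ 2 *\<^sub>R pd ref_tri 2 f x)) (at x within ref_tri)"
proof -
  let ?L = "frechet_derivative f (at x within ref_tri)"
  have L: "(f has_derivative ?L) (at x within ref_tri)" using assms frechet_derivative_works by blast
  have E: "?L h = h $ 1 *\<^sub>R ?L (axis 1 1) + h $ 2 *\<^sub>R ?L (axis 2 1)" for h
  proof -
    have "h = h $ 1 *\<^sub>R axis 1 1 + h $ 2 *\<^sub>R axis 2 1"
      by (simp add: vec_eq_iff forall_2 axis_def)
    then have "?L h = ?L (h $ 1 *\<^sub>R axis 1 1 + h $ 2 *\<^sub>R axis 2 1)" by simp
    then show ?thesis
      using has_derivative_linear[OF L] by (simp add: linear_add linear_scale)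
  qed
  have eq: "(\<lambda>h. h $ 1 *\<^sub>R ?L (axis 1 1) + h $ 2 *\<^sub>R ?L (axis 2 1)) = ?L"
    by (rule ext) (rule E[symmetric])
  show ?thesis unfolding pd_def eq by (rule L)
qed

lemma pd_const [simp]: "x \<in> ref_tri \<Longrightarrow> pd ref_tri i (\<lambda>x. c) x = 0"
  by (subst pd_eqI[OF _ has_derivative_const]) auto

lemma pd_bounded_linear:
  assumes "bounded_linear L" "x \<in> ref_tri" "f differentiable (at x within ref_tri)"
  shows "pd ref_tri i (\<lambda>x. L (f x)) x = L (pd ref_tri i f x)"
  using pd_eqI[OF assms(2) bounded_linear.has_derivative[OF assms(1)
        assms(3)[unfolded frechet_derivative_works]], of i]
  by (simp add: pd_def)

lemma pd_add:
  assumes "x \<in> ref_tri" "f differentiable (at x within ref_tri)" "g differentiable (at x within ref_tri)"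
  shows "pd ref_tri i (\<lambda>x. f x + g x) x = pd ref_tri i f x + pd ref_tri i g x"
  using pd_eqI[OF assms(1) has_derivative_add[OF assms(2,3)[unfolded frechet_derivative_works]], of i]
  by (simp add: pd_def)

lemma pd_diff:
  assumes "x \<in> ref_tri" "f differentiable (at x within ref_tri)" "g differentiable (at x within ref_tri)"
  shows "pd ref_tri i (\<lambda>x. f x - g x) x = pd ref_tri i f x - pd ref_tri i g x"
  using pd_eqI[OF assms(1) has_derivative_diff[OF assms(2,3)[unfolded frechet_derivative_works]], of i]
  by (simp add: pd_def)

lemma pd_mult:
  fixes f g :: "real^2 \<Rightarrow> real"
  assumes "x \<in> ref_tri" "f differentiable (at x within ref_tri)" "g differentiable (at x within ref_tri)"
  shows "pd ref_tri i (\<lambda>x. f x * g x) x = pd ref_tri i f x * g x + f x * pd ref_tri i g x"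
  using pd_eqI[OF assms(1) has_derivative_mult[OF assms(2,3)[unfolded frechet_derivative_works]], of i]
  by (simp add: pd_def)

lemma has_derivative_chain_real:
  fixes f :: "real^2 \<Rightarrow> real"
  assumes f: "f differentiable (at x within ref_tri)" and h: "(h has_real_derivative d) (at (f x))"
  shows "((\<lambda>x. h (f x)) has_derivative (\<lambda>v. d * frechet_derivative f (at x within ref_tri) v))
      (at x within ref_tri)"
  using has_derivative_compose[OF f[unfolded frechet_derivative_works] h[unfolded has_field_derivative_def]]
  by simp

lemma pd_chain:
  fixes f :: "real^2 \<Rightarrow> real"
  assumes x: "x \<in> ref_tri" and f: "f differentiable (at x within ref_tri)" and h: "(h has_real_derivative d)
      (at (f x))"
  shows "pd ref_tri i (\<lambda>x. h (f x)) x = d * pd ref_tri i f x"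
  using pd_eqI[OF x has_derivative_chain_real[OF f h]] by (simp add: pd_def)

lemma pd_inverse:
  fixes f :: "real^2 \<Rightarrow> real"
  assumes "x \<in> ref_tri" "f differentiable (at x within ref_tri)" "f x \<noteq> 0"
  shows "pd ref_tri i (\<lambda>x. inverse (f x)) x = - pd ref_tri i f x / (f x)\<^sup>2"
  using pd_chain[OF assms(1,2) DERIV_inverse[OF assms(3)]]
  by (simp add: power2_eq_square divide_inverse)

lemma pd_sqrt:
  fixes f :: "real^2 \<Rightarrow> real"
  assumes "x \<in> ref_tri" "f differentiable (at x within ref_tri)" "f x > 0"
  shows "pd ref_tri i (\<lambda>x. sqrt (f x)) x = pd ref_tri i f x / (2 * sqrt (f x))"
proof -
  have "pd ref_tri i (\<lambda>x. sqrt (f x)) x = inverse (sqrt (f x)) / 2 * pd ref_tri i f x"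
    by (rule pd_chain[OF assms(1,2) DERIV_real_sqrt[OF assms(3)]])
  also have "\<dots> = pd ref_tri i f x / (2 * sqrt (f x))" by (simp only: divide_inverse inverse_mult_distrib mult_ac)
  finally show ?thesis .
qed

lemma Ck_on_cong:
  assumes "\<And>x. x \<in> S \<Longrightarrow> f x = g x"
  shows "Ck_on k S f \<longleftrightarrow> Ck_on k S g"
proof (cases k)
  case 0 then show ?thesis using assms by (simp cong: continuous_on_cong)
next
  case (Suc n)
  have "(f has_derivative f') (at x within S) \<longleftrightarrow> (g has_derivative f') (at x within S)" if "x \<in> S" for f' x
    using has_derivative_transform[OF that, of g f f'] has_derivative_transform[OF that, of f g f'] assms
    by auto
  with Suc show ?thesis by simp
qed

lemma Ck_on_Suc_ref_tri:
  "Ck_on (Suc k) ref_tri f \<longleftrightarrow>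
     (\<forall>x\<in>ref_tri. f differentiable (at x within ref_tri)) \<and> (\<forall>i. Ck_on k ref_tri (pd ref_tri i f))"
proof
  assume "Ck_on (Suc k) ref_tri f"
  then obtain D where D: "\<And>x. x \<in> ref_tri \<Longrightarrow> has_partials f D x ref_tri"
    and CD: "\<And>i. i \<in> Basis \<Longrightarrow> Ck_on k ref_tri (D i)" by auto
  have "pd ref_tri i f x = D (axis i 1) x" if "x \<in> ref_tri" for x i
    using pd_eqI[OF that D[OF that]] by (simp add: sum_Basis_coordinate)
  then have "Ck_on k ref_tri (pd ref_tri i f)" for i
    using CD[of "axis i 1"] Ck_on_cong[of ref_tri "pd ref_tri i f" "D (axis i 1)" k] by auto
  then show "(\<forall>x\<in>ref_tri. f differentiable (at x within ref_tri)) \<and> (\<forall>i. Ck_on k ref_tri (pd ref_tri i f))"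
    using D differentiableI by blast
next
  assume *: "(\<forall>x\<in>ref_tri. f differentiable (at x within ref_tri)) \<and> (\<forall>i. Ck_on k ref_tri (pd ref_tri i f))"
  define D where "D b = (if b = axis 1 1 then pd ref_tri 1 f else pd ref_tri 2 f)" for b :: "real^2"
  have "has_partials f D x ref_tri" if "x \<in> ref_tri" for x
    using has_derivative_pd[of f x] * that axis_1_neq_axis_2
    by (simp add: sum_Basis_real2 D_def inner_axis)
  moreover have "\<forall>i\<in>Basis. Ck_on k ref_tri (D i)" using * by (simp add: D_def)
  ultimately show "Ck_on (Suc k) ref_tri f" by auto
qed

text \<open>The class \<open>Ck_on 1\<close> on the triangle, phrased with the canonical partial derivatives instead of an
existential quantifier, so that it can be combined with the rules for \<open>pd\<close>.\<close>

definition C1 :: "(real^2 \<Rightarrow> real) \<Rightarrow> bool" where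
  "C1 f \<longleftrightarrow> (\<forall>x\<in>ref_tri. f differentiable (at x within ref_tri)) \<and> (\<forall>i. continuous_on ref_tri (pd ref_tri i f))"

lemma C1_iff_Ck: "C1 f \<longleftrightarrow> Ck_on (Suc 0) ref_tri f"
  unfolding C1_def Ck_on_Suc_ref_tri by simp

lemma C1_differentiable: "C1 f \<Longrightarrow> x \<in> ref_tri \<Longrightarrow> f differentiable (at x within ref_tri)"
  by (simp add: C1_def)

lemma C1_continuous_pd: "C1 f \<Longrightarrow> continuous_on ref_tri (pd ref_tri i f)"
  by (simp add: C1_def)

lemma C1_continuous: "C1 f \<Longrightarrow> continuous_on ref_tri f"
  using C1_differentiable differentiable_imp_continuous_within
  unfolding continuous_on_eq_continuous_within by blast

lemma C1_const [intro]: "C1 (\<lambda>x. c)"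
  unfolding C1_def by (auto simp: cong: continuous_on_cong)

lemma C1_add [intro]: "C1 f \<Longrightarrow> C1 g \<Longrightarrow> C1 (\<lambda>x. f x + g x)"
  unfolding C1_def by (auto simp: pd_add cong: continuous_on_cong intro!: continuous_intros)

lemma C1_diff [intro]: "C1 f \<Longrightarrow> C1 g \<Longrightarrow> C1 (\<lambda>x. f x - g x)"
  unfolding C1_def by (auto simp: pd_diff cong: continuous_on_cong intro!: continuous_intros)

lemma C1_mult [intro]: "C1 f \<Longrightarrow> C1 g \<Longrightarrow> C1 (\<lambda>x. f x * g x)"
  using C1_continuous[of f] C1_continuous[of g]
  unfolding C1_def by (auto simp: pd_mult cong: continuous_on_cong intro!: continuous_intros)

lemma C1_inverse [intro]:
  assumes f: "C1 f" and pos: "\<And>x. x \<in> ref_tri \<Longrightarrow> f x \<noteq> 0"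
  shows "C1 (\<lambda>x. inverse (f x))"
  using C1_continuous[OF f] f pos
  unfolding C1_def by (auto simp: pd_inverse cong: continuous_on_cong intro!: continuous_intros
      differentiable_inverse)

lemma C1_sqrt [intro]:
  assumes f: "C1 f" and pos: "\<And>x. x \<in> ref_tri \<Longrightarrow> f x > 0"
  shows "C1 (\<lambda>x. sqrt (f x))"
proof -
  have "(\<lambda>x. sqrt (f x)) differentiable (at x within ref_tri)" if "x \<in> ref_tri" for x
    using has_derivative_chain_real[OF C1_differentiable[OF f that] DERIV_real_sqrt[OF pos[OF that]]]
    by (rule differentiableI)
  moreover have "continuous_on ref_tri (\<lambda>x. pd ref_tri i f x / (2 * sqrt (f x)))" for i
    by (intro continuous_intros C1_continuous_pd f C1_continuous) (use pos in force)
  moreover have "pd ref_tri i (\<lambda>x. sqrt (f x)) x = pd ref_tri i f x / (2 * sqrt (f x))" if "x \<in> ref_tri" for x i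
    by (rule pd_sqrt[OF that C1_differentiable[OF f that] pos[OF that]])
  ultimately show ?thesis unfolding C1_def by (auto cong: continuous_on_cong)
qed

lemma C1_divide [intro]: "C1 f \<Longrightarrow> C1 g \<Longrightarrow> (\<And>x. x \<in> ref_tri \<Longrightarrow> g x \<noteq> 0) \<Longrightarrow> C1 (\<lambda>x. f x / g x)"
  unfolding divide_inverse by (intro C1_mult C1_inverse)

lemma C1_cong: "(\<And>x. x \<in> ref_tri \<Longrightarrow> f x = g x) \<Longrightarrow> C1 f \<longleftrightarrow> C1 g"
  unfolding C1_iff_Ck by (rule Ck_on_cong)

lemma pd_cong:
  assumes "\<And>x. x \<in> ref_tri \<Longrightarrow> f x = g x" "x \<in> ref_tri"
  shows "pd ref_tri i f x = pd ref_tri i g x"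
proof -
  have "(f has_derivative f') (at x within ref_tri) \<longleftrightarrow> (g has_derivative f') (at x within ref_tri)" for f'
    using has_derivative_transform[OF assms(2), of g f f'] has_derivative_transform[OF assms(2), of f g f'] assms(1)
    by auto
  then show ?thesis unfolding pd_def frechet_derivative_def by simp
qed

definition C2 :: "(real^2 \<Rightarrow> real) \<Rightarrow> bool" where
  "C2 f \<longleftrightarrow> C1 f \<and> (\<forall>i. C1 (pd ref_tri i f))"

lemma C2_iff_Ck: "C2 f \<longleftrightarrow> Ck_on 2 ref_tri f"
proof -
  have "Ck_on 2 ref_tri f \<longleftrightarrow> (\<forall>x\<in>ref_tri. f differentiable (at x within ref_tri)) \<and> (\<forall>i. C1 (pd ref_tri i f))"
    unfolding numeral_2_eq_2 C1_iff_Ck Ck_on_Suc_ref_tri[of "Suc 0"] ..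
  also have "\<dots> \<longleftrightarrow> C2 f" unfolding C2_def using C1_continuous by (auto simp: C1_def)
  finally show ?thesis ..
qed

lemma C2_pd_commute:
  assumes f: "C2 f" and x: "x \<in> ref_tri"
  shows "pd ref_tri i (pd ref_tri j f) x = pd ref_tri j (pd ref_tri i f) x"
proof -
  define ix where "ix b = (if b = axis 1 1 then 1 else 2 :: 2)" for b :: "real^2"
  have ix: "ix (axis k 1) = k" for k
    using exhaust_2[of k] axis_1_neq_axis_2 by (auto simp: ix_def)
  have D: "(h has_derivative (\<lambda>v. \<Sum>i\<in>Basis. (v \<bullet> i) *\<^sub>R pd ref_tri (ix i) h x)) (at x within ref_tri)"
    if "C1 h" "x \<in> ref_tri" for h x
    using has_derivative_pd[OF C1_differentiable[OF that]]
    by (simp add: sum_Basis_real2 ix inner_axis)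
  have "pd ref_tri (ix (axis j 1)) (pd ref_tri (ix (axis i 1)) f) x
      = pd ref_tri (ix (axis i 1)) (pd ref_tri (ix (axis j 1)) f) x"
    by (rule mixed_partials_commute[OF convex_ref_tri interior_ref_tri _ _ x,
          where f = f and D = "\<lambda>b. pd ref_tri (ix b) f"
            and DD = "\<lambda>b c. pd ref_tri (ix c) (pd ref_tri (ix b) f)"])
      (use f in \<open>auto simp: C2_def simp del: real_scaleR_def intro!: D C1_continuous_pd\<close>)
  then show ?thesis by (simp add: ix)
qed

section \<open>Families of functions depending on time\<close>

lemma sum_Basis_time_space:
  "(\<Sum>i\<in>(Basis :: (real \<times> (real^2)) set). F i) = F (1, 0) + (\<Sum>i\<in>Basis. F (0, i))"
proof -
  have "(\<Sum>i\<in>(Basis :: (real \<times> (real^2)) set). F i)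
      = (\<Sum>i\<in>(\<lambda>u. (u, 0)) ` (Basis :: real set). F i) + (\<Sum>i\<in>Pair 0 ` (Basis :: (real^2) set). F i)"
    unfolding Basis_prod_def by (rule sum.union_disjoint) auto
  then show ?thesis by (simp add: sum.reindex inj_on_def)
qed

lemma has_derivative_slice_space:
  fixes F :: "real \<times> (real^2) \<Rightarrow> real"
  assumes F: "(F has_derivative (\<lambda>h. \<Sum>i\<in>Basis. (h \<bullet> i) *\<^sub>R D i (t, x))) (at (t, x) within I \<times> S)" and t: "t \<in> I"
  shows "((\<lambda>y. F (t, y)) has_derivative (\<lambda>h. \<Sum>i\<in>Basis. (h \<bullet> i) *\<^sub>R D (0, i) (t, x))) (at x within S)"
proof -
  have 1: "((\<lambda>y. (t, y)) has_derivative (\<lambda>h. (0, h))) (at x within S)"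
    by (auto intro!: derivative_eq_intros)
  have "(\<lambda>y. (t, y)) ` S \<subseteq> I \<times> S" using t by auto
  from has_derivative_in_compose[OF 1 has_derivative_subset[OF F this]]
  show ?thesis by (simp add: sum_Basis_time_space)
qed

lemma has_derivative_slice_time:
  fixes F :: "real \<times> (real^2) \<Rightarrow> real"
  assumes F: "(F has_derivative (\<lambda>h. \<Sum>i\<in>Basis. (h \<bullet> i) *\<^sub>R D i (t, x))) (at (t, x) within I \<times> S)" and x: "x \<in> S"
  shows "((\<lambda>r. F (r, x)) has_real_derivative D (1, 0) (t, x)) (at t within I)"
proof -
  have 1: "((\<lambda>r. (r, x)) has_derivative (\<lambda>h. (h, 0))) (at t within I)"
    by (auto intro!: derivative_eq_intros)
  have "(\<lambda>r. (r, x)) ` I \<subseteq> I \<times> S" using x by auto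
  from has_derivative_in_compose[OF 1 has_derivative_subset[OF F this]]
  show ?thesis by (simp add: sum_Basis_time_space has_field_derivative_def mult.commute[of _ "D (1, 0) (t, x)"])
qed

lemma C1_partials:
  assumes D: "\<And>x. x \<in> ref_tri \<Longrightarrow> has_partials f D x ref_tri"
    and cont: "\<And>i. i \<in> Basis \<Longrightarrow> continuous_on ref_tri (D i)"
  shows "C1 f" "\<And>i x. x \<in> ref_tri \<Longrightarrow> pd ref_tri i f x = D (axis i 1) x"
proof -
  show "C1 f" unfolding C1_iff_Ck using D cont by (auto intro!: exI[of _ D])
  show "pd ref_tri i f x = D (axis i 1) x" if "x \<in> ref_tri" for i x
    unfolding pd_eqI[OF that D[OF that]] by (rule sum_Basis_coordinate) simp
qed

lemma continuous_on_slice: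
  "continuous_on (I \<times> S) F \<Longrightarrow> t \<in> I \<Longrightarrow> continuous_on S (\<lambda>x. F (t, x))"
  by (rule continuous_on_compose2[where g = F]) (auto intro!: continuous_intros)

text \<open>Joint differentiability in time and position controls all that is differentiated later: the function, its
velocity and the spatial derivatives of both are jointly continuous. Since mixed derivatives commute,
the velocity of a spatial derivative is the spatial derivative of the velocity.\<close>

lemma C2_family:
  fixes f :: "real \<Rightarrow> real^2 \<Rightarrow> real"
  assumes f: "Ck_on 2 ({0..1} \<times> ref_tri) (\<lambda>(t, x). f t x)"
  defines "fd \<equiv> \<lambda>t x. vector_derivative (\<lambda>r. f r x) (at t within {0..1})"
  shows C2_family_continuous: "continuous_on ({0..1} \<times> ref_tri) (\<lambda>(t, x). f t x)"
      "continuous_on ({0..1} \<times> ref_tri) (\<lambda>(t, x). fd t x)"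
      "continuous_on ({0..1} \<times> ref_tri) (\<lambda>(t, x). pd ref_tri i (f t) x)"
      "continuous_on ({0..1} \<times> ref_tri) (\<lambda>(t, x). pd ref_tri i (fd t) x)"
    and C2_family_C2: "t \<in> {0..1} \<Longrightarrow> C2 (f t)" "t \<in> {0..1} \<Longrightarrow> C1 (fd t)"
    and C2_family_deriv: "t \<in> {0..1} \<Longrightarrow> x \<in> ref_tri \<Longrightarrow> ((\<lambda>r. f r x) has_real_derivative fd t x) (at t within {0..1})"
      "t \<in> {0..1} \<Longrightarrow> x \<in> ref_tri \<Longrightarrow>
        ((\<lambda>r. pd ref_tri i (f r) x) has_real_derivative pd ref_tri i (fd t) x) (at t within {0..1})"
proof -
  let ?I = "{0..1::real}" and ?f = "\<lambda>(t, x). f t x"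
  let ?U = "?I \<times> ref_tri"
  obtain D where D: "\<And>p. p \<in> ?U \<Longrightarrow> has_partials ?f D p ?U"
    and CD: "\<And>i. i \<in> Basis \<Longrightarrow> Ck_on 1 ?U (D i)"
    using f unfolding numeral_2_eq_2 One_nat_def Ck_on.simps(2)[of "Suc 0"] by blast
  have "\<forall>i\<in>Basis. \<exists>E. (\<forall>p\<in>?U. has_partials (D i) E p ?U)
      \<and> (\<forall>j\<in>Basis. continuous_on ?U (E j))"
    using CD unfolding One_nat_def Ck_on.simps by blast
  then obtain DD where DD: "\<And>p i. p \<in> ?U \<Longrightarrow> i \<in> Basis \<Longrightarrow>
        has_partials (D i) (DD i) p ?U"
    and cDD: "\<And>i j. i \<in> Basis \<Longrightarrow> j \<in> Basis \<Longrightarrow> continuous_on ?U (DD i j)"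
    unfolding bchoice_iff by blast
  have U: "convex ?U" "interior ?U \<noteq> {}"
    using interior_ref_tri by (auto simp: interior_Times intro!: convex_Times convex_ref_tri)
  have sym: "DD i j p = DD j i p" if "i \<in> Basis" "j \<in> Basis" "p \<in> ?U" for i j p
    by (rule mixed_partials_commute[OF U that D DD cDD])
  have cont: "continuous_on ?U ?f"
    using D has_derivative_continuous unfolding continuous_on_eq_continuous_within by blast
  have cD: "continuous_on ?U (D i)" if "i \<in> Basis" for i
    using DD[OF _ that] has_derivative_continuous unfolding continuous_on_eq_continuous_within by blast
  have B: "(1, 0) \<in> (Basis :: (real \<times> (real^2)) set)" "(0, axis i 1) \<in> (Basis :: (real \<times> (real^2)) set)"
      "b \<in> Basis \<Longrightarrow> (0, b) \<in> (Basis :: (real \<times> (real^2)) set)" for i and b :: "real^2"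
    by (auto simp: Basis_prod_def)
  have Ds: "(f t has_derivative (\<lambda>h. \<Sum>i\<in>Basis. (h \<bullet> i) *\<^sub>R D (0, i) (t, x))) (at x within ref_tri)"
    if "t \<in> ?I" "x \<in> ref_tri" for t x
    using has_derivative_slice_space[where F = ?f and D = D, OF D[of "(t, x)"] that(1)] that by simp
  have DDs: "((\<lambda>x. D b (t, x)) has_derivative (\<lambda>h. \<Sum>i\<in>Basis. (h \<bullet> i) *\<^sub>R DD b (0, i) (t, x))) (at x within ref_tri)"
    if "t \<in> ?I" "x \<in> ref_tri" "b \<in> Basis" for t x b
    using has_derivative_slice_space[where F = "D b" and D = "DD b", OF DD[of "(t, x)" b] that(1)] that by blast
  have Dt: "((\<lambda>r. f r x) has_real_derivative D (1, 0) (t, x)) (at t within ?I)"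
    if "t \<in> ?I" "x \<in> ref_tri" for t x
    using has_derivative_slice_time[where F = ?f and D = D, OF D[of "(t, x)"] that(2)] that by simp
  have DDt: "((\<lambda>r. D b (r, x)) has_real_derivative DD b (1, 0) (t, x)) (at t within ?I)"
    if "t \<in> ?I" "x \<in> ref_tri" "b \<in> Basis" for t x b
    using has_derivative_slice_time[where F = "D b" and D = "DD b", OF DD[of "(t, x)" b] that(2)] that by blast
  have fd: "fd t x = D (1, 0) (t, x)" if "t \<in> ?I" "x \<in> ref_tri" for t x
    unfolding fd_def
    using Dt[OF that] that(1) by (auto simp: has_real_derivative_iff_has_vector_derivative
        intro!: vector_derivative_within_closed_interval)
  have f1: "C1 (f t)" "\<And>i x. x \<in> ref_tri \<Longrightarrow> pd ref_tri i (f t) x = D (0, axis i 1) (t, x)" if "t \<in> ?I" for t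
    using C1_partials[of "f t" "\<lambda>i x. D (0, i) (t, x)", OF Ds[OF that]] continuous_on_slice[OF cD that] B(3)
    by blast+
  have D1: "C1 (\<lambda>x. D b (t, x))" "\<And>i x. x \<in> ref_tri \<Longrightarrow> pd ref_tri i (\<lambda>x. D b (t, x)) x = DD b (0, axis i 1) (t, x)"
    if "t \<in> ?I" "b \<in> Basis" for t b
    using C1_partials[of "\<lambda>x. D b (t, x)" "\<lambda>i x. DD b (0, i) (t, x)", OF DDs[OF that(1) _ that(2)]]
      continuous_on_slice[OF cDD[OF that(2)] that(1)] B(3)
    by blast+
  have fd1: "C1 (fd t)" "\<And>i x. x \<in> ref_tri \<Longrightarrow> pd ref_tri i (fd t) x = DD (1, 0) (0, axis i 1) (t, x)" if
      "t \<in> ?I" for t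
    using D1[OF that B(1)] C1_cong[of "fd t" "\<lambda>x. D (1, 0) (t, x)"] pd_cong[of "fd t"
        "\<lambda>x. D (1, 0) (t, x)"] fd[OF that]
    by auto
  show "continuous_on ?U ?f" by (rule cont)
  show "continuous_on ?U (\<lambda>(t, x). fd t x)"
    using cD[OF B(1)] by (rule continuous_on_eq) (auto simp: fd)
  show "continuous_on ?U (\<lambda>(t, x). pd ref_tri i (f t) x)"
    using cD[OF B(2)] by (rule continuous_on_eq) (auto simp: f1)
  show "continuous_on ?U (\<lambda>(t, x). pd ref_tri i (fd t) x)"
    using cDD[OF B(1) B(2)] by (rule continuous_on_eq) (auto simp: fd1)
  show "C2 (f t)" if "t \<in> ?I"
    unfolding C2_def using f1[OF that] D1(1)[OF that B(2)] C1_cong[of "pd ref_tri j (f t)"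
        "\<lambda>x. D (0, axis j 1) (t, x)" for j] by auto
  show "C1 (fd t)" if "t \<in> ?I" by (rule fd1[OF that])
  show "((\<lambda>r. f r x) has_real_derivative fd t x) (at t within ?I)" if "t \<in> ?I" "x \<in> ref_tri"
    unfolding fd[OF that] by (rule Dt[OF that])
  show "((\<lambda>r. pd ref_tri i (f r) x) has_real_derivative pd ref_tri i (fd t) x) (at t within ?I)"
    if "t \<in> ?I" "x \<in> ref_tri"
  proof -
    have "((\<lambda>r. D (0, axis i 1) (r, x)) has_real_derivative DD (0, axis i 1) (1, 0) (t, x)) (at t within ?I)"
      by (rule DDt[OF that B(2)])
    also have "DD (0, axis i 1) (1, 0) (t, x) = pd ref_tri i (fd t) x"
      using fd1(2)[OF that] sym[OF B(2) B(1), of "(t, x)"] that by simp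
    finally show ?thesis
      by (rule has_field_derivative_transform_within[OF _ zero_less_one that(1)]) (simp add: f1(2) that)
  qed
qed

lemma continuous_integrable_compact:
  fixes f :: "'a::euclidean_space \<Rightarrow> real"
  assumes "compact S" "continuous_on S f"
  shows "f integrable_on S" "set_integrable lborel S f"
proof -
  show "set_integrable lborel S f"
    using borel_integrable_compact[OF assms] by (simp add: set_integrable_def)
  then show "f integrable_on S" by (rule set_borel_integral_eq_integral)
qed

text \<open>By uniform continuity of the time derivative and the mean value inequality, the difference quotients
converge uniformly on the compact set, whose measure is finite.\<close>

lemma has_derivative_integral_compact:
  fixes f fd :: "real \<Rightarrow> 'a::euclidean_space \<Rightarrow> real"
  assumes S: "compact S" and t0: "t0 \<in> {0..1}"
    and deriv: "\<And>t x. t \<in> {0..1} \<Longrightarrow> x \<in> S \<Longrightarrow> ((\<lambda>t. f t x) has_real_derivative fd t x) (at t within {0..1})"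
    and cont_fd: "continuous_on ({0..1} \<times> S) (\<lambda>(t, x). fd t x)"
    and cont_f: "\<And>t. t \<in> {0..1} \<Longrightarrow> continuous_on S (f t)"
  shows "((\<lambda>t. integral S (f t)) has_real_derivative integral S (fd t0)) (at t0 within {0..1})"
proof -
  let ?I = "{0..1::real}"
  define m where "m = integral S (\<lambda>x. 1::real)"
  have int1: "(\<lambda>x. 1::real) integrable_on S"
    by (rule continuous_integrable_compact[OF S]) auto
  have m: "m \<ge> 0" unfolding m_def by (rule integral_nonneg[OF int1]) auto
  have intf: "f t integrable_on S" if "t \<in> ?I" for t
    by (rule continuous_integrable_compact[OF S cont_f[OF that]])
  have "continuous_on S (fd t0)" using continuous_on_slice[OF cont_fd t0] by simp
  then have intfd: "fd t0 integrable_on S" by (rule continuous_integrable_compact[OF S])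
  have uc: "uniformly_continuous_on (?I \<times> S) (\<lambda>(t, x). fd t x)"
    by (rule compact_uniformly_continuous[OF cont_fd]) (intro compact_Times S compact_Icc)
  have "\<exists>d>0. \<forall>y\<in>?I. norm (y - t0) < d \<longrightarrow>
      norm (integral S (f y) - integral S (f t0) - (y - t0) * integral S (fd t0)) \<le> e * norm (y - t0)"
    if e: "e > 0" for e
  proof -
    \<comment> \<open>The summand 1 covers sets of measure zero.\<close>
    define \<epsilon> where "\<epsilon> = e / (m + 1)"
    have \<epsilon>: "\<epsilon> > 0" "\<epsilon> * m \<le> e" using e m by (auto simp: \<epsilon>_def field_simps)
    obtain d where d: "d > 0" "\<And>p q. p \<in> ?I \<times> S \<Longrightarrow> q \<in> ?I \<times> S \<Longrightarrow> dist q p < d \<Longrightarrow>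
        dist (case q of (t, x) \<Rightarrow> fd t x) (case p of (t, x) \<Rightarrow> fd t x) < \<epsilon>"
      using uc \<epsilon>(1) unfolding uniformly_continuous_on_def by metis
    have close: "\<bar>fd t x - fd t0 x\<bar> \<le> \<epsilon>" if "t \<in> ?I" "\<bar>t - t0\<bar> < d" "x \<in> S" for t x
      using d(2)[of "(t0, x)" "(t, x)"] that t0 by (auto simp: dist_Pair_Pair dist_real_def)
    show ?thesis
    proof (intro exI[of _ d] conjI ballI impI)
      fix y assume y: "y \<in> ?I" "norm (y - t0) < d"
      have bound: "norm (f y x - f t0 x - (y - t0) * fd t0 x) \<le> \<epsilon> * \<bar>y - t0\<bar> * 1" if x: "x \<in> S" for x
      proof -
        have "norm ((f y x - y * fd t0 x) - (f t0 x - t0 * fd t0 x)) \<le> \<epsilon> * norm (y - t0)"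
        proof (rule field_differentiable_bound[where S = "?I \<inter> ball t0 d" and f' = "\<lambda>t. fd t x - fd t0 x"])
          show "convex (?I \<inter> ball t0 d)" by (intro convex_Int convex_ball) auto
          show "((\<lambda>y. f y x - y * fd t0 x) has_field_derivative fd z x - fd t0 x) (at z within ?I \<inter> ball t0 d)"
            if "z \<in> ?I \<inter> ball t0 d" for z
            using that x by (auto intro!: derivative_eq_intros DERIV_subset[OF deriv])
          show "norm (fd z x - fd t0 x) \<le> \<epsilon>" if "z \<in> ?I \<inter> ball t0 d" for z
            using close[of z x] that x by (auto simp: dist_real_def)
        qed (use y t0 d in \<open>auto simp: dist_real_def\<close>)
        then show ?thesis by (simp add: algebra_simps)
      qed
      have intc: "(\<lambda>x. c * 1) integrable_on S" for c :: real by (intro integrable_on_mult_right int1)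
      have "integral S (f y) - integral S (f t0) - (y - t0) * integral S (fd t0)
          = integral S (\<lambda>x. f y x - f t0 x - (y - t0) * fd t0 x)"
        using intf[OF y(1)] intf[OF t0] intfd
        by (simp add: Henstock_Kurzweil_Integration.integral_diff integrable_diff integrable_on_mult_right)
      also have "norm \<dots> \<le> integral S (\<lambda>x. \<epsilon> * \<bar>y - t0\<bar> * 1)"
        by (rule integral_norm_bound_integral)
          (use intf[OF y(1)] intf[OF t0] intfd bound in \<open>auto intro!: integrable_diff integrable_on_mult_right
              intc[simplified]\<close>)
      also have "\<dots> = \<epsilon> * m * \<bar>y - t0\<bar>"
        unfolding m_def Henstock_Kurzweil_Integration.integral_mult_right by simp
      also have "\<dots> \<le> e * norm (y - t0)" using \<epsilon>(2) by (simp add: mult_right_mono)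
      finally show "norm (integral S (f y) - integral S (f t0) - (y - t0) * integral S (fd t0)) \<le> e * norm (y
          - t0)" .
    qed (rule d)
  qed
  then show ?thesis
    unfolding has_field_derivative_def has_derivative_within_alt
    by (simp add: mult.commute[of "integral S (fd t0)"] bounded_linear_mult_right)
qed

section \<open>Substitution and Green's theorem\<close>

text \<open>The absolute value accounts for changes of variables that reverse the interval. The two triangles at an
interior edge traverse it in opposite directions, so this is the relevant case.\<close>

lemma integral_substitution_unit_interval:
  fixes \<psi> \<psi>' f :: "real \<Rightarrow> real"
  assumes d: "\<And>s. s \<in> {0..1} \<Longrightarrow> (\<psi> has_real_derivative \<psi>' s) (at s within {0..1})"
    and inj: "inj_on \<psi> {0..1}" and onto: "\<psi> ` {0..1} = {0..1}"
    and f: "continuous_on {0..1} f"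
  shows "(\<lambda>s. \<bar>\<psi>' s\<bar> * f (\<psi> s)) integrable_on {0..1}"
    and "integral {0..1} (\<lambda>s. \<bar>\<psi>' s\<bar> * f (\<psi> s)) = integral {0..1} f"
proof -
  have "f absolutely_integrable_on {0..1}"
    using absolutely_integrable_continuous[of 0 1 f] f by simp
  then have "(\<lambda>s. \<bar>\<psi>' s\<bar> * f (\<psi> s)) absolutely_integrable_on {0..1} \<and>
      integral {0..1} (\<lambda>s. \<bar>\<psi>' s\<bar> * f (\<psi> s)) = integral {0..1} f"
    using has_absolute_integral_change_of_variables_1'[OF _ d inj, of f "integral {0..1} f"]
    by (simp add: onto)
  then show "(\<lambda>s. \<bar>\<psi>' s\<bar> * f (\<psi> s)) integrable_on {0..1}"
    and "integral {0..1} (\<lambda>s. \<bar>\<psi>' s\<bar> * f (\<psi> s)) = integral {0..1} f"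
    by (auto simp: absolutely_integrable_on_def)
qed

lemma integral_reverse_unit_interval:
  fixes f :: "real \<Rightarrow> real"
  assumes "continuous_on {0..1} f"
  shows "integral {0..1} (\<lambda>s. f (1 - s)) = integral {0..1} f"
proof -
  have "integral {0..1} (\<lambda>s. \<bar>- 1\<bar> * f (1 - s)) = integral {0..1} f"
  proof (rule integral_substitution_unit_interval(2)[OF _ _ _ assms])
    show "((\<lambda>s. 1 - s) has_real_derivative - 1) (at s within {0..1})" for s :: real
      by (auto intro!: derivative_eq_intros)
    show "(\<lambda>s. 1 - s) ` {0..1} = {0..1::real}"
    proof
      show "{0..1} \<subseteq> (\<lambda>s. 1 - s) ` {0..1::real}"
        by (rule subsetI, rule image_eqI[where x = "1 - y" for y]) auto
    qed auto
  qed (auto simp: inj_on_def)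
  then show ?thesis by simp
qed

definition plane_point :: "real \<Rightarrow> real \<Rightarrow> real^2" where
  "plane_point x y = x *\<^sub>R axis 1 1 + y *\<^sub>R axis 2 1"

lemma plane_point_component [simp]: "plane_point x y $ 1 = x" "plane_point x y $ 2 = y"
  by (auto simp: plane_point_def axis_def)

text \<open>This transports Fubini's theorem from pairs of reals to \<open>real^2\<close>.\<close>

lemma lborel_plane: "distr (lborel \<Otimes>\<^sub>M lborel) borel (\<lambda>(x, y). plane_point x y) = lborel"
proof (rule lborel_eqI[symmetric])
  have meas: "(\<lambda>(x, y). plane_point x y) \<in> borel_measurable (borel \<Otimes>\<^sub>M borel)"
    unfolding borel_prod plane_point_def
    by (intro borel_measurable_continuous_onI) (auto simp: case_prod_beta intro!: continuous_intros)
  fix l u :: "real^2"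
  assume lu: "\<And>b. b \<in> Basis \<Longrightarrow> l \<bullet> b \<le> u \<bullet> b"
  have le: "l $ 1 \<le> u $ 1" "l $ 2 \<le> u $ 2"
    using lu[of "axis 1 1"] lu[of "axis 2 1"] by (auto simp: inner_axis)
  have pre: "(\<lambda>(x, y). plane_point x y) -` box l u \<inter> space (lborel \<Otimes>\<^sub>M lborel)
      = {l $ 1<..<u $ 1} \<times> {l $ 2<..<u $ 2}"
    by (auto simp: mem_box_cart forall_2 space_pair_measure)
  have "emeasure (distr (lborel \<Otimes>\<^sub>M lborel) borel (\<lambda>(x, y). plane_point x y)) (box l u)
      = emeasure (lborel \<Otimes>\<^sub>M lborel) ({l $ 1<..<u $ 1} \<times> {l $ 2<..<u $ 2})"
    using meas by (subst emeasure_distr) (auto simp: pre)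
  also have "\<dots> = ennreal (u $ 1 - l $ 1) * ennreal (u $ 2 - l $ 2)"
    using le by (subst lborel.emeasure_pair_measure_Times) auto
  also have "\<dots> = ennreal ((u $ 1 - l $ 1) * (u $ 2 - l $ 2))"
    using le by (simp add: ennreal_mult)
  also have "(u $ 1 - l $ 1) * (u $ 2 - l $ 2) = (\<Prod>b\<in>Basis. (u - l) \<bullet> b)"
    by (simp add: Basis_real2 axis_1_neq_axis_2 inner_axis)
  finally show "emeasure (distr (lborel \<Otimes>\<^sub>M lborel) borel (\<lambda>(x, y). plane_point x y)) (box l u)
      = (\<Prod>b\<in>Basis. (u - l) \<bullet> b)" .
qed simp

text \<open>Exchanging the coordinates maps the triangle to itself. The statement is about any such
parametrization \<open>p\<close>, in order to serve for both orders of integration.\<close>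

lemma integral_ref_tri_fibres:
  fixes f :: "real^2 \<Rightarrow> real" and p :: "real \<Rightarrow> real \<Rightarrow> real^2"
  assumes f: "continuous_on ref_tri f"
    and p: "\<And>x. continuous_on UNIV (p x)" "\<And>x y. p x y \<in> ref_tri \<longleftrightarrow> 0 \<le> x \<and> x \<le> 1 \<and> 0 \<le> y \<and> y \<le> 1 - x"
    and int: "integrable lborel (\<lambda>x. LINT y|lborel. indicator ref_tri (p x y) *\<^sub>R f (p x y))"
  shows "(LINT x|lborel. LINT y|lborel. indicator ref_tri (p x y) *\<^sub>R f (p x y))
    = integral {0..1} (\<lambda>x. integral {0..1 - x} (\<lambda>y. f (p x y)))"
proof -
  have inner: "(LINT y|lborel. indicator ref_tri (p x y) *\<^sub>R f (p x y))
      = indicator {0..1} x *\<^sub>R integral {0..1 - x} (\<lambda>y. f (p x y))" for x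
  proof (cases "x \<in> {0..1}")
    case True
    have "continuous_on {0..1 - x} (\<lambda>y. f (p x y))"
      by (rule continuous_on_compose2[OF f continuous_on_subset[OF p(1)]]) (use True p(2) in auto)
    then have "set_integrable lborel {0..1 - x} (\<lambda>y. f (p x y))"
      by (rule continuous_integrable_compact[rotated]) simp
    from set_borel_integral_eq_integral(2)[OF this]
    have "integral {0..1 - x} (\<lambda>y. f (p x y)) = (LINT y|lborel. indicator {0..1 - x} y *\<^sub>R f (p x y))"
      by (simp add: set_lebesgue_integral_def)
    also have "\<dots> = (LINT y|lborel. indicator ref_tri (p x y) *\<^sub>R f (p x y))"
      using True p(2) by (intro Bochner_Integration.integral_cong) (auto simp: indicator_def)
    finally show ?thesis using True by simp
  next
    case False
    then have "indicator ref_tri (p x y) = (0::real)" for y using p(2) by (auto simp: indicator_def)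
    then show ?thesis using False by simp
  qed
  have "set_integrable lborel {0..1} (\<lambda>x. integral {0..1 - x} (\<lambda>y. f (p x y)))"
    using int unfolding inner set_integrable_def .
  from set_borel_integral_eq_integral(2)[OF this] show ?thesis
    unfolding inner by (simp add: set_lebesgue_integral_def)
qed

lemma integral_ref_tri_iterated:
  fixes f :: "real^2 \<Rightarrow> real"
  assumes f: "continuous_on ref_tri f"
  shows "integral ref_tri f = integral {0..1} (\<lambda>x. integral {0..1 - x} (\<lambda>y. f (plane_point x y)))"
    and "integral ref_tri f = integral {0..1} (\<lambda>y. integral {0..1 - y} (\<lambda>x. f (plane_point x y)))"
proof -
  let ?p = "\<lambda>(x, y). plane_point x y" and ?h = "\<lambda>z. indicator ref_tri z *\<^sub>R f z"
  have meas: "?p \<in> borel_measurable (lborel \<Otimes>\<^sub>M lborel)"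
    unfolding lborel_prod plane_point_def measurable_lborel2
    by (intro borel_measurable_continuous_onI) (auto simp: case_prod_beta intro!: continuous_intros)
  have si: "set_integrable lborel ref_tri f" by (rule continuous_integrable_compact[OF compact_ref_tri f])
  then have int: "integrable lborel ?h" by (simp add: set_integrable_def)
  have hm: "?h \<in> borel_measurable borel" using borel_measurable_integrable[OF int] by simp
  have intp: "integrable (lborel \<Otimes>\<^sub>M lborel) (\<lambda>(x, y). ?h (plane_point x y))"
    using integrable_distr_eq[OF meas hm] int lborel_plane by (simp add: case_prod_beta')
  have "integral ref_tri f = (LINT z|lborel. ?h z)"
    using set_borel_integral_eq_integral(2)[OF si] by (simp add: set_lebesgue_integral_def)
  also have "\<dots> = (LINT z|distr (lborel \<Otimes>\<^sub>M lborel) borel ?p. ?h z)" by (simp only: lborel_plane)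
  also have "\<dots> = (LINT w|(lborel \<Otimes>\<^sub>M lborel). (case w of (x, y) \<Rightarrow> ?h (plane_point x y)))"
    by (subst integral_distr[OF meas hm]) (simp add: case_prod_beta')
  finally have eq: "integral ref_tri f = (LINT w|(lborel \<Otimes>\<^sub>M lborel). (case w of (x, y) \<Rightarrow> ?h (plane_point x y)))" .
  have pc: "continuous_on UNIV (plane_point x)" "continuous_on UNIV (\<lambda>y. plane_point y x)" for x
    unfolding plane_point_def by (auto intro!: continuous_intros)
  show "integral ref_tri f = integral {0..1} (\<lambda>x. integral {0..1 - x} (\<lambda>y. f (plane_point x y)))"
    unfolding eq lborel_pair.integral_fst[OF intp, symmetric]
    by (rule integral_ref_tri_fibres[OF f pc(1) _ lborel_pair.integrable_fst[OF intp]])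
      (auto simp: mem_ref_tri)
  show "integral ref_tri f = integral {0..1} (\<lambda>y. integral {0..1 - y} (\<lambda>x. f (plane_point x y)))"
    unfolding eq lborel_pair.integral_snd[OF intp, symmetric]
    by (rule integral_ref_tri_fibres[OF f pc(2) _ lborel_pair.integrable_snd[OF intp]])
      (auto simp: mem_ref_tri)
qed

lemma has_derivative_C1_line:
  assumes f: "C1 f" and J: "\<And>s. s \<in> J \<Longrightarrow> a + s *\<^sub>R d \<in> ref_tri" and s: "s \<in> J"
  shows "((\<lambda>s. f (a + s *\<^sub>R d)) has_real_derivative
      d $ 1 * pd ref_tri 1 f (a + s *\<^sub>R d) + d $ 2 * pd ref_tri 2 f (a + s *\<^sub>R d)) (at s within J)"
proof -
  have 1: "((\<lambda>s. a + s *\<^sub>R d) has_derivative (\<lambda>s. s *\<^sub>R d)) (at s within J)"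
    by (auto intro!: derivative_eq_intros)
  have "(\<lambda>s. a + s *\<^sub>R d) ` J \<subseteq> ref_tri" using J by auto
  from has_derivative_in_compose[OF 1 has_derivative_subset[OF has_derivative_pd[OF C1_differentiable[OF f
      J[OF s]]] this]]
  show ?thesis by (rule has_derivative_imp_has_field_derivative) (simp add: algebra_simps)
qed

definition side_dir :: "3 \<Rightarrow> real^2" where
  "side_dir k = ref_vertex (k + 2) - ref_vertex (k + 1)"

lemma ref_path_line: "ref_path k s = ref_vertex (k + 1) + s *\<^sub>R side_dir k"
  by (simp add: ref_path_def linepath_def side_dir_def algebra_simps)

lemma velocity_ref_path: "s \<in> {0..1} \<Longrightarrow> velocity (ref_path k) s = side_dir k"
  unfolding velocity_def ref_path_line
  by (rule vector_derivative_within_closed_interval) (auto intro!: derivative_eq_intros)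

lemma side_dir_nonzero: "side_dir k \<noteq> 0"
  using exhaust_3[of k] by (auto simp: side_dir_def ref_vertex_def axis_eq_axis)

lemma has_derivative_side:
  assumes f: "C1 f" and s: "s \<in> {0..1}"
  shows "((\<lambda>s. f (ref_path k s)) has_real_derivative
      side_dir k $ 1 * pd ref_tri 1 f (ref_path k s) + side_dir k $ 2 * pd ref_tri 2 f (ref_path k s))
          (at s within {0..1})"
  unfolding ref_path_line
  by (rule has_derivative_C1_line[OF f _ s]) (use ref_path_in_ref_tri in \<open>simp add: ref_path_line\<close>)

lemma continuous_on_side:
  assumes "continuous_on ref_tri f"
  shows "continuous_on {0..1} (\<lambda>s. f (ref_path k s))"
  by (rule continuous_on_compose2[OF assms]) (auto simp: ref_path_line ref_path_in_ref_tri[unfolded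
      ref_path_line] intro!: continuous_intros)

lemma integral_continuous_derivative:
  fixes f f' :: "real \<Rightarrow> real"
  assumes "a \<le> b" "\<And>s. s \<in> {a..b} \<Longrightarrow> (f has_real_derivative f' s) (at s within {a..b})"
  shows "integral {a..b} f' = f b - f a"
  using assms by (intro integral_unique fundamental_theorem_of_calculus)
    (auto simp: has_real_derivative_iff_has_vector_derivative)

text \<open>Along the fibres parallel to an axis, the fundamental theorem of calculus leaves the values at the end
points. The slanted side is reached in both directions and occurs for both components.\<close>

lemma green_ref_tri:
  assumes P: "C1 P" and Q: "C1 Q"
  shows "integral ref_tri (\<lambda>x. pd ref_tri 1 Q x - pd ref_tri 2 P x)
    = (\<Sum>k\<in>UNIV. integral {0..1} (\<lambda>s. P (ref_path k s) * side_dir k $ 1 + Q (ref_path k s) * side_dir k $ 2))"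
proof -
  have cP: "continuous_on {0..1} (\<lambda>x. P (plane_point x 0))" "continuous_on {0..1} (\<lambda>x. P (plane_point x (1 - x)))"
    and cQ: "continuous_on {0..1} (\<lambda>y. Q (plane_point 0 y))" "continuous_on {0..1} (\<lambda>y. Q (plane_point (1 - y) y))"
    unfolding plane_point_def
    by (rule continuous_on_compose2[OF C1_continuous[OF P]] continuous_on_compose2[OF C1_continuous[OF Q]];
        auto simp: mem_ref_tri axis_def intro!: continuous_intros)+
  have iP: "(\<lambda>x. P (plane_point x (1 - x))) integrable_on {0..1}" "(\<lambda>x. P (plane_point x 0)) integrable_on {0..1}"
    and iQ: "(\<lambda>y. Q (plane_point (1 - y) y)) integrable_on {0..1}" "(\<lambda>y. Q (plane_point 0 y)) integrable_on {0..1}"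
    using cP cQ by (auto intro: integrable_continuous_real)
  have "integral ref_tri (pd ref_tri 2 P) = integral {0..1} (\<lambda>x. P (plane_point x (1 - x)) - P (plane_point x 0))"
    unfolding integral_ref_tri_iterated(1)[OF C1_continuous_pd[OF P]]
  proof (rule integral_cong)
    fix x :: real assume x: "x \<in> {0..1}"
    show "integral {0..1 - x} (\<lambda>y. pd ref_tri 2 P (plane_point x y))
        = P (plane_point x (1 - x)) - P (plane_point x 0)"
    proof (rule integral_continuous_derivative)
      show "((\<lambda>y. P (plane_point x y)) has_real_derivative pd ref_tri 2 P (plane_point x s))
          (at s within {0..1 - x})"
        if "s \<in> {0..1 - x}" for s
        using has_derivative_C1_line[OF P, of "{0..1 - x}" "x *\<^sub>R axis 1 1" "axis 2 1" s] that x
        by (auto simp: plane_point_def mem_ref_tri axis_def)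
    qed (use x in auto)
  qed
  also have "\<dots> = integral {0..1} (\<lambda>x. P (plane_point x (1 - x))) - integral {0..1} (\<lambda>x. P (plane_point x 0))"
    by (rule Henstock_Kurzweil_Integration.integral_diff[OF iP])
  finally have IP: "integral ref_tri (pd ref_tri 2 P)
    = integral {0..1} (\<lambda>x. P (plane_point x (1 - x))) - integral {0..1} (\<lambda>x. P (plane_point x 0))" .
  have "integral ref_tri (pd ref_tri 1 Q) = integral {0..1} (\<lambda>y. Q (plane_point (1 - y) y) - Q (plane_point 0 y))"
    unfolding integral_ref_tri_iterated(2)[OF C1_continuous_pd[OF Q]]
  proof (rule integral_cong)
    fix y :: real assume y: "y \<in> {0..1}"
    show "integral {0..1 - y} (\<lambda>x. pd ref_tri 1 Q (plane_point x y))
        = Q (plane_point (1 - y) y) - Q (plane_point 0 y)"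
    proof (rule integral_continuous_derivative)
      show "((\<lambda>x. Q (plane_point x y)) has_real_derivative pd ref_tri 1 Q (plane_point s y))
          (at s within {0..1 - y})"
        if "s \<in> {0..1 - y}" for s
        using has_derivative_C1_line[OF Q, of "{0..1 - y}" "y *\<^sub>R axis 2 1" "axis 1 1" s] that y
        by (auto simp: plane_point_def mem_ref_tri axis_def add.commute)
    qed (use y in auto)
  qed
  also have "\<dots> = integral {0..1} (\<lambda>y. Q (plane_point (1 - y) y)) - integral {0..1} (\<lambda>y. Q (plane_point 0 y))"
    by (rule Henstock_Kurzweil_Integration.integral_diff[OF iQ])
  finally have IQ: "integral ref_tri (pd ref_tri 1 Q)
    = integral {0..1} (\<lambda>y. Q (plane_point (1 - y) y)) - integral {0..1} (\<lambda>y. Q (plane_point 0 y))" .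
  have r1: "ref_path 1 s = plane_point 0 (1 - s)" and r2: "ref_path 2 s = plane_point s 0"
    and r3: "ref_path 3 s = plane_point (1 - s) s" for s
    by (auto simp: ref_path_line side_dir_def ref_vertex_def plane_point_def vec_eq_iff forall_2 axis_def)
  have d: "side_dir 1 $ 1 = 0" "side_dir 1 $ 2 = - 1" "side_dir 2 $ 1 = 1" "side_dir 2 $ 2 = 0"
      "side_dir 3 $ 1 = - 1" "side_dir 3 $ 2 = 1"
    by (auto simp: side_dir_def ref_vertex_def axis_def)
  have e1: "integral {0..1} (\<lambda>s. - Q (plane_point 0 (1 - s))) = - integral {0..1} (\<lambda>y. Q (plane_point 0 y))"
    using integral_reverse_unit_interval[OF cQ(1)] by simp
  have rP: "(\<lambda>s. P (plane_point (1 - s) s)) integrable_on {0..1}"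
    unfolding plane_point_def by (intro integrable_continuous_real continuous_on_compose2[OF C1_continuous[OF P]])
      (auto simp: mem_ref_tri axis_def intro!: continuous_intros)
  have "integral {0..1} (\<lambda>s. P (plane_point (1 - s) s)) = integral {0..1} (\<lambda>x. P (plane_point x (1 - x)))"
    using integral_reverse_unit_interval[OF cP(2)] by simp
  then have e3: "integral {0..1} (\<lambda>s. - P (plane_point (1 - s) s) + Q (plane_point (1 - s) s))
      = - integral {0..1} (\<lambda>x. P (plane_point x (1 - x))) + integral {0..1} (\<lambda>y. Q (plane_point (1 - y) y))"
    using Henstock_Kurzweil_Integration.integral_add[OF integrable_neg[OF rP] iQ(1)] by simp
  have "integral ref_tri (\<lambda>x. pd ref_tri 1 Q x - pd ref_tri 2 P x)
      = integral ref_tri (pd ref_tri 1 Q) - integral ref_tri (pd ref_tri 2 P)"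
    by (intro Henstock_Kurzweil_Integration.integral_diff continuous_integrable_compact compact_ref_tri
        C1_continuous_pd P Q)
  moreover have "integral {0..1} (\<lambda>s. P (ref_path 1 s) * side_dir 1 $ 1 + Q (ref_path 1 s) * side_dir 1 $ 2)
      = - integral {0..1} (\<lambda>y. Q (plane_point 0 y))"
    unfolding r1 d e1[symmetric] by simp
  moreover have "integral {0..1} (\<lambda>s. P (ref_path 2 s) * side_dir 2 $ 1 + Q (ref_path 2 s) * side_dir 2 $ 2)
      = integral {0..1} (\<lambda>x. P (plane_point x 0))"
    unfolding r2 d by simp
  moreover have "integral {0..1} (\<lambda>s. P (ref_path 3 s) * side_dir 3 $ 1 + Q (ref_path 3 s) * side_dir 3 $ 2)
      = - integral {0..1} (\<lambda>x. P (plane_point x (1 - x))) + integral {0..1} (\<lambda>y. Q (plane_point (1 - y) y))"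
    unfolding r3 d e3[symmetric] by simp
  ultimately show ?thesis
    unfolding IP IQ sum_3 by linarith
qed

section \<open>The geometry of a metric at a point\<close>

lemma pos_def_entries:
  assumes A: "pos_def A"
  shows "A $ 2 $ 1 = A $ 1 $ 2" "A $ 1 $ 1 > 0" "A $ 2 $ 2 > 0"
    "A $ 1 $ 1 * A $ 2 $ 2 - A $ 1 $ 2 * A $ 1 $ 2 > 0"
proof -
  have t: "transpose A $ 1 $ 2 = A $ 1 $ 2" and pos: "\<And>w. w \<noteq> 0 \<Longrightarrow> w \<bullet> (A *v w) > 0"
    using A by (auto simp: pos_def_def)
  show sym: "A $ 2 $ 1 = A $ 1 $ 2" using t by (simp add: transpose_def)
  have q: "(vector [u, v] :: real^2) \<bullet> (A *v vector [u, v])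
      = A $ 1 $ 1 * u * u + 2 * A $ 1 $ 2 * u * v + A $ 2 $ 2 * v * v" for u v
    by (simp add: inner_vec_def sum_2 matrix_vector_mult_def sym algebra_simps)
  have q': "A $ 1 $ 1 * u * u + 2 * A $ 1 $ 2 * u * v + A $ 2 $ 2 * v * v > 0" if "u \<noteq> 0 \<or> v \<noteq> 0" for u v
    using pos[of "vector [u, v]"] that unfolding q by (auto simp: vec_eq_iff forall_2)
  show E: "A $ 1 $ 1 > 0" using q'[of 1 0] by simp
  show "A $ 2 $ 2 > 0" using q'[of 0 1] by simp
  have "A $ 1 $ 1 * (A $ 1 $ 1 * A $ 2 $ 2 - A $ 1 $ 2 * A $ 1 $ 2) > 0"
    using q'[of "- A $ 1 $ 2" "A $ 1 $ 1"] E by (simp add: algebra_simps)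
  then show "A $ 1 $ 1 * A $ 2 $ 2 - A $ 1 $ 2 * A $ 1 $ 2 > 0" using E by (simp add: zero_less_mult_iff)
qed

lemma det_pos_def:
  assumes A: "pos_def A"
  shows "det A = A $ 1 $ 1 * A $ 2 $ 2 - A $ 1 $ 2 * A $ 1 $ 2" "det A > 0"
  using pos_def_entries[OF A] by (simp_all add: det_2)

lemma matrix_inv_pos_def:
  assumes A: "pos_def A"
  shows "matrix_inv A $ 1 $ 1 = A $ 2 $ 2 / det A" "matrix_inv A $ 1 $ 2 = - A $ 1 $ 2 / det A"
    "matrix_inv A $ 2 $ 1 = - A $ 1 $ 2 / det A" "matrix_inv A $ 2 $ 2 = A $ 1 $ 1 / det A"
proof -
  define B :: "real^2^2" where
    "B = vector [vector [A $ 2 $ 2 / det A, - A $ 1 $ 2 / det A], vector [- A $ 1 $ 2 / det A, A $ 1 $ 1 / det A]]"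
  note e = pos_def_entries[OF A] det_pos_def[OF A]
  have AB: "A ** B = mat 1"
    using e by (simp add: vec_eq_iff forall_2 matrix_matrix_mult_def sum_2 B_def mat_def field_simps)
  then have "B ** A = mat 1" by (simp add: matrix_left_right_inverse)
  have "invertible A" using AB \<open>B ** A = mat 1\<close> by (auto simp: invertible_def)
  then have "A ** matrix_inv A = mat 1"
    unfolding matrix_inv_def invertible_def by (rule someI2_ex) simp
  then have "matrix_inv A = B"
    using \<open>B ** A = mat 1\<close> by (metis matrix_mul_assoc matrix_mul_lid matrix_mul_rid)
  then show "matrix_inv A $ 1 $ 1 = A $ 2 $ 2 / det A" "matrix_inv A $ 1 $ 2 = - A $ 1 $ 2 / det A"
    "matrix_inv A $ 2 $ 1 = - A $ 1 $ 2 / det A" "matrix_inv A $ 2 $ 2 = A $ 1 $ 1 / det A"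
    by (simp_all add: B_def)
qed

lemma bil_2: "bil A u w = u $ 1 * (A $ 1 $ 1 * w $ 1 + A $ 1 $ 2 * w $ 2) + u $ 2 * (A $ 2 $ 1 * w $ 1
    + A $ 2 $ 2 * w $ 2)"
  by (simp add: bil_def inner_vec_def sum_2 matrix_vector_mult_def)

lemma bil_pos:
  assumes "pos_def A" "d \<noteq> 0"
  shows "bil A d d > 0"
  using assms by (simp add: bil_def pos_def_def)

lemma right_normal_components:
  assumes A: "pos_def A" and d: "d \<noteq> 0"
  defines "q \<equiv> bil A d d"
  shows "right_normal A d $ 1 = (A $ 1 $ 2 * d $ 1 + A $ 2 $ 2 * d $ 2) / (sqrt (det A) * sqrt q)"
    "right_normal A d $ 2 = - (A $ 1 $ 1 * d $ 1 + A $ 1 $ 2 * d $ 2) / (sqrt (det A) * sqrt q)"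
proof -
  note e = pos_def_entries(1)[OF A] det_pos_def[OF A]
  define w where "w = matrix_inv A *v (vector [d $ 2, - d $ 1])"
  have w: "w $ 1 = (A $ 1 $ 2 * d $ 1 + A $ 2 $ 2 * d $ 2) / det A" "w $ 2 = - (A $ 1 $ 1 * d $ 1
      + A $ 1 $ 2 * d $ 2) / det A"
    by (simp_all add: w_def matrix_vector_mult_def sum_2 matrix_inv_pos_def[OF A] add_divide_distrib
        diff_divide_distrib)
  have D: "det A \<noteq> 0" using e by simp
  have Aw: "A $ 1 $ 1 * w $ 1 + A $ 1 $ 2 * w $ 2 = d $ 2" "A $ 1 $ 2 * w $ 1 + A $ 2 $ 2 * w $ 2 = - d $ 1"
  proof -
    have "A $ 1 $ 1 * w $ 1 + A $ 1 $ 2 * w $ 2 = det A * d $ 2 / det A"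
      unfolding w e(2) by (simp add: add_divide_distrib[symmetric] diff_divide_distrib[symmetric] algebra_simps)
    then show "A $ 1 $ 1 * w $ 1 + A $ 1 $ 2 * w $ 2 = d $ 2" using D by simp
    have "A $ 1 $ 2 * w $ 1 + A $ 2 $ 2 * w $ 2 = det A * (- d $ 1) / det A"
      unfolding w e(2) by (simp add: add_divide_distrib[symmetric] diff_divide_distrib[symmetric] algebra_simps)
    then show "A $ 1 $ 2 * w $ 1 + A $ 2 $ 2 * w $ 2 = - d $ 1" using D by simp
  qed
  have "bil A w w = w $ 1 * d $ 2 + w $ 2 * (- d $ 1)"
    unfolding bil_2 e(1) Aw ..
  also have "\<dots> = q / det A"
    unfolding w q_def bil_2 e(1) by (simp add: add_divide_distrib diff_divide_distrib algebra_simps)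
  finally have len: "len A w = sqrt q / sqrt (det A)" by (simp add: len_def real_sqrt_divide)
  have sD: "sqrt (det A) * sqrt (det A) = det A" "sqrt (det A) > 0" using e by simp_all
  have q: "sqrt q > 0" using bil_pos[OF A d] by (simp add: q_def)
  have n: "right_normal A d $ i = w $ i / len A w" for i
    by (simp add: right_normal_def w_def Let_def divide_inverse mult.commute)
  have aux: "x / det A / (sqrt q / sqrt (det A)) = x / (sqrt (det A) * sqrt q)" for x
  proof -
    have "x / y / (b / a) = x / (a * b)" if "a * a = y" "a > 0" "b > 0" for x y a b :: real
      using that by (auto simp: field_simps)
    from this[OF sD q] show ?thesis .
  qed
  show "right_normal A d $ 1 = (A $ 1 $ 2 * d $ 1 + A $ 2 $ 2 * d $ 2) / (sqrt (det A) * sqrt q)"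
    "right_normal A d $ 2 = - (A $ 1 $ 1 * d $ 1 + A $ 1 $ 2 * d $ 2) / (sqrt (det A) * sqrt q)"
    unfolding n len w by (rule aux)+
qed

lemma bil_right_normal:
  assumes A: "pos_def A" and d: "d \<noteq> 0"
  shows "bil A u (right_normal A d) = (u $ 1 * d $ 2 - u $ 2 * d $ 1) * sqrt (det A) / sqrt (bil A d d)"
proof -
  note e = pos_def_entries(1)[OF A] det_pos_def[OF A]
  let ?r = "sqrt (det A)" and ?q = "sqrt (bil A d d)"
  have r: "?r > 0" "?r * ?r = det A" using e by simp_all
  have q: "?q > 0" using bil_pos[OF A d] by simp
  have "bil A u (right_normal A d) = (u $ 1 * d $ 2 - u $ 2 * d $ 1) * det A / (?r * ?q)"
    unfolding bil_2[of A u] right_normal_components[OF A d] e(1) e(2)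
    by (simp add: add_divide_distrib[symmetric] diff_divide_distrib[symmetric] algebra_simps)
  also have "\<dots> = (u $ 1 * d $ 2 - u $ 2 * d $ 1) * ?r / ?q"
  proof -
    have "x * y / (a * b) = x * a / b" if "a > 0" "a * a = y" "b > 0" for x y a b :: real
      using that by (auto simp: field_simps)
    from this[OF r q] show ?thesis .
  qed
  finally show ?thesis .
qed

text \<open>For an orthonormal basis \<open>\<tau>, n\<close> the trace of \<open>B\<close> is \<open>B(\<tau>, \<tau>) + B(n, n)\<close>, so only the tangential component
survives in \<open>(S B)(n, n)\<close>.\<close>

lemma S_op_normal_normal:
  assumes A: "pos_def A" and d: "d \<noteq> 0" and B: "B $ 2 $ 1 = B $ 1 $ 2"
  shows "bil (S_op A B) (right_normal A d) (right_normal A d) = - bil B d d / bil A d d"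
proof -
  note e = pos_def_entries(1)[OF A] det_pos_def[OF A]
  let ?n = "right_normal A d" and ?r = "sqrt (det A)" and ?q = "sqrt (bil A d d)"
  have r: "?r * ?r = det A" using e by simp
  have qp: "bil A d d > 0" by (rule bil_pos[OF A d])
  have q: "?q * ?q = bil A d d" using qp by simp
  have tr: "tr_g A B = (A $ 2 $ 2 * B $ 1 $ 1 - 2 * A $ 1 $ 2 * B $ 1 $ 2 + A $ 1 $ 1 * B $ 2 $ 2) / det A"
    by (simp add: tr_g_def sum_2 matrix_inv_pos_def[OF A] B add_divide_distrib diff_divide_distrib algebra_simps)
  have nn: "bil A ?n ?n = 1" using right_normal(1)[OF A d] .
  let ?P = "A $ 1 $ 1 * d $ 1 + A $ 1 $ 2 * d $ 2" and ?Q = "A $ 1 $ 2 * d $ 1 + A $ 2 $ 2 * d $ 2"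
  have "bil B ?n ?n = (B $ 1 $ 1 * ?Q * ?Q - 2 * B $ 1 $ 2 * ?P * ?Q
      + B $ 2 $ 2 * ?P * ?P) / ((?r * ?q) * (?r * ?q))"
    unfolding bil_2[of B] right_normal_components[OF A d] B
    by (simp add: add_divide_distrib diff_divide_distrib algebra_simps)
  also have "(?r * ?q) * (?r * ?q) = (?r * ?r) * (?q * ?q)" by (simp only: mult_ac)
  also have "\<dots> = det A * bil A d d" unfolding r q ..
  finally have Bn: "bil B ?n ?n = (B $ 1 $ 1 * ?Q * ?Q - 2 * B $ 1 $ 2 * ?P * ?Q
      + B $ 2 $ 2 * ?P * ?P) / (det A * bil A d d)" .
  have "bil (S_op A B) ?n ?n = bil B ?n ?n - tr_g A B * bil A ?n ?n"
    by (simp add: S_op_def bil_2 algebra_simps)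
  also have "\<dots> = (B $ 1 $ 1 * ?Q * ?Q - 2 * B $ 1 $ 2 * ?P * ?Q + B $ 2 $ 2 * ?P * ?P) / (det A * bil A d d) -
      tr_g A B"
    unfolding nn Bn by simp
  also have "\<dots> = ((B $ 1 $ 1 * ?Q * ?Q - 2 * B $ 1 $ 2 * ?P * ?Q + B $ 2 $ 2 * ?P * ?P)
      - (A $ 2 $ 2 * B $ 1 $ 1 - 2 * A $ 1 $ 2 * B $ 1 $ 2 + A $ 1 $ 1 * B $ 2 $ 2) * bil A d d) / (det A *
          bil A d d)"
    unfolding tr using e qp by (simp add: divide_simps)
  also have "(B $ 1 $ 1 * ?Q * ?Q - 2 * B $ 1 $ 2 * ?P * ?Q + B $ 2 $ 2 * ?P * ?P)
      - (A $ 2 $ 2 * B $ 1 $ 1 - 2 * A $ 1 $ 2 * B $ 1 $ 2 + A $ 1 $ 1 * B $ 2 $ 2) * bil A d d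
          = det A * (- bil B d d)"
    unfolding bil_2 e(1) e(2) B by algebra
  also have "det A * (- bil B d d) / (det A * bil A d d) = - bil B d d / bil A d d" using e by simp
  finally show ?thesis .
qed

text \<open>In dimension two, raising both indices of \<open>S B\<close> gives minus the cofactor matrix of \<open>B\<close> divided by the
determinant of the metric.\<close>

lemma inner_g_S_op:
  assumes A: "pos_def A" and B: "B $ 2 $ 1 = B $ 1 $ 2"
  shows "inner_g A (S_op A B) H = - (B $ 2 $ 2 * H $ 1 $ 1 - B $ 1 $ 2 * (H $ 1 $ 2 + H $ 2 $ 1)
      + B $ 1 $ 1 * H $ 2 $ 2) / det A"
proof -
  note e = pos_def_entries(1)[OF A] det_pos_def[OF A]
  define p where "p = 1 / det A"
  have pD: "p * (A $ 1 $ 1 * A $ 2 $ 2 - A $ 1 $ 2 * A $ 1 $ 2) = 1" unfolding p_def e(2)[symmetric]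
      using e(3) by simp
  have inv: "matrix_inv A $ 1 $ 1 = p * A $ 2 $ 2" "matrix_inv A $ 1 $ 2 = - p * A $ 1 $ 2"
    "matrix_inv A $ 2 $ 1 = - p * A $ 1 $ 2" "matrix_inv A $ 2 $ 2 = p * A $ 1 $ 1"
    by (simp_all add: matrix_inv_pos_def[OF A] p_def)
  have "inner_g A (S_op A B) H = - (B $ 2 $ 2 * H $ 1 $ 1 - B $ 1 $ 2 * (H $ 1 $ 2 + H $ 2 $ 1)
      + B $ 1 $ 1 * H $ 2 $ 2) * p"
    using pD unfolding inner_g_def S_op_def tr_g_def sum_2 inv vector_minus_component vector_scaleR_component
      real_scaleR_def e(1) B
    by algebra
  then show ?thesis by (simp add: p_def)
qed

text \<open>The curvature equation of \<open>gauss_curvature_exact\<close> with all derivatives of the metric expressed by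
Christoffel symbols. Here \<open>a\<^sub>i\<^sub>j\<close> and \<open>b\<^sub>i\<^sub>j\<close> are the two components of \<open>\<nabla>\<^sub>i \<partial>\<^sub>j\<close>, while \<open>p\<close>, \<open>p'\<close> stand for
\<open>\<partial>\<^sub>1\<close> of \<open>a\<^sub>2\<^sub>2\<close>, \<open>b\<^sub>2\<^sub>2\<close> and \<open>q\<close>, \<open>q'\<close> for \<open>\<partial>\<^sub>2\<close> of \<open>a\<^sub>1\<^sub>2\<close>, \<open>b\<^sub>1\<^sub>2\<close>. The hypothesis \<open>cod\<close> expresses
\<open>\<langle>R(\<partial>\<^sub>1, \<partial>\<^sub>2) \<partial>\<^sub>2, \<partial>\<^sub>2\<rangle> = 0\<close>, which determines the second component \<open>c2\<close> of the curvature vector from the first.\<close>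

lemma curvature_algebra:
  fixes E F G D r :: real
  assumes D: "D = E * G - F * F" "D > 0" "G > 0" and r: "r * r = D" "r > 0"
    and E1: "E1 = 2 * (E * a11 + F * b11)" and E2: "E2 = 2 * (E * a12 + F * b12)"
    and F1: "F1 = (F * a11 + G * b11) + (E * a12 + F * b12)" and F2: "F2 = (F * a12 + G * b12) + (E * a22
        + F * b22)"
    and G1: "G1 = 2 * (F * a12 + G * b12)" and G2: "G2 = 2 * (F * a22 + G * b22)"
    and cod: "F * (p - q) + G * (p' - q') + (F1 * a22 + G1 * b22 - F2 * a12 - G2 * b12) = 0"
    and c1: "c1 = p - q + (a22 * a11 + b22 * a12 - a12 * a12 - b12 * a22)"
    and c2: "c2 = p' - q' + (a22 * b11 + b22 * b12 - a12 * b12 - b12 * b22)"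
  shows "((c1 * E + c2 * F) / D) * r
    = (r * (a11 + b12) * (a22 / G) + r * (p / G - a22 * G1 / (G * G)))
      - (r * (a12 + b22) * (a12 / G) + r * (q / G - a12 * G2 / (G * G)))"
proof -
  have "F * c1 + G * c2 = 0" using cod unfolding c1 c2 F1 G1 F2 G2 by algebra
  then have c2': "c2 = - F * c1 / G" using D(3) by (simp add: field_simps)
  have "(c1 * E + c2 * F) = c1 * D / G" unfolding c2' D(1) using D(3) by (simp add: field_simps)
  then have "((c1 * E + c2 * F) / D) * r = r * c1 / G" using D(2) by simp
  also have "r * c1 / G = r * (G * c1) / (G * G)" using D(3) by simp
  also have "G * c1 = G * (a11 + b12) * a22 + (p * G - a22 * G1) - (G * (a12 + b22) * a12 + (q * G - a12 * G2))"
    unfolding c1 G1 G2 by algebra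
  also have "r * (\<dots>) / (G * G) = (r * (a11 + b12) * (a22 / G) + r * (p / G - a22 * G1 / (G * G)))
      - (r * (a12 + b22) * (a12 / G) + r * (q / G - a12 * G2 / (G * G)))"
    using D(3) by (simp add: field_simps)
  finally show ?thesis .
qed

text \<open>This is \<open>B(d, J d) / (2 A(d, d))\<close>, where \<open>J\<close> is the rotation by a right angle for \<open>A\<close>: if the metric \<open>A\<close>
moves with velocity \<open>B\<close>, a fixed direction \<open>d\<close> turns at this rate relative to the orthonormal basis
each vector \<open>e\<close> of which moves with velocity \<open>- 1/2 B\<^sup>\<sharp> e\<close>.\<close>

definition rot :: "real^2^2 \<Rightarrow> real^2^2 \<Rightarrow> real^2 \<Rightarrow> real" where
  "rot A B d = ((B $ 1 $ 2 * d $ 1 + B $ 2 $ 2 * d $ 2) * (A $ 1 $ 1 * d $ 1 + A $ 1 $ 2 * d $ 2)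
      - (B $ 1 $ 1 * d $ 1 + B $ 1 $ 2 * d $ 2) * (A $ 1 $ 2 * d $ 1
          + A $ 2 $ 2 * d $ 2)) / (2 * sqrt (det A) * bil A d d)"

text \<open>For independent vectors this is \<open>pi/2\<close> minus the angle from \<open>u\<close> to \<open>w\<close>, up to a multiple of \<open>pi\<close>: the
argument is the cotangent of that angle. For parallel vectors \<open>x / 0 = 0\<close> makes it the constant \<open>0\<close>,
which suits a side parallel to \<open>\<partial>\<^sub>2\<close>.\<close>

definition coangle :: "real^2^2 \<Rightarrow> real^2 \<Rightarrow> real^2 \<Rightarrow> real" where
  "coangle A u w = arctan (bil A u w / (sqrt (det A) * (u $ 1 * w $ 2 - u $ 2 * w $ 1)))"

lemma rot_scaleR:
  assumes "c \<noteq> 0"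
  shows "rot A B (c *\<^sub>R d) = rot A B d"
proof -
  have "bil A (c *\<^sub>R d) (c *\<^sub>R d) = (c * c) * bil A d d" by (simp add: bil_2 algebra_simps)
  moreover have "(B $ 1 $ 2 * (c *\<^sub>R d) $ 1 + B $ 2 $ 2 * (c *\<^sub>R d) $ 2) * (A $ 1 $ 1 * (c *\<^sub>R d) $ 1
      + A $ 1 $ 2 * (c *\<^sub>R d) $ 2)
      - (B $ 1 $ 1 * (c *\<^sub>R d) $ 1 + B $ 1 $ 2 * (c *\<^sub>R d) $ 2) * (A $ 1 $ 2 * (c *\<^sub>R d) $ 1
          + A $ 2 $ 2 * (c *\<^sub>R d) $ 2)
    = (c * c) * ((B $ 1 $ 2 * d $ 1 + B $ 2 $ 2 * d $ 2) * (A $ 1 $ 1 * d $ 1 + A $ 1 $ 2 * d $ 2)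
      - (B $ 1 $ 1 * d $ 1 + B $ 1 $ 2 * d $ 2) * (A $ 1 $ 2 * d $ 1 + A $ 2 $ 2 * d $ 2))"
    by (simp add: algebra_simps)
  ultimately show ?thesis using assms by (simp add: rot_def)
qed

text \<open>The angle from \<open>u\<close> to \<open>w\<close> grows at the rate \<open>rot w - rot u\<close>. Both sides of the statement vanish for
parallel vectors, because \<open>rot\<close> only depends on the line spanned by its argument.\<close>

lemma has_derivative_coangle:
  fixes A :: "real \<Rightarrow> real^2^2"
  assumes pd: "\<And>s. s \<in> I \<Longrightarrow> pos_def (A s)" and t: "t \<in> I" and u: "u \<noteq> 0" and w: "w \<noteq> 0"
    and A': "\<And>i j. ((\<lambda>s. A s $ i $ j) has_real_derivative B $ i $ j) (at t within I)"
    and B: "B $ 2 $ 1 = B $ 1 $ 2"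
  shows "((\<lambda>s. coangle (A s) u w) has_real_derivative rot (A t) B u - rot (A t) B w) (at t within I)"
proof (cases "u $ 1 * w $ 2 - u $ 2 * w $ 1 = 0")
  case True
  have "\<exists>c. c \<noteq> 0 \<and> w = c *\<^sub>R u"
  proof (cases "u $ 1 = 0")
    case True
    then have u2: "u $ 2 \<noteq> 0" using u by (auto simp: vec_eq_iff forall_2)
    then have w1: "w $ 1 = 0" using True \<open>u $ 1 * w $ 2 - u $ 2 * w $ 1 = 0\<close> by simp
    then have "w $ 2 \<noteq> 0" using w by (auto simp: vec_eq_iff forall_2)
    then show ?thesis using u2 w1 True by (intro exI[of _ "w $ 2 / u $ 2"]) (auto simp: vec_eq_iff forall_2)
  next
    case False
    have w2: "w $ 2 = w $ 1 / u $ 1 * u $ 2" using False True by (simp add: field_simps)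
    then have "w $ 1 \<noteq> 0" using w by (auto simp: vec_eq_iff forall_2)
    then show ?thesis using False w2 by (intro exI[of _ "w $ 1 / u $ 1"]) (auto simp: vec_eq_iff forall_2)
  qed
  then have "rot (A t) B w = rot (A t) B u" by (auto simp: rot_scaleR)
  then show ?thesis by (simp add: coangle_def True)
next
  case False
  define c where "c = u $ 1 * w $ 2 - u $ 2 * w $ 1"
  have c: "c \<noteq> 0" using False by (simp add: c_def)
  note pt = pd[OF t]
  note e = pos_def_entries(1)[OF pt] det_pos_def[OF pt]
  define r where "r = sqrt (det (A t))"
  have r: "r > 0" "r * r = det (A t)" using e by (simp_all add: r_def)
  have qu: "bil (A t) u u > 0" and qw: "bil (A t) w w > 0" using bil_pos[OF pt] u w by auto
  define N where "N = bil (A t) u w"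
  have dN: "((\<lambda>s. bil (A s) u w) has_real_derivative bil B u w) (at t within I)"
    unfolding bil_2 by (rule derivative_eq_intros A' refl)+ (simp add: algebra_simps)
  define D' where "D' = B $ 1 $ 1 * A t $ 2 $ 2 + A t $ 1 $ 1 * B $ 2 $ 2 - 2 * A t $ 1 $ 2 * B $ 1 $ 2"
  have dD: "((\<lambda>s. det (A s)) has_real_derivative D') (at t within I)"
    unfolding det_2 D'_def by (rule derivative_eq_intros A' refl)+ (simp add: B e(1) algebra_simps)
  have dr: "((\<lambda>s. sqrt (det (A s))) has_real_derivative D' / (2 * r)) (at t within I)"
    using DERIV_chain2[OF DERIV_real_sqrt[OF e(3)] dD] by (simp add: r_def field_simps)
  have darg: "((\<lambda>s. bil (A s) u w / (sqrt (det (A s)) * c)) has_real_derivative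
      (bil B u w * (r * c) - N * (D' / (2 * r) * c)) / ((r * c) * (r * c))) (at t within I)"
    using DERIV_divide[OF dN DERIV_cmult_right[OF dr, of c]] r c by (simp add: r_def N_def)
  have "((\<lambda>s. arctan (bil (A s) u w / (sqrt (det (A s)) * c))) has_real_derivative
      inverse (1 + (N / (r * c))\<^sup>2) * ((bil B u w * (r * c) - N * (D' / (2 * r) * c)) / ((r * c) * (r * c))))
          (at t within I)"
    using DERIV_chain2[OF DERIV_arctan darg] by (simp add: N_def r_def)
  also have "inverse (1 + (N / (r * c))\<^sup>2) * ((bil B u w * (r * c) - N * (D' / (2 * r) * c)) / ((r * c) * (r * c)))
      = (bil B u w * (r * c) - N * (D' / (2 * r) * c)) / ((r * c) * (r * c) + N * N)"
  proof -
    have aux: "inverse (1 + (N / R)\<^sup>2) * (X / (R * R)) = X / (R * R + N * N)" if "R \<noteq> 0" for X R :: real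
    proof -
      have "1 + (N / R)\<^sup>2 = (R * R + N * N) / (R * R)" using that by (simp add: field_simps power2_eq_square)
      then show ?thesis using that by simp
    qed
    show ?thesis by (rule aux) (use r c in simp)
  qed
  \<comment> \<open>Lagrange's identity for the metric \<open>A t\<close>.\<close>
  also have "(r * c) * (r * c) + N * N = bil (A t) u u * bil (A t) w w"
  proof -
    have "(r * c) * (r * c) + N * N = det (A t) * (c * c) + N * N" unfolding r(2)[symmetric] by (simp only: mult_ac)
    then show ?thesis unfolding e(2) c_def N_def bil_2 e(1) by algebra
  qed
  also have "bil B u w * (r * c) - N * (D' / (2 * r) * c) = (2 * det (A t) * c * bil B u w - N * c * D') / (2 * r)"
    unfolding r(2)[symmetric] using r(1) by (simp add: field_simps)
  also have "\<dots> / (bil (A t) u u * bil (A t) w w) = rot (A t) B u - rot (A t) B w"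
  proof -
    define X where "X d = (B $ 1 $ 2 * d $ 1 + B $ 2 $ 2 * d $ 2) * (A t $ 1 $ 1 * d $ 1 + A t $ 1 $ 2 * d $ 2)
      - (B $ 1 $ 1 * d $ 1 + B $ 1 $ 2 * d $ 2) * (A t $ 1 $ 2 * d $ 1 + A t $ 2 $ 2 * d $ 2)" for d :: "real^2"
    have "2 * det (A t) * c * bil B u w - N * c * D' = X u * bil (A t) w w - X w * bil (A t) u u"
      unfolding e(2) c_def N_def D'_def X_def bil_2 e(1) B by algebra
    moreover have "rot (A t) B d = X d / (2 * r * bil (A t) d d)" for d
      by (simp add: rot_def X_def r_def)
    ultimately show ?thesis using r(1) qu qw by (simp add: field_simps)
  qed
  finally show ?thesis by (simp add: coangle_def c_def)
qed

text \<open>The equation \<open>k ds + \<beta> = d\<vartheta>\<close> along the direction \<open>(d, e)\<close>, where the metric moves with velocity \<open>s\<close>, its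
derivative in that direction. On the right stands \<open>rot (d, e) - rot \<partial>\<^sub>2\<close>. The notation is that of
\<open>curvature_algebra\<close>.\<close>

lemma edge_algebra:
  fixes E F G r :: real
  assumes D: "D = E * G - F * F" "G > 0" and r: "r * r = D" "r > 0"
    and E1: "E1 = 2 * (E * a11 + F * b11)" and E2: "E2 = 2 * (E * a12 + F * b12)"
    and F1: "F1 = (F * a11 + G * b11) + (E * a12 + F * b12)" and F2: "F2 = (F * a12 + G * b12) + (E * a22
        + F * b22)"
    and G1: "G1 = 2 * (F * a12 + G * b12)" and G2: "G2 = 2 * (F * a22 + G * b22)"
    and q: "q = E * d * d + 2 * F * d * e + G * e * e" "q > 0"
    and s: "s11 = d * E1 + e * E2" "s12 = d * F1 + e * F2" "s22 = d * G1 + e * G2"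
  shows "- (e * (d * d * a11 + 2 * d * e * a12 + e * e * a22) - d * (d * d * b11 + 2 * d * e * b12
      + e * e * b22)) * r / q
      + r * (d * a12 + e * a22) / G
    = ((s12 * d + s22 * e) * (E * d + F * e) - (s11 * d + s12 * e) * (F * d + G * e)) / (2 * r * q)
      - (s22 * F - s12 * G) / (2 * r * G)"
proof -
  let ?X = "(e * (d * d * a11 + 2 * d * e * a12 + e * e * a22) - d * (d * d * b11 + 2 * d * e * b12 + e * e * b22))"
  let ?Y = "(s12 * d + s22 * e) * (E * d + F * e) - (s11 * d + s12 * e) * (F * d + G * e)"
  have key: "- 2 * D * ?X * G + 2 * D * (d * a12 + e * a22) * q = ?Y * G - (s22 * F - s12 * G) * q"
    unfolding D(1) q s E1 E2 F1 F2 G1 G2 by algebra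
  have "- ?X * r / q + r * (d * a12 + e * a22) / G = (- 2 * (r * r) * ?X * G + 2 * (r * r) * (d * a12
      + e * a22) * q) / (2 * r * q * G)"
    using r(2) q(2) D(2) by (simp add: field_simps)
  also have "\<dots> = (?Y * G - (s22 * F - s12 * G) * q) / (2 * r * q * G)" unfolding r(1) key ..
  also have "\<dots> = ?Y / (2 * r * q) - (s22 * F - s12 * G) / (2 * r * G)"
    using r(2) q(2) D(2) by (simp add: field_simps)
  finally show ?thesis .
qed

text \<open>The identity \<open>- dV \<and> \<beta>' = 1/2 \<langle>S \<sigma>, \<nabla>\<nabla>V\<rangle> dA + d\<eta>\<close> in coordinates. All expressions carry the factor \<open>1 / r\<close>
with \<open>r\<close> the area density; the hypotheses are multiplied by \<open>2 * r\<close>, which leaves \<open>G\<close> as the only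
denominator and makes the claim a polynomial identity.\<close>

lemma variation_algebra:
  fixes E F G r :: real
  assumes D: "D = E * G - F * F" "G > 0" and r: "r * r = D" "r > 0"
    and E1: "E1 = 2 * (E * a11 + F * b11)" and E2: "E2 = 2 * (E * a12 + F * b12)"
    and F1: "F1 = (F * a11 + G * b11) + (E * a12 + F * b12)" and F2: "F2 = (F * a12 + G * b12) + (E * a22
        + F * b22)"
    and G1: "G1 = 2 * (F * a12 + G * b12)" and G2: "G2 = 2 * (F * a22 + G * b22)"
    and Dd: "Dd = s11 * G + E * s22 - 2 * F * s12"
    and b1: "2 * r * b1d = s11_2 - (s12 * G1 + F * s22_1) / G + F * G1 * s22 / (G * G) - a12 * Dd / G"
    and b2: "2 * r * b2d = 2 * s12_2 - s22_1 - (s12 * G2 + F * s22_2) / G + F * G2 * s22 / (G * G) - a22 * Dd / G"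
    and c: "2 * r * c = F * s22 / G - s12"
    and C1: "2 * r * c_1 = (F1 * s22 + F * s22_1) / G - F * s22 * G1 / (G * G) - s12_1 - (a11
        + b12) * (F * s22 / G - s12)"
    and C2: "2 * r * c_2 = (F2 * s22 + F * s22_2) / G - F * s22 * G2 / (G * G) - s12_2 - (a12
        + b22) * (F * s22 / G - s12)"
    and h1: "2 * r * eta2_1 = (- s12_1 * V2 - s12 * V12 + s22_1 * V1
        + s22 * V11) - (s22 * V1 - s12 * V2) * (a11 + b12) - 2 * r * (c_1 * V2 + c * V12)"
    and h2: "2 * r * eta1_2 = (- s11_2 * V2 - s11 * V22 + s12_2 * V1
        + s12 * V12) - (s12 * V1 - s11 * V2) * (a12 + b22) - 2 * r * (c_2 * V1 + c * V12)"
    and H: "H11 = V11 - (a11 * V1 + b11 * V2)" "H12 = V12 - (a12 * V1 + b12 * V2)" "H22 = V22 - (a22 * V1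
        + b22 * V2)"
  shows "- (V1 * b2d - V2 * b1d) + (s22 * H11 - 2 * s12 * H12 + s11 * H22) / (2 * r) = eta2_1 - eta1_2"
proof -
  define h where "h = 1 / G"
  have hG: "h * G = 1" using D(2) by (simp add: h_def)
  have dv: "x / G = x * h" "x / (G * G) = x * h * h" for x by (simp_all add: h_def)
  have cV: "2 * r * (c_1 * V2 + c * V12) = (2 * r * c_1) * V2 + (2 * r * c) * V12"
    "2 * r * (c_2 * V1 + c * V12) = (2 * r * c_2) * V1 + (2 * r * c) * V12" by (simp_all add: algebra_simps)
  have "2 * r * (eta2_1 - eta1_2) = 2 * r * eta2_1 - 2 * r * eta1_2" by (simp add: algebra_simps)
  also have "\<dots> = - (V1 * (2 * r * b2d) - V2 * (2 * r * b1d)) + (s22 * H11 - 2 * s12 * H12 + s11 * H22)"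
    using hG unfolding h1 h2 cV b1 b2 C1 C2 H dv Dd E1 E2 F1 F2 G1 G2 by algebra
  also have "\<dots> = 2 * r * (- (V1 * b2d - V2 * b1d) + (s22 * H11 - 2 * s12 * H12 + s11 * H22) / (2 * r))"
    using r(2) by (simp add: field_simps)
  finally show ?thesis using r(2) by simp
qed

section \<open>Curvature of a metric on the triangle\<close>

lemma pd_divide:
  fixes f g :: "real^2 \<Rightarrow> real"
  assumes "x \<in> ref_tri" "f differentiable (at x within ref_tri)" "g differentiable (at x within ref_tri)" "g x \<noteq> 0"
  shows "pd ref_tri i (\<lambda>x. f x / g x) x = pd ref_tri i f x / g x - f x * pd ref_tri i g x / (g x * g x)"
proof -
  have "(\<lambda>x. inverse (g x)) differentiable (at x within ref_tri)"
    using assms(3,4) by (rule differentiable_inverse)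
  then show ?thesis
    unfolding divide_inverse[of "f _" "g _"]
    using pd_mult[OF assms(1,2), of "\<lambda>x. inverse (g x)" i] pd_inverse[OF assms(1,3,4), of i]
    by (simp add: divide_inverse power2_eq_square)
qed

lemma differentiable_vec:
  fixes f :: "real^2 \<Rightarrow> real^2"
  assumes "\<And>i. (\<lambda>x. f x $ i) differentiable (at x within S)"
  shows "f differentiable (at x within S)"
  unfolding differentiable_componentwise_within[of f]
  using assms by (auto simp: Basis_real2 inner_axis)

lemma differentiable_matrix:
  fixes f :: "real^2 \<Rightarrow> real^2^2"
  assumes "\<And>i j. (\<lambda>x. f x $ i $ j) differentiable (at x within S)"
  shows "f differentiable (at x within S)"
  unfolding differentiable_componentwise_within[of f]
proof
  fix b :: "real^2^2" assume "b \<in> Basis"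
  then obtain i j where "b = axis i (axis j 1)" by (auto simp: Basis_vec_def)
  then show "(\<lambda>x. f x \<bullet> b) differentiable (at x within S)"
    using assms[of i j] by (simp add: inner_axis)
qed

lemma arccos_coangle:
  assumes A: "pos_def A" and c: "u $ 1 * w $ 2 - u $ 2 * w $ 1 > 0"
  shows "arccos (bil A u w / (len A u * len A w)) = pi / 2 - coangle A u w"
proof -
  note e = pos_def_entries(1)[OF A] det_pos_def[OF A]
  define k where "k = u $ 1 * w $ 2 - u $ 2 * w $ 1"
  define N where "N = bil A u w"
  define r where "r = sqrt (det A)"
  define l where "l = len A u * len A w"
  have r: "r > 0" "r * r = det A" using e by (simp_all add: r_def)
  have k: "k > 0" using c by (simp add: k_def)
  have "u \<noteq> 0" "w \<noteq> 0" using c by auto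
  then have q: "bil A u u > 0" "bil A w w > 0" using bil_pos[OF A] by auto
  then have "len A u * len A u = bil A u u" "len A w * len A w = bil A w w" and l1: "l > 0"
    by (simp_all add: l_def len_def)
  moreover have "l * l = (len A u * len A u) * (len A w * len A w)" by (simp only: l_def mult_ac)
  ultimately have l: "l > 0" "l * l = bil A u u * bil A w w" by simp_all
  have "N * N + (r * k) * (r * k) = N * N + det A * (k * k)" by (simp add: algebra_simps flip: r(2))
  also have "\<dots> = l * l" unfolding l(2) e(2) k_def N_def bil_2 e(1) by algebra
  finally have sum: "N * N + (r * k) * (r * k) = l * l" .
  have "N * N < l * l" using sum r k by (simp add: mult_pos_pos add_pos_pos flip: sum)
  then have "\<bar>N\<bar> < l" using l(1) by (metis abs_mult_self_eq abs_of_pos mult_mono' not_le abs_ge_zero less_imp_le)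
  then have x: "- 1 < N / l" "N / l < 1" using l(1) by (auto simp: field_simps)
  have "1 - (N / l)\<^sup>2 = ((r * k) / l)\<^sup>2"
    using sum l(1) by (simp add: field_simps power2_eq_square)
  then have s: "sqrt (1 - (N / l)\<^sup>2) = r * k / l" using r k l by simp
  have "arccos (N / l) = pi / 2 - arctan (N / l / (r * k / l))"
    using arccos_arctan[OF x] unfolding s .
  also have "N / l / (r * k / l) = N / (r * k)" using l(1) by simp
  finally show ?thesis by (simp add: N_def l_def coangle_def r_def k_def)
qed

text \<open>The components of the connection form \<open>\<langle>\<nabla> e\<^sub>2, e\<^sub>1\<rangle>\<close> of the oriented orthonormal frame with
\<open>e\<^sub>2 = \<partial>\<^sub>2 / |\<partial>\<^sub>2|\<close>, for a metric \<open>A\<close> with partial derivatives \<open>B1\<close> and \<open>B2\<close>. Time derivatives are taken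
of these formulas; in terms of Christoffel symbols see \<open>conn_christoffel\<close>.\<close>

definition conn1 :: "real^2^2 \<Rightarrow> real^2^2 \<Rightarrow> real^2^2 \<Rightarrow> real" where
  "conn1 A B1 B2 = (B2 $ 1 $ 1 - A $ 1 $ 2 * B1 $ 2 $ 2 / A $ 2 $ 2) / (2 * sqrt (det A))"

definition conn2 :: "real^2^2 \<Rightarrow> real^2^2 \<Rightarrow> real^2^2 \<Rightarrow> real" where
  "conn2 A B1 B2 = (2 * B2 $ 1 $ 2 - B1 $ 2 $ 2 - A $ 1 $ 2 * B2 $ 2 $ 2 / A $ 2 $ 2) / (2 * sqrt (det A))"

locale triangle_metric =
  fixes g :: "real^2 \<Rightarrow> real^2^2"
  assumes C2_entry: "C2 (\<lambda>x. g x $ i $ j)" and pos: "x \<in> ref_tri \<Longrightarrow> pos_def (g x)"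
begin

abbreviation "E \<equiv> \<lambda>x. g x $ 1 $ 1"
abbreviation "F \<equiv> \<lambda>x. g x $ 1 $ 2"
abbreviation "G \<equiv> \<lambda>x. g x $ 2 $ 2"
abbreviation "\<Gamma> \<equiv> christoffel ref_tri g"
abbreviation "P \<equiv> pd ref_tri"
abbreviation "r \<equiv> \<lambda>x. sqrt (det (g x))"

lemma C1_entry: "C1 (\<lambda>x. g x $ i $ j)"
  using C2_entry by (simp add: C2_def)

lemma C1_pd_entry: "C1 (pd ref_tri k (\<lambda>x. g x $ i $ j))"
  using C2_entry by (simp add: C2_def)

lemma pos_entries:
  assumes "x \<in> ref_tri"
  shows "g x $ 2 $ 1 = F x" "det (g x) = E x * G x - F x * F x" "det (g x) > 0" "G x > 0" "E x > 0"
    "r x > 0" "r x * r x = det (g x)"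
  using pos_def_entries[OF pos[OF assms]] det_pos_def[OF pos[OF assms]] by simp_all

lemma differentiable_g: "x \<in> ref_tri \<Longrightarrow> g differentiable (at x within ref_tri)"
  by (intro differentiable_matrix C1_differentiable C1_entry)

lemma pd_entry: "x \<in> ref_tri \<Longrightarrow> pd ref_tri k g x $ i $ j = pd ref_tri k (\<lambda>x. g x $ i $ j) x"
  by (rule pd_bounded_linear[of "\<lambda>A. A $ i $ j", symmetric])
    (auto intro!: differentiable_g bounded_linear_compose[OF bounded_linear_vec_nth bounded_linear_vec_nth])

lemma pd_sym: "x \<in> ref_tri \<Longrightarrow> P k (\<lambda>x. g x $ 2 $ 1) x = P k F x"
  by (rule pd_cong) (auto simp: pos_entries)

lemma christoffel_1: "x \<in> ref_tri \<Longrightarrow> \<Gamma> i j x $ 1 =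
    (G x * (P i (\<lambda>x. g x $ j $ 1) x + P j (\<lambda>x. g x $ i $ 1) x - P 1 (\<lambda>x. g x $ i $ j) x)
    - F x * (P i (\<lambda>x. g x $ j $ 2) x + P j (\<lambda>x. g x $ i $ 2) x - P 2 (\<lambda>x. g x $ i $ j) x)) / (2 * det (g x))"
  by (simp add: christoffel_def sum_2 matrix_inv_pos_def[OF pos] pd_entry diff_divide_distrib mult.commute)

lemma christoffel_2: "x \<in> ref_tri \<Longrightarrow> \<Gamma> i j x $ 2 =
    (E x * (P i (\<lambda>x. g x $ j $ 2) x + P j (\<lambda>x. g x $ i $ 2) x - P 2 (\<lambda>x. g x $ i $ j) x)
    - F x * (P i (\<lambda>x. g x $ j $ 1) x + P j (\<lambda>x. g x $ i $ 1) x - P 1 (\<lambda>x. g x $ i $ j) x)) / (2 * det (g x))"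
  by (simp add: christoffel_def sum_2 matrix_inv_pos_def[OF pos] pd_entry diff_divide_distrib mult.commute)

lemma C1_det: "C1 (\<lambda>x. det (g x))"
  unfolding det_2 by (intro C1_diff C1_mult C1_entry)

lemma C1_r: "C1 r"
  by (intro C1_sqrt C1_det) (rule pos_entries(3))

lemma C1_christoffel: "C1 (\<lambda>x. \<Gamma> i j x $ k)"
proof -
  have d: "2 * det (g x) \<noteq> 0" if "x \<in> ref_tri" for x using pos_entries(3)[OF that] by simp
  have "C1 (\<lambda>x. \<Gamma> i j x $ 1)"
    by (rule iffD2[OF C1_cong], erule christoffel_1)
      (intro C1_divide C1_diff C1_mult C1_add C1_entry C1_pd_entry C1_det C1_const d)
  moreover have "C1 (\<lambda>x. \<Gamma> i j x $ 2)"
    by (rule iffD2[OF C1_cong], erule christoffel_2)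
      (intro C1_divide C1_diff C1_mult C1_add C1_entry C1_pd_entry C1_det C1_const d)
  ultimately show ?thesis using exhaust_2[of k] by auto
qed

lemma pd_christoffel: "x \<in> ref_tri \<Longrightarrow> P k (\<Gamma> i j) x $ l = P k (\<lambda>x. \<Gamma> i j x $ l) x"
  by (rule pd_bounded_linear[of "\<lambda>v. v $ l", symmetric])
    (auto intro!: differentiable_vec C1_differentiable[OF C1_christoffel] bounded_linear_vec_nth)

lemma christoffel_sym: "x \<in> ref_tri \<Longrightarrow> \<Gamma> 2 1 x = \<Gamma> 1 2 x"
  by (simp add: vec_eq_iff forall_2 christoffel_1 christoffel_2 pd_sym add.commute)

text \<open>The equations \<open>\<partial>\<^sub>k \<langle>\<partial>\<^sub>i, \<partial>\<^sub>j\<rangle> = \<langle>\<nabla>\<^sub>k \<partial>\<^sub>i, \<partial>\<^sub>j\<rangle> + \<langle>\<partial>\<^sub>i, \<nabla>\<^sub>k \<partial>\<^sub>j\<rangle>\<close>. With them every identity between first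
derivatives of the metric becomes one between Christoffel symbols.\<close>

lemma metric_compatible:
  assumes x: "x \<in> ref_tri"
  shows "P 1 E x = 2 * (E x * \<Gamma> 1 1 x $ 1 + F x * \<Gamma> 1 1 x $ 2)"
    "P 2 E x = 2 * (E x * \<Gamma> 1 2 x $ 1 + F x * \<Gamma> 1 2 x $ 2)"
    "P 1 F x = (F x * \<Gamma> 1 1 x $ 1 + G x * \<Gamma> 1 1 x $ 2) + (E x * \<Gamma> 1 2 x $ 1 + F x * \<Gamma> 1 2 x $ 2)"
    "P 2 F x = (F x * \<Gamma> 1 2 x $ 1 + G x * \<Gamma> 1 2 x $ 2) + (E x * \<Gamma> 2 2 x $ 1 + F x * \<Gamma> 2 2 x $ 2)"
    "P 1 G x = 2 * (F x * \<Gamma> 1 2 x $ 1 + G x * \<Gamma> 1 2 x $ 2)"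
    "P 2 G x = 2 * (F x * \<Gamma> 2 2 x $ 1 + G x * \<Gamma> 2 2 x $ 2)"
proof -
  have D: "E x * G x - F x * F x \<noteq> 0" using pos_entries(2,3)[OF x] by simp
  have low: "E x * ((G x * a - F x * b) / (2 * det (g x))) + F x * ((E x * b - F x * a) / (2 * det (g x))) = a / 2"
    "F x * ((G x * a - F x * b) / (2 * det (g x))) + G x * ((E x * b - F x * a) / (2 * det (g x))) = b / 2" for a b
    unfolding pos_entries(2)[OF x] using D by (auto simp: divide_simps) (auto simp: algebra_simps)
  note c = christoffel_1[OF x] christoffel_2[OF x] pd_sym[OF x]
  show "P 1 E x = 2 * (E x * \<Gamma> 1 1 x $ 1 + F x * \<Gamma> 1 1 x $ 2)"
    "P 2 E x = 2 * (E x * \<Gamma> 1 2 x $ 1 + F x * \<Gamma> 1 2 x $ 2)"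
    "P 1 F x = (F x * \<Gamma> 1 1 x $ 1 + G x * \<Gamma> 1 1 x $ 2) + (E x * \<Gamma> 1 2 x $ 1 + F x * \<Gamma> 1 2 x $ 2)"
    "P 2 F x = (F x * \<Gamma> 1 2 x $ 1 + G x * \<Gamma> 1 2 x $ 2) + (E x * \<Gamma> 2 2 x $ 1 + F x * \<Gamma> 2 2 x $ 2)"
    "P 1 G x = 2 * (F x * \<Gamma> 1 2 x $ 1 + G x * \<Gamma> 1 2 x $ 2)"
    "P 2 G x = 2 * (F x * \<Gamma> 2 2 x $ 1 + G x * \<Gamma> 2 2 x $ 2)"
    unfolding c low by (simp_all add: field_simps)
qed

lemma pd_r:
  assumes x: "x \<in> ref_tri"
  shows "P 1 r x = r x * (\<Gamma> 1 1 x $ 1 + \<Gamma> 1 2 x $ 2)" "P 2 r x = r x * (\<Gamma> 1 2 x $ 1 + \<Gamma> 2 2 x $ 2)"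
proof -
  note d = C1_differentiable[OF C1_entry x]
  have pdet: "P i (\<lambda>x. det (g x)) x = P i E x * G x + E x * P i G x - (P i F x * F x + F x * P i F x)" for i
  proof -
    have "P i (\<lambda>x. det (g x)) x = P i (\<lambda>x. E x * G x - F x * F x) x"
      by (rule pd_cong[OF _ x]) (simp add: pos_entries)
    also have "\<dots> = P i E x * G x + E x * P i G x - (P i F x * F x + F x * P i F x)"
      by (simp add: pd_diff[OF x] pd_mult[OF x] d)
    finally show ?thesis .
  qed
  have pr: "P i r x = P i (\<lambda>x. det (g x)) x / (2 * r x)" for i
    by (rule pd_sqrt[OF x C1_differentiable[OF C1_det x] pos_entries(3)[OF x]])
  have "P 1 (\<lambda>x. det (g x)) x = 2 * det (g x) * (\<Gamma> 1 1 x $ 1 + \<Gamma> 1 2 x $ 2)"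
    unfolding pdet metric_compatible[OF x] pos_entries(2)[OF x] by algebra
  moreover have "P 2 (\<lambda>x. det (g x)) x = 2 * det (g x) * (\<Gamma> 1 2 x $ 1 + \<Gamma> 2 2 x $ 2)"
    unfolding pdet metric_compatible[OF x] pos_entries(2)[OF x] by algebra
  moreover have "2 * y * z / (2 * a) = a * z" if "a * a = y" "a > 0" for a y z :: real
    using that by (auto simp: field_simps)
  ultimately show "P 1 r x = r x * (\<Gamma> 1 1 x $ 1 + \<Gamma> 1 2 x $ 2)" "P 2 r x = r x * (\<Gamma> 1 2 x $ 1 + \<Gamma> 2 2 x $ 2)"
    unfolding pr using pos_entries(6,7)[OF x] by auto
qed

abbreviation "\<beta>1 \<equiv> \<lambda>x. conn1 (g x) (pd ref_tri 1 g x) (pd ref_tri 2 g x)"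
abbreviation "\<beta>2 \<equiv> \<lambda>x. conn2 (g x) (pd ref_tri 1 g x) (pd ref_tri 2 g x)"

lemma conn_christoffel:
  assumes x: "x \<in> ref_tri"
  shows "\<beta>1 x = r x * (\<Gamma> 1 2 x $ 1 / G x)" "\<beta>2 x = r x * (\<Gamma> 2 2 x $ 1 / G x)"
proof -
  note e = pos_entries[OF x]
  have aux: "2 * y * b / G x / (2 * a) = a * (b / G x)" if "a > 0" "a * a = y" for a b y :: real
    using that e by (auto simp: field_simps)
  have "P 2 E x - F x * P 1 G x / G x = 2 * det (g x) * \<Gamma> 1 2 x $ 1 / G x"
    unfolding metric_compatible[OF x] e(2) using e(4) by (simp add: field_simps)
  then show "\<beta>1 x = r x * (\<Gamma> 1 2 x $ 1 / G x)"
    unfolding conn1_def pd_entry[OF x] using aux[OF e(6,7)] by simp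
  have "2 * P 2 F x - P 1 G x - F x * P 2 G x / G x = 2 * det (g x) * \<Gamma> 2 2 x $ 1 / G x"
    unfolding metric_compatible[OF x] e(2) using e(4) by (simp add: field_simps)
  then show "\<beta>2 x = r x * (\<Gamma> 2 2 x $ 1 / G x)"
    unfolding conn2_def pd_entry[OF x] using aux[OF e(6,7)] by simp
qed

lemma C1_conn: "C1 \<beta>1" "C1 \<beta>2"
proof -
  have G: "G x \<noteq> 0" if "x \<in> ref_tri" for x using pos_entries(4)[OF that] by simp
  show "C1 \<beta>1" by (rule iffD2[OF C1_cong], erule conn_christoffel(1))
      (intro C1_mult C1_divide C1_r C1_christoffel C1_entry G)
  show "C1 \<beta>2" by (rule iffD2[OF C1_cong], erule conn_christoffel(2))
      (intro C1_mult C1_divide C1_r C1_christoffel C1_entry G)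
qed

text \<open>The form \<open>K dA\<close> is the exterior derivative of the connection form of a frame. The frame is adapted to
\<open>\<partial>\<^sub>2\<close>, so \<open>R(\<partial>\<^sub>1, \<partial>\<^sub>2) \<partial>\<^sub>2\<close> enters, the vector from which \<open>gauss_curvature\<close> is defined.\<close>

lemma gauss_curvature_exact:
  assumes x: "x \<in> ref_tri"
  shows "gauss_curvature ref_tri g x * area_density g x = P 1 \<beta>2 x - P 2 \<beta>1 x"
proof -
  note e = pos_entries[OF x]
  note d = C1_differentiable[OF C1_entry x] C1_differentiable[OF C1_christoffel x] C1_differentiable[OF C1_r x]
  have diff: "(\<lambda>x. \<Gamma> i j x $ k / G x) differentiable (at x within ref_tri)" for i j k
    using d e(4) by (auto intro!: differentiable_divide)
  have p\<beta>: "P m (\<lambda>x. r x * (\<Gamma> i j x $ 1 / G x)) x = P m r x * (\<Gamma> i j x $ 1 / G x)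
      + r x * (P m (\<lambda>x. \<Gamma> i j x $ 1) x / G x - \<Gamma> i j x $ 1 * P m G x / (G x * G x))" for m i j
    unfolding pd_mult[OF x d(3) diff] pd_divide[OF x d(2) d(1) less_imp_neq[OF e(4), symmetric]] ..
  let ?p = "\<lambda>m i j k. P m (\<lambda>x. \<Gamma> i j x $ k) x"
  have low: "F x * \<Gamma> i 2 x $ 1 + G x * \<Gamma> i 2 x $ 2 = P i G x / 2" if "x \<in> ref_tri" for i x
    using metric_compatible(5,6)[OF that] exhaust_2[of i] by auto
  have plow: "P m F x * \<Gamma> i 2 x $ 1 + F x * ?p m i 2 1 + (P m G x * \<Gamma> i 2 x $ 2 + G x * ?p m i 2 2)
      = P m (P i G) x / 2" for m i
  proof -
    have "P m F x * \<Gamma> i 2 x $ 1 + F x * ?p m i 2 1 + (P m G x * \<Gamma> i 2 x $ 2 + G x * ?p m i 2 2)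
        = P m (\<lambda>x. F x * \<Gamma> i 2 x $ 1 + G x * \<Gamma> i 2 x $ 2) x"
      by (simp add: pd_add[OF x] pd_mult[OF x] d)
    also have "\<dots> = P m (\<lambda>x. P i G x * (1 / 2)) x"
      by (rule pd_cong[OF _ x]) (simp add: low)
    also have "\<dots> = P m (P i G) x / 2"
      unfolding pd_mult[OF x C1_differentiable[OF C1_pd_entry x] differentiable_const] using x by simp
    finally show ?thesis .
  qed
  \<comment> \<open>Subtracting the two derivatives of \<open>low\<close>, the second derivatives of \<open>g\<^sub>2\<^sub>2\<close> cancel.\<close>
  have cod: "F x * (?p 1 2 2 1 - ?p 2 1 2 1) + G x * (?p 1 2 2 2 - ?p 2 1 2 2)
      + (P 1 F x * \<Gamma> 2 2 x $ 1 + P 1 G x * \<Gamma> 2 2 x $ 2 - P 2 F x * \<Gamma> 1 2 x $ 1 - P 2 G x * \<Gamma> 1 2 x $ 2) = 0"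
    using plow[of 1 2] plow[of 2 1] C2_pd_commute[OF C2_entry[of 2 2] x, of 1 2] by (simp add: algebra_simps)
  have c: "curv_vec ref_tri g x $ k = ?p 1 2 2 k - ?p 2 1 2 k
      + (\<Gamma> 2 2 x $ 1 * \<Gamma> 1 1 x $ k + \<Gamma> 2 2 x $ 2 * \<Gamma> 1 2 x $ k - \<Gamma> 1 2 x $ 1 * \<Gamma> 1 2 x $ k - \<Gamma> 1 2 x $ 2 * \<Gamma> 2
          2 x $ k)" for k
    by (simp add: curv_vec_def sum_2 pd_christoffel[OF x] christoffel_sym[OF x])
  have "gauss_curvature ref_tri g x * area_density g x
      = ((curv_vec ref_tri g x $ 1 * E x + curv_vec ref_tri g x $ 2 * F x) / det (g x)) * r x"
    by (simp add: gauss_curvature_def area_density_def bil_2 axis_def e(1))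
  also have "\<dots> = (r x * (\<Gamma> 1 1 x $ 1 + \<Gamma> 1 2 x $ 2) * (\<Gamma> 2 2 x $ 1 / G x)
        + r x * (?p 1 2 2 1 / G x - \<Gamma> 2 2 x $ 1 * P 1 G x / (G x * G x)))
      - (r x * (\<Gamma> 1 2 x $ 1 + \<Gamma> 2 2 x $ 2) * (\<Gamma> 1 2 x $ 1 / G x)
        + r x * (?p 2 1 2 1 / G x - \<Gamma> 1 2 x $ 1 * P 2 G x / (G x * G x)))"
    by (rule curvature_algebra[OF e(2,3,4,7,6) metric_compatible(1,2,3,4,5,6)[OF x] cod c c])
  also have "\<dots> = P 1 (\<lambda>x. r x * (\<Gamma> 2 2 x $ 1 / G x)) x - P 2 (\<lambda>x. r x * (\<Gamma> 1 2 x $ 1 / G x)) x"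
    unfolding p\<beta> pd_r[OF x] ..
  also have "\<dots> = P 1 \<beta>2 x - P 2 \<beta>1 x"
    using pd_cong[OF conn_christoffel(1) x, where i = 2] pd_cong[OF conn_christoffel(2) x, where i = 1] by simp
  finally show ?thesis .
qed

text \<open>The sides of the reference triangle are straight lines traversed at constant velocity, so their
acceleration consists of Christoffel symbols only.\<close>

lemma geodesic_curvature_side:
  fixes k :: 3 and s :: real
  assumes s: "s \<in> {0..1}"
  defines "x \<equiv> ref_path k s" and "d \<equiv> side_dir k"
  shows "side_curvature g k s * side_speed g k s
    = - (d $ 2 * (d $ 1 * d $ 1 * \<Gamma> 1 1 x $ 1 + 2 * d $ 1 * d $ 2 * \<Gamma> 1 2 x $ 1 + d $ 2 * d $ 2 * \<Gamma> 2 2 x $ 1)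
       - d $ 1 * (d $ 1 * d $ 1 * \<Gamma> 1 1 x $ 2 + 2 * d $ 1 * d $ 2 * \<Gamma> 1 2 x $ 2 + d $ 2 * d $ 2 * \<Gamma> 2 2 x $ 2))
      * r x / bil (g x) d d"
proof -
  have x: "x \<in> ref_tri" unfolding x_def by (rule ref_path_in_ref_tri[OF s])
  have d0: "d \<noteq> 0" by (simp add: d_def side_dir_nonzero)
  have v: "velocity (ref_path k) s = d" by (simp add: d_def velocity_ref_path[OF s])
  have "(velocity (ref_path k) has_vector_derivative 0) (at s within {0..1})"
    by (rule has_vector_derivative_transform[OF s _ has_vector_derivative_const[of d]])
      (simp add: velocity_ref_path d_def)
  then have vv: "velocity (velocity (ref_path k)) s = 0"
    unfolding velocity_def[of "velocity _"]
    using s by (intro vector_derivative_within_closed_interval) auto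
  define a where "a = cov_accel ref_tri g (ref_path k) s"
  have a: "a $ l = d $ 1 * d $ 1 * \<Gamma> 1 1 x $ l + 2 * d $ 1 * d $ 2 * \<Gamma> 1 2 x $ l
      + d $ 2 * d $ 2 * \<Gamma> 2 2 x $ l" for l
    by (simp add: a_def cov_accel_def vv v sum_2 christoffel_sym[OF x] algebra_simps flip: x_def)
  have q: "bil (g x) d d > 0" using bil_pos[OF pos[OF x] d0] .
  have "side_curvature g k s * side_speed g k s
      = - ((a $ 1 * d $ 2 - a $ 2 * d $ 1) * r x / sqrt (bil (g x) d d)) / bil (g x) d d * sqrt (bil (g x) d d)"
    unfolding side_curvature_def geodesic_curvature_def side_speed_def len_def v x_def[symmetric] a_def[symmetric]
      bil_right_normal[OF pos[OF x] d0] ..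
  also have "\<dots> = - (a $ 1 * d $ 2 - a $ 2 * d $ 1) * r x / bil (g x) d d"
  proof -
    have "- (X * R / sqrt y) / y * sqrt y = - X * R / y" if "y > 0" for X R y :: real
      using that by simp
    from this[OF q] show ?thesis .
  qed
  also have "\<dots> = - (d $ 2 * a $ 1 - d $ 1 * a $ 2) * r x / bil (g x) d d"
    by (simp only: mult.commute)
  finally show ?thesis unfolding a .
qed

text \<open>Along a side, the angle from \<open>\<partial>\<^sub>2\<close> to the tangent changes by \<open>k ds + \<beta>\<close>: the tangent turns with the geodesic
curvature relative to a parallel frame, and the frame itself turns by the connection form.\<close>

lemma has_derivative_coangle_side:
  fixes k :: 3 and s :: real
  assumes s: "s \<in> {0..1}"
  defines "d \<equiv> side_dir k"
  shows "((\<lambda>s. - coangle (g (ref_path k s)) (axis 2 1) d) has_real_derivative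
      side_curvature g k s * side_speed g k s + (\<beta>1 (ref_path k s) * d $ 1 + \<beta>2 (ref_path k s) * d $ 2))
          (at s within {0..1})"
proof -
  define x where "x = ref_path k s"
  have x: "x \<in> ref_tri" unfolding x_def by (rule ref_path_in_ref_tri[OF s])
  have d0: "d \<noteq> 0" by (simp add: d_def side_dir_nonzero)
  note e = pos_entries[OF x]
  define B where "B = d $ 1 *\<^sub>R P 1 g x + d $ 2 *\<^sub>R P 2 g x"
  have B: "B $ i $ j = d $ 1 * P 1 (\<lambda>x. g x $ i $ j) x + d $ 2 * P 2 (\<lambda>x. g x $ i $ j) x" for i j
    by (simp add: B_def pd_entry[OF x])
  have dg: "((\<lambda>s. g (ref_path k s) $ i $ j) has_real_derivative B $ i $ j) (at s within {0..1})" for i j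
    unfolding B d_def x_def by (rule has_derivative_side[OF C1_entry s])
  have "((\<lambda>s. coangle (g (ref_path k s)) (axis 2 1) d) has_real_derivative rot (g x) B (axis 2 1) - rot (g x)
      B d) (at s within {0..1})"
    unfolding x_def
    by (rule has_derivative_coangle[OF _ s _ d0 dg])
      (auto simp: axis_eq_0_iff ref_path_in_ref_tri intro!: pos, simp add: B pd_sym[OF x])
  from DERIV_minus[OF this]
  have D: "((\<lambda>s. - coangle (g (ref_path k s)) (axis 2 1) d) has_real_derivative rot (g x) B d - rot (g x) B
      (axis 2 1)) (at s within {0..1})"
    by simp
  have rot2: "rot (g x) B (axis 2 1) = (B $ 2 $ 2 * F x - B $ 1 $ 2 * G x) / (2 * r x * G x)"
    by (simp add: rot_def axis_def bil_2)
  have q: "bil (g x) d d = E x * d $ 1 * d $ 1 + 2 * F x * d $ 1 * d $ 2 + G x * d $ 2 * d $ 2"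
    by (simp add: bil_2 e(1) algebra_simps)
  have "side_curvature g k s * side_speed g k s + (\<beta>1 x * d $ 1 + \<beta>2 x * d $ 2)
      = side_curvature g k s * side_speed g k s + r x * (d $ 1 * \<Gamma> 1 2 x $ 1 + d $ 2 * \<Gamma> 2 2 x $ 1) / G x"
    unfolding conn_christoffel[OF x] by (simp add: add_divide_distrib algebra_simps)
  also have "\<dots> = rot (g x) B d - rot (g x) B (axis 2 1)"
    unfolding geodesic_curvature_side[OF s, of k, folded x_def d_def] rot2
    unfolding rot_def
    by (rule edge_algebra[OF e(2,4,7,6) metric_compatible[OF x] q bil_pos[OF pos[OF x] d0] B B B])
  finally show ?thesis using D unfolding x_def by simp
qed

end

section \<open>A weighted Gauss-Bonnet formula\<close>

definition triangle_functional :: "(real^2 \<Rightarrow> real^2^2) \<Rightarrow> (real^2 \<Rightarrow> real) \<Rightarrow> real" where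
  "triangle_functional g V =
     tri_integral g (\<lambda>x. V x * gauss_curvature ref_tri g x)
     + (\<Sum>k\<in>UNIV. integral {0..1} (\<lambda>s. V (ref_path k s) * (side_curvature g k s * side_speed g k s)))
     - (\<Sum>k\<in>UNIV. V (ref_vertex k) * vertex_angle g k)"

text \<open>What integration by parts along the incoming side \<open>m + 1\<close> and the outgoing side \<open>m + 2\<close> leaves at the
vertex \<open>m\<close>, minus the interior angle there.\<close>

definition corner_defect :: "real^2^2 \<Rightarrow> 3 \<Rightarrow> real" where
  "corner_defect A m = - coangle A (axis 2 1) (side_dir (m + 1)) + coangle A (axis 2 1) (side_dir (m + 2))
     + coangle A (side_dir (m + 2)) (- side_dir (m + 1)) - pi / 2"

definition side_derivative :: "(real^2 \<Rightarrow> real) \<Rightarrow> 3 \<Rightarrow> real \<Rightarrow> real" where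
  "side_derivative V k s = side_dir k $ 1 * pd ref_tri 1 V (ref_path k s)
      + side_dir k $ 2 * pd ref_tri 2 V (ref_path k s)"

lemma sum_3_shift:
  fixes f g :: "3 \<Rightarrow> 'a::comm_monoid_add"
  shows "(\<Sum>k\<in>UNIV. f (k + c)) = (\<Sum>k\<in>UNIV. f k)"
proof -
  have "bij (\<lambda>k::3. k + c)" by (rule o_bij[of "\<lambda>k. k - c"]) (auto simp: fun_eq_iff)
  from sum.reindex_bij_betw[OF this, of f] show ?thesis .
qed

lemma three_arith: "m + 1 + 2 = (m :: 3)" "m + 2 + 1 = m" "m + 2 + 2 = m + 1" "m + 1 + 1 = m + 2"
  using exhaust_3[of m] by auto

lemma cross_side_dir: "side_dir (m + 2) $ 1 * (- side_dir (m + 1)) $ 2 - side_dir (m + 2) $ 2 * (- side_dir (m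
    + 1)) $ 1 > 0"
  using exhaust_3[of m] by (auto simp: side_dir_def ref_vertex_def axis_def)

lemma vertex_angle_coangle:
  assumes "pos_def (g (ref_vertex m))"
  shows "vertex_angle g m = pi / 2 - coangle (g (ref_vertex m)) (side_dir (m + 2)) (- side_dir (m + 1))"
  using arccos_coangle[OF assms cross_side_dir]
  by (simp add: vertex_angle_def Let_def side_dir_def three_arith)

context triangle_metric
begin

lemma continuous_on_christoffel: "continuous_on ref_tri (\<lambda>x. \<Gamma> i j x $ k)"
  by (rule C1_continuous[OF C1_christoffel])

lemma continuous_side_curvature:
  "continuous_on {0..1} (\<lambda>s. side_curvature g k s * side_speed g k s)"
proof -
  define d where "d = side_dir k"
  have d0: "d \<noteq> 0" by (simp add: d_def side_dir_nonzero)
  have q: "bil (g x) d d \<noteq> 0" if "x \<in> ref_tri" for x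
    using bil_pos[OF pos[OF that] d0] by simp
  have cq: "continuous_on ref_tri (\<lambda>x. bil (g x) d d)"
    unfolding bil_2 by (intro continuous_intros C1_continuous[OF C1_entry])
  have "continuous_on ref_tri (\<lambda>x. - (d $ 2 * (d $ 1 * d $ 1 * \<Gamma> 1 1 x $ 1 + 2 * d $ 1 * d $ 2 * \<Gamma> 1 2 x $ 1
      + d $ 2 * d $ 2 * \<Gamma> 2 2 x $ 1)
       - d $ 1 * (d $ 1 * d $ 1 * \<Gamma> 1 1 x $ 2 + 2 * d $ 1 * d $ 2 * \<Gamma> 1 2 x $ 2 + d $ 2 * d $ 2 * \<Gamma> 2 2 x $ 2))
      * r x / bil (g x) d d)"
    by (intro continuous_on_mult continuous_on_add continuous_on_diff continuous_on_minus continuous_on_divide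
        continuous_on_real_sqrt continuous_on_const continuous_on_christoffel C1_continuous[OF C1_det] cq ballI q)
  from continuous_on_side[OF this, of k] show ?thesis
    by (rule continuous_on_eq) (simp add: geodesic_curvature_side d_def)
qed

text \<open>Only first derivatives of the metric and of \<open>V\<close> are left on the right-hand side. For \<open>V = 1\<close> only
the corner terms remain, as in the theorem of Gauss and Bonnet.\<close>

lemma triangle_functional_eq:
  assumes V: "C1 V"
  shows "triangle_functional g V =
    - integral ref_tri (\<lambda>x. P 1 V x * \<beta>2 x - P 2 V x * \<beta>1 x)
    + (\<Sum>k\<in>UNIV. integral {0..1} (\<lambda>s. side_derivative V k s * coangle (g (ref_path k s)) (axis 2 1) (side_dir k)))
    + (\<Sum>k\<in>UNIV. V (ref_vertex k) * corner_defect (g (ref_vertex k)) k)"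
proof -
  let ?\<theta> = "\<lambda>k s. - coangle (g (ref_path k s)) (axis 2 1) (side_dir k)"
  let ?b = "\<lambda>k s. \<beta>1 (ref_path k s) * side_dir k $ 1 + \<beta>2 (ref_path k s) * side_dir k $ 2"
  let ?\<kappa> = "\<lambda>k s. side_curvature g k s * side_speed g k s"
  let ?V = "\<lambda>k s. V (ref_path k s)"
  note V' = C1_differentiable[OF V] and \<beta>' = C1_differentiable[OF C1_conn(1)] C1_differentiable[OF C1_conn(2)]
  have cV: "continuous_on ref_tri V" "continuous_on ref_tri (P i V)" for i
    using C1_continuous[OF V] C1_continuous_pd[OF V] by auto
  have c\<beta>: "continuous_on ref_tri \<beta>1" "continuous_on ref_tri \<beta>2" "continuous_on ref_tri (P i \<beta>1)"
      "continuous_on ref_tri (P i \<beta>2)" for i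
    using C1_continuous[OF C1_conn(1)] C1_continuous[OF C1_conn(2)] C1_continuous_pd[OF C1_conn(1)]
        C1_continuous_pd[OF C1_conn(2)]
    by auto
  have "integral ref_tri (\<lambda>x. P 1 (\<lambda>x. V x * \<beta>2 x) x - P 2 (\<lambda>x. V x * \<beta>1 x) x)
      = (\<Sum>k\<in>UNIV. integral {0..1} (\<lambda>s. (V (ref_path k s) * \<beta>1 (ref_path k s)) * side_dir k $ 1
          + (V (ref_path k s) * \<beta>2 (ref_path k s)) * side_dir k $ 2))"
    by (rule green_ref_tri[OF C1_mult[OF V C1_conn(1)] C1_mult[OF V C1_conn(2)]])
  also have "\<dots> = (\<Sum>k\<in>UNIV. integral {0..1} (\<lambda>s. ?V k s * ?b k s))"
    by (simp add: algebra_simps)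
  also have "integral ref_tri (\<lambda>x. P 1 (\<lambda>x. V x * \<beta>2 x) x - P 2 (\<lambda>x. V x * \<beta>1 x) x)
      = integral ref_tri (\<lambda>x. V x * gauss_curvature ref_tri g x * area_density g x
          + (P 1 V x * \<beta>2 x - P 2 V x * \<beta>1 x))"
  proof (rule integral_cong)
    fix x assume x: "x \<in> ref_tri"
    show "P 1 (\<lambda>x. V x * \<beta>2 x) x - P 2 (\<lambda>x. V x * \<beta>1 x) x
        = V x * gauss_curvature ref_tri g x * area_density g x + (P 1 V x * \<beta>2 x - P 2 V x * \<beta>1 x)"
      unfolding pd_mult[OF x V'[OF x] \<beta>'(1)[OF x]] pd_mult[OF x V'[OF x] \<beta>'(2)[OF x]] mult.assoc
        gauss_curvature_exact[OF x]
      by (simp add: algebra_simps)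
  qed
  also have "\<dots> = integral ref_tri (\<lambda>x. V x * gauss_curvature ref_tri g x * area_density g x)
      + integral ref_tri (\<lambda>x. P 1 V x * \<beta>2 x - P 2 V x * \<beta>1 x)"
  proof (rule Henstock_Kurzweil_Integration.integral_add)
    have "continuous_on ref_tri (\<lambda>x. V x * (P 1 \<beta>2 x - P 2 \<beta>1 x))"
      by (intro continuous_intros cV c\<beta>)
    then have "continuous_on ref_tri (\<lambda>x. V x * gauss_curvature ref_tri g x * area_density g x)"
      by (rule continuous_on_eq) (simp add: mult.assoc gauss_curvature_exact)
    then show "(\<lambda>x. V x * gauss_curvature ref_tri g x * area_density g x) integrable_on ref_tri"
      by (rule continuous_integrable_compact(1)[OF compact_ref_tri])
    show "(\<lambda>x. P 1 V x * \<beta>2 x - P 2 V x * \<beta>1 x) integrable_on ref_tri"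
      by (intro continuous_integrable_compact(1)[OF compact_ref_tri] continuous_intros cV c\<beta>)
  qed
  finally have area: "tri_integral g (\<lambda>x. V x * gauss_curvature ref_tri g x)
      = (\<Sum>k\<in>UNIV. integral {0..1} (\<lambda>s. ?V k s * ?b k s)) - integral ref_tri (\<lambda>x. P 1 V x * \<beta>2 x - P 2 V x * \<beta>1 x)"
    by (simp add: tri_integral_def)
  have side: "integral {0..1} (\<lambda>s. ?V k s * ?\<kappa> k s) + integral {0..1} (\<lambda>s. ?V k s * ?b k s)
      = (?V k 1 * ?\<theta> k 1 - ?V k 0 * ?\<theta> k 0) + integral {0..1} (\<lambda>s. side_derivative V k s * coangle (g
          (ref_path k s)) (axis 2 1) (side_dir k))" for k
  proof -
    have d\<theta>: "(?\<theta> k has_real_derivative ?\<kappa> k s + ?b k s) (at s within {0..1})" if "s \<in> {0..1}" for s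
      by (rule has_derivative_coangle_side[OF that])
    have c\<theta>: "continuous_on {0..1} (?\<theta> k)"
      using DERIV_continuous_on[OF d\<theta>] .
    have cs: "continuous_on {0..1} (?V k)" "continuous_on {0..1} (?\<kappa> k)" "continuous_on {0..1} (?b k)"
        "continuous_on {0..1} (side_derivative V k)"
      unfolding side_derivative_def
      by (intro continuous_intros continuous_on_side cV c\<beta> continuous_side_curvature)+
    have "integral {0..1} (\<lambda>s. side_derivative V k s * ?\<theta> k s + (?\<kappa> k s + ?b k s) * ?V k s)
        = ?V k 1 * ?\<theta> k 1 - ?V k 0 * ?\<theta> k 0"
    proof (rule integral_continuous_derivative)
      fix s :: real assume s: "s \<in> {0..1}"
      show "((\<lambda>s. ?V k s * ?\<theta> k s) has_real_derivative side_derivative V k s * ?\<theta> k s + (?\<kappa> k s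
          + ?b k s) * ?V k s) (at s within {0..1})"
        unfolding side_derivative_def by (rule DERIV_mult[OF has_derivative_side[OF V s] d\<theta>[OF s]])
    qed simp
    also have "(\<lambda>s. side_derivative V k s * ?\<theta> k s + (?\<kappa> k s + ?b k s) * ?V k s)
        = (\<lambda>s. (?V k s * ?\<kappa> k s + ?V k s * ?b k s) - side_derivative V k s * coangle (g (ref_path k s)) (axis
            2 1) (side_dir k))"
      by (simp add: algebra_simps)
    also have "integral {0..1} \<dots> = (integral {0..1} (\<lambda>s. ?V k s * ?\<kappa> k s) + integral {0..1} (\<lambda>s. ?V k s * ?b k s))
        - integral {0..1} (\<lambda>s. side_derivative V k s * coangle (g (ref_path k s)) (axis 2 1) (side_dir k))"
    proof -
      have i: "(\<lambda>s. ?V k s * ?\<kappa> k s) integrable_on {0..1}" "(\<lambda>s. ?V k s * ?b k s) integrable_on {0..1}"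
        by (intro integrable_continuous_real continuous_intros cs)+
      have "continuous_on {0..1} (\<lambda>s. coangle (g (ref_path k s)) (axis 2 1) (side_dir k))"
        using continuous_on_minus[OF c\<theta>] by simp
      then have j: "(\<lambda>s. side_derivative V k s * coangle (g (ref_path k s)) (axis 2 1) (side_dir k))
          integrable_on {0..1}"
        by (intro integrable_continuous_real continuous_intros cs)
      show ?thesis
        unfolding Henstock_Kurzweil_Integration.integral_diff[OF integrable_add[OF i] j]
          Henstock_Kurzweil_Integration.integral_add[OF i] ..
    qed
    finally show ?thesis by linarith
  qed
  have path: "ref_path k 1 = ref_vertex (k + 2)" "ref_path k 0 = ref_vertex (k + 1)" for k
    by (simp_all add: ref_path_def linepath_def)
  \<comment> \<open>Sides are regrouped by vertices: side \<open>k\<close> runs from vertex \<open>k + 1\<close> to vertex \<open>k + 2\<close>.\<close>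
  have shift: "(\<Sum>k\<in>UNIV. V (ref_vertex (k + 2)) * - coangle (g (ref_vertex (k + 2))) (axis 2 1) (side_dir k))
        = (\<Sum>m\<in>UNIV. V (ref_vertex m) * - coangle (g (ref_vertex m)) (axis 2 1) (side_dir (m + 1)))"
      "(\<Sum>k\<in>UNIV. V (ref_vertex (k + 1)) * - coangle (g (ref_vertex (k + 1))) (axis 2 1) (side_dir k))
        = (\<Sum>m\<in>UNIV. V (ref_vertex m) * - coangle (g (ref_vertex m)) (axis 2 1) (side_dir (m + 2)))"
    using sum_3_shift[of "\<lambda>m. V (ref_vertex m) * - coangle (g (ref_vertex m)) (axis 2 1) (side_dir (m + 1))" 2]
      sum_3_shift[of "\<lambda>m. V (ref_vertex m) * - coangle (g (ref_vertex m)) (axis 2 1) (side_dir (m + 2))" 1]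
    by (simp_all only: three_arith)
  have ends: "(\<Sum>k\<in>UNIV. ?V k 1 * ?\<theta> k 1 - ?V k 0 * ?\<theta> k 0)
      = (\<Sum>m\<in>UNIV. V (ref_vertex m) * (- coangle (g (ref_vertex m)) (axis 2 1) (side_dir (m + 1))
          + coangle (g (ref_vertex m)) (axis 2 1) (side_dir (m + 2))))"
    unfolding path sum_subtractf shift unfolding sum_subtractf[symmetric] by (simp add: algebra_simps)
  have "(\<Sum>k\<in>UNIV. integral {0..1} (\<lambda>s. ?V k s * ?\<kappa> k s)) + (\<Sum>k\<in>UNIV. integral {0..1} (\<lambda>s. ?V k s * ?b k s))
      = (\<Sum>k\<in>UNIV. ?V k 1 * ?\<theta> k 1 - ?V k 0 * ?\<theta> k 0)
      + (\<Sum>k\<in>UNIV. integral {0..1} (\<lambda>s. side_derivative V k s * coangle (g (ref_path k s)) (axis 2 1) (side_dir k)))"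
    unfolding sum.distrib[symmetric] side ..
  moreover have "(\<Sum>m\<in>UNIV. V (ref_vertex m) * corner_defect (g (ref_vertex m)) m)
      = (\<Sum>k\<in>UNIV. ?V k 1 * ?\<theta> k 1 - ?V k 0 * ?\<theta> k 0) - (\<Sum>k\<in>UNIV. V (ref_vertex k) * vertex_angle g k)"
    unfolding ends sum_subtractf[symmetric]
    by (rule sum.cong)
      (simp_all add: corner_defect_def vertex_angle_coangle[of g, OF pos[OF ref_vertex_in_ref_tri]] algebra_simps)
  ultimately show ?thesis
    unfolding triangle_functional_def area by linarith
qed

end

section \<open>The variation of the connection form\<close>

definition det_rate :: "real^2^2 \<Rightarrow> real^2^2 \<Rightarrow> real" where
  "det_rate A S = S $ 1 $ 1 * A $ 2 $ 2 + A $ 1 $ 1 * S $ 2 $ 2 - 2 * A $ 1 $ 2 * S $ 1 $ 2"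

definition conn1_rate :: "real^2^2 \<Rightarrow> real^2^2 \<Rightarrow> real^2^2 \<Rightarrow> real^2^2 \<Rightarrow> real^2^2 \<Rightarrow> real^2^2 \<Rightarrow> real" where
  "conn1_rate A B1 B2 S S1 S2 =
     (S2 $ 1 $ 1 - (S $ 1 $ 2 * B1 $ 2 $ 2 + A $ 1 $ 2 * S1 $ 2 $ 2) / A $ 2 $ 2
        + A $ 1 $ 2 * B1 $ 2 $ 2 * S $ 2 $ 2 / (A $ 2 $ 2 * A $ 2 $ 2)) / (2 * sqrt (det A))
     - conn1 A B1 B2 * det_rate A S / (2 * det A)"

definition conn2_rate :: "real^2^2 \<Rightarrow> real^2^2 \<Rightarrow> real^2^2 \<Rightarrow> real^2^2 \<Rightarrow> real^2^2 \<Rightarrow> real^2^2 \<Rightarrow> real" where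
  "conn2_rate A B1 B2 S S1 S2 =
     (2 * S2 $ 1 $ 2 - S1 $ 2 $ 2 - (S $ 1 $ 2 * B2 $ 2 $ 2 + A $ 1 $ 2 * S2 $ 2 $ 2) / A $ 2 $ 2
        + A $ 1 $ 2 * B2 $ 2 $ 2 * S $ 2 $ 2 / (A $ 2 $ 2 * A $ 2 $ 2)) / (2 * sqrt (det A))
     - conn2 A B1 B2 * det_rate A S / (2 * det A)"

lemma has_derivative_over_sqrt_det:
  fixes A :: "real \<Rightarrow> real^2^2"
  assumes pd: "pos_def (A t)"
    and A': "\<And>i j. ((\<lambda>s. A s $ i $ j) has_real_derivative S $ i $ j) (at t within I)" and S: "S $ 2 $ 1 = S $ 1 $ 2"
    and N: "(N has_real_derivative N') (at t within I)"
  shows "((\<lambda>s. N s / (2 * sqrt (det (A s)))) has_real_derivative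
    N' / (2 * sqrt (det (A t))) - N t / (2 * sqrt (det (A t))) * det_rate (A t) S / (2 * det (A t)))
        (at t within I)"
proof -
  note e = pos_def_entries(1)[OF pd] det_pos_def[OF pd]
  define r where "r = sqrt (det (A t))"
  have r: "r > 0" "r * r = det (A t)" using e by (simp_all add: r_def)
  have dD: "((\<lambda>s. det (A s)) has_real_derivative det_rate (A t) S) (at t within I)"
    unfolding det_2 det_rate_def by (rule derivative_eq_intros A' refl)+ (simp add: S e(1) algebra_simps)
  have dr: "((\<lambda>s. sqrt (det (A s))) has_real_derivative det_rate (A t) S / (2 * r)) (at t within I)"
    using DERIV_chain2[OF DERIV_real_sqrt[OF e(3)] dD] by (simp add: r_def field_simps)
  have "((\<lambda>s. N s / (2 * sqrt (det (A s)))) has_real_derivative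
      (N' * (2 * r) - N t * (2 * (det_rate (A t) S / (2 * r)))) / ((2 * r) * (2 * r))) (at t within I)"
    using DERIV_divide[OF N DERIV_cmult[OF dr, of 2]] r by (simp add: r_def)
  also have "(N' * (2 * r) - N t * (2 * (det_rate (A t) S / (2 * r)))) / ((2 * r) * (2 * r))
      = N' / (2 * r) - N t / (2 * r) * det_rate (A t) S / (2 * (r * r))"
    using r(1) by (simp add: field_simps)
  finally show ?thesis unfolding r(2) unfolding r_def .
qed

lemma has_derivative_conn:
  fixes A X Y :: "real \<Rightarrow> real^2^2"
  assumes pd: "pos_def (A t)"
    and A': "\<And>i j. ((\<lambda>s. A s $ i $ j) has_real_derivative S $ i $ j) (at t within I)" and S: "S $ 2 $ 1 = S $ 1 $ 2"
    and X': "\<And>i j. ((\<lambda>s. X s $ i $ j) has_real_derivative S1 $ i $ j) (at t within I)"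
    and Y': "\<And>i j. ((\<lambda>s. Y s $ i $ j) has_real_derivative S2 $ i $ j) (at t within I)"
  shows "((\<lambda>s. conn1 (A s) (X s) (Y s)) has_real_derivative conn1_rate (A t) (X t) (Y t) S S1 S2) (at t within I)"
    and "((\<lambda>s. conn2 (A s) (X s) (Y s)) has_real_derivative conn2_rate (A t) (X t) (Y t) S S1 S2) (at t within I)"
proof -
  have G: "A t $ 2 $ 2 \<noteq> 0" using pos_def_entries[OF pd] by simp
  have q: "(x * G - y * z) / (G * G) = x / G - y * z / (G * G)" if "G \<noteq> 0" for x y z G :: real
    using that by (simp add: field_simps)
  have frac: "((\<lambda>s. A s $ 1 $ 2 * B s $ 2 $ 2 / A s $ 2 $ 2) has_real_derivative
      (S $ 1 $ 2 * B t $ 2 $ 2 + A t $ 1 $ 2 * R $ 2 $ 2) / A t $ 2 $ 2 - A t $ 1 $ 2 * B t $ 2 $ 2 * S $ 2 $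
          2 / (A t $ 2 $ 2 * A t $ 2 $ 2)) (at t within I)"
    if B': "\<And>i j. ((\<lambda>s. B s $ i $ j) has_real_derivative R $ i $ j) (at t within I)" for B R
    using DERIV_divide[OF DERIV_mult[OF A'[of 1 2] B'[of 2 2]] A'[of 2 2] G] G
    unfolding q[OF G] by (simp add: add.commute mult.commute)
  have "((\<lambda>s. Y s $ 1 $ 1 - A s $ 1 $ 2 * X s $ 2 $ 2 / A s $ 2 $ 2) has_real_derivative
      S2 $ 1 $ 1 - (S $ 1 $ 2 * X t $ 2 $ 2 + A t $ 1 $ 2 * S1 $ 2 $ 2) / A t $ 2 $ 2
        + A t $ 1 $ 2 * X t $ 2 $ 2 * S $ 2 $ 2 / (A t $ 2 $ 2 * A t $ 2 $ 2)) (at t within I)"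
    using DERIV_diff[OF Y'[of 1 1] frac[OF X']] by (simp add: algebra_simps)
  from has_derivative_over_sqrt_det[where A = A, OF pd A' S this]
  show "((\<lambda>s. conn1 (A s) (X s) (Y s)) has_real_derivative conn1_rate (A t) (X t) (Y t) S S1 S2) (at t within I)"
    unfolding conn1_rate_def conn1_def .
  have "((\<lambda>s. 2 * Y s $ 1 $ 2 - X s $ 2 $ 2 - A s $ 1 $ 2 * Y s $ 2 $ 2 / A s $ 2 $ 2) has_real_derivative
      2 * S2 $ 1 $ 2 - S1 $ 2 $ 2 - (S $ 1 $ 2 * Y t $ 2 $ 2 + A t $ 1 $ 2 * S2 $ 2 $ 2) / A t $ 2 $ 2
        + A t $ 1 $ 2 * Y t $ 2 $ 2 * S $ 2 $ 2 / (A t $ 2 $ 2 * A t $ 2 $ 2)) (at t within I)"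
    using DERIV_diff[OF DERIV_diff[OF DERIV_cmult[OF Y'[of 1 2], of 2] X'[of 2 2]] frac[OF Y']]
        by (simp add: algebra_simps)
  from has_derivative_over_sqrt_det[where A = A, OF pd A' S this]
  show "((\<lambda>s. conn2 (A s) (X s) (Y s)) has_real_derivative conn2_rate (A t) (X t) (Y t) S S1 S2) (at t within I)"
    unfolding conn2_rate_def conn2_def .
qed

lemma C1_component_matrix:
  fixes S :: "real^2 \<Rightarrow> real^2^2"
  assumes "x \<in> ref_tri" "\<And>i j. C1 (\<lambda>x. S x $ i $ j)"
  shows "pd ref_tri k S x $ i $ j = pd ref_tri k (\<lambda>x. S x $ i $ j) x"
  by (rule pd_bounded_linear[of "\<lambda>A. A $ i $ j", symmetric])
    (intro assms(1) differentiable_matrix C1_differentiable[OF assms(2,1)]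
      bounded_linear_compose[OF bounded_linear_vec_nth bounded_linear_vec_nth])+

context triangle_metric
begin

lemma pd_over_r:
  assumes x: "x \<in> ref_tri" and X: "C1 X"
  shows "2 * r x * P 1 (\<lambda>x. X x / (2 * r x)) x = P 1 X x - X x * (\<Gamma> 1 1 x $ 1 + \<Gamma> 1 2 x $ 2)"
    "2 * r x * P 2 (\<lambda>x. X x / (2 * r x)) x = P 2 X x - X x * (\<Gamma> 1 2 x $ 1 + \<Gamma> 2 2 x $ 2)"
proof -
  have d: "(\<lambda>x. 2 * r x) differentiable (at x within ref_tri)"
    by (intro C1_differentiable[OF _ x] C1_mult C1_const C1_r)
  have r: "2 * r x > 0" using pos_entries(6)[OF x] by simp
  have p: "P i (\<lambda>x. 2 * r x) x = 2 * P i r x" for i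
    using pd_mult[OF x differentiable_const C1_differentiable[OF C1_r x], where i = i] x by simp
  have aux: "b * (y / b - X x * (b * z) / (b * b)) = y - X x * z" if "b > 0" for b y z
    using that by (simp add: field_simps)
  have *: "2 * (r x * z) = (2 * r x) * z" for z by simp
  show "2 * r x * P 1 (\<lambda>x. X x / (2 * r x)) x = P 1 X x - X x * (\<Gamma> 1 1 x $ 1 + \<Gamma> 1 2 x $ 2)"
    "2 * r x * P 2 (\<lambda>x. X x / (2 * r x)) x = P 2 X x - X x * (\<Gamma> 1 2 x $ 1 + \<Gamma> 2 2 x $ 2)"
    unfolding pd_divide[OF x C1_differentiable[OF X x] d less_imp_neq[OF r, symmetric]] p pd_r[OF x] *
    by (rule aux[OF r])+
qed

end

text \<open>The integrand \<open>(S \<sigma>)(n, n) dV(n) ds\<close> of the edge terms of \<open>b_h\<close>, seen from one side of the edge.\<close>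

definition edge_flux :: "(real^2 \<Rightarrow> real^2^2) \<Rightarrow> (real^2 \<Rightarrow> real^2^2) \<Rightarrow> (real^2 \<Rightarrow> real) \<Rightarrow> 3 \<Rightarrow> real \<Rightarrow> real" where
  "edge_flux g S V k s = (let x = ref_path k s; n = side_normal g k x in
     bil (S_op (g x) (S x)) n n * frechet_derivative V (at x within ref_tri) n * side_speed g k s)"

locale triangle_variation = triangle_metric g for g +
  fixes S :: "real^2 \<Rightarrow> real^2^2" and V :: "real^2 \<Rightarrow> real"
  assumes S: "C1 (\<lambda>x. S x $ i $ j)" and S_sym: "x \<in> ref_tri \<Longrightarrow> S x $ 2 $ 1 = S x $ 1 $ 2"
    and V: "C2 V"
begin

text \<open>This is \<open>rot\<close> of the direction \<open>\<partial>\<^sub>2\<close> to which the frame is adapted. Up to sign, its differential is the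
part of the variation of \<open>\<beta>\<close> that comes from the choice of the frame.\<close>

definition frame_rate :: "real^2 \<Rightarrow> real" where
  "frame_rate x = (F x * S x $ 2 $ 2 / G x - S x $ 1 $ 2) / (2 * r x)"

text \<open>The components of the form \<open>\<eta> = 1/2 \<sigma>(\<cdot>, J \<nabla>V) - rot \<partial>\<^sub>2 dV\<close>. In coordinates
\<open>J \<nabla>V = (- \<partial>\<^sub>2V, \<partial>\<^sub>1V) / sqrt (det g)\<close>. The form is forced by the requirement of \<open>boundary_identity\<close> on all
directions, whose terms combine to an expression linear in the direction.\<close>

definition \<eta>1 :: "real^2 \<Rightarrow> real" where
  "\<eta>1 x = (S x $ 1 $ 2 * P 1 V x - S x $ 1 $ 1 * P 2 V x) / (2 * r x) - frame_rate x * P 1 V x"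

definition \<eta>2 :: "real^2 \<Rightarrow> real" where
  "\<eta>2 x = (S x $ 2 $ 2 * P 1 V x - S x $ 1 $ 2 * P 2 V x) / (2 * r x) - frame_rate x * P 2 V x"

lemma C1_V: "C1 V" "C1 (P i V)"
  using V by (auto simp: C2_def)

lemma G_nonzero: "x \<in> ref_tri \<Longrightarrow> G x \<noteq> 0" and r_nonzero: "x \<in> ref_tri \<Longrightarrow> 2 * r x \<noteq> 0"
  using pos_entries(4,6) by (auto simp: less_imp_neq[symmetric])

lemma C1_parts:
  "C1 (\<lambda>x. F x * S x $ 2 $ 2 / G x - S x $ 1 $ 2)" "C1 frame_rate"
  "C1 (\<lambda>x. S x $ 2 $ 2 * P 1 V x - S x $ 1 $ 2 * P 2 V x)" "C1 (\<lambda>x. S x $ 1 $ 2 * P 1 V x - S x $ 1 $ 1 * P 2 V x)"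
proof -
  show 1: "C1 (\<lambda>x. F x * S x $ 2 $ 2 / G x - S x $ 1 $ 2)"
    by (intro C1_diff C1_divide C1_mult C1_entry S G_nonzero)
  show "C1 frame_rate" unfolding frame_rate_def[abs_def]
    by (intro C1_divide[OF 1] C1_mult C1_const C1_r r_nonzero)
  show "C1 (\<lambda>x. S x $ 2 $ 2 * P 1 V x - S x $ 1 $ 2 * P 2 V x)" "C1 (\<lambda>x. S x $ 1 $ 2 * P 1 V x - S x $ 1 $ 1 *
      P 2 V x)"
    by (intro C1_diff C1_mult S C1_V)+
qed

lemma C1_\<eta>: "C1 \<eta>1" "C1 \<eta>2"
  unfolding \<eta>1_def[abs_def] \<eta>2_def[abs_def]
  by (intro C1_diff C1_divide C1_parts C1_mult C1_const C1_r r_nonzero C1_V; assumption?)+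

lemma hessian_components:
  "hessian ref_tri g V x $ i $ j = P i (P j V) x - (\<Gamma> i j x $ 1 * P 1 V x + \<Gamma> i j x $ 2 * P 2 V x)"
  by (simp add: hessian_def sum_2)

text \<open>The variation of the connection form contains derivatives of \<open>\<sigma>\<close>. Up to the exact term \<open>d\<eta>\<close> they can be
moved to \<open>V\<close>, where they form the covariant Hessian.\<close>

lemma interior_identity:
  assumes x: "x \<in> ref_tri"
  shows "- (P 1 V x * conn2_rate (g x) (P 1 g x) (P 2 g x) (S x) (P 1 S x) (P 2 S x)
          - P 2 V x * conn1_rate (g x) (P 1 g x) (P 2 g x) (S x) (P 1 S x) (P 2 S x))
    = 1 / 2 * (inner_g (g x) (S_op (g x) (S x)) (hessian ref_tri g V x) * area_density g x) + (P 1 \<eta>2 x - P 2 \<eta>1 x)"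
proof -
  note e = pos_entries[OF x]
  note d = C1_differentiable[OF C1_entry x] C1_differentiable[OF S x] C1_differentiable[OF C1_V(2) x]
    C1_differentiable[OF C1_parts(2) x]
  have dq: "(\<lambda>x. F x * S x $ 2 $ 2 / G x) differentiable (at x within ref_tri)"
      "(\<lambda>x. F x * S x $ 2 $ 2) differentiable (at x within ref_tri)"
    by (intro C1_differentiable[OF _ x] C1_divide C1_mult C1_entry S G_nonzero; assumption)+
  have pS: "P k S x $ i $ j = P k (\<lambda>x. S x $ i $ j) x" for k i j
    by (rule C1_component_matrix[OF x S])
  have r2: "2 * r x * (N / (2 * r x) - c * R / (2 * det (g x))) = N - (2 * r x * c) * R / (2 * det (g x))" for N c R
    using e(6) by (simp add: field_simps)
  have b: "2 * r x * conn1 (g x) (P 1 g x) (P 2 g x) = 2 * det (g x) * \<Gamma> 1 2 x $ 1 / G x"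
      "2 * r x * conn2 (g x) (P 1 g x) (P 2 g x) = 2 * det (g x) * \<Gamma> 2 2 x $ 1 / G x"
  proof -
    have "2 * a * (a * (y / z)) = 2 * D * y / z" if "a * a = D" for a y z D :: real
      using that by (auto simp: mult_ac)
    from this[OF e(7)] show "2 * r x * conn1 (g x) (P 1 g x) (P 2 g x) = 2 * det (g x) * \<Gamma> 1 2 x $ 1 / G x"
      "2 * r x * conn2 (g x) (P 1 g x) (P 2 g x) = 2 * det (g x) * \<Gamma> 2 2 x $ 1 / G x"
      unfolding conn_christoffel[OF x] by blast+
  qed
  have aux: "2 * y * a / z * R / (2 * y) = a * R / z" if "y > 0" for y a z R :: real
    using that by simp
  have b1: "2 * r x * conn1_rate (g x) (P 1 g x) (P 2 g x) (S x) (P 1 S x) (P 2 S x)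
      = P 2 (\<lambda>x. S x $ 1 $ 1) x - (S x $ 1 $ 2 * P 1 G x + F x * P 1 (\<lambda>x. S x $ 2 $ 2) x) / G x
        + F x * P 1 G x * S x $ 2 $ 2 / (G x * G x) - \<Gamma> 1 2 x $ 1 * det_rate (g x) (S x) / G x"
    unfolding conn1_rate_def r2 b aux[OF e(3)] pS pd_entry[OF x] ..
  have b2: "2 * r x * conn2_rate (g x) (P 1 g x) (P 2 g x) (S x) (P 1 S x) (P 2 S x)
      = 2 * P 2 (\<lambda>x. S x $ 1 $ 2) x - P 1 (\<lambda>x. S x $ 2 $ 2) x - (S x $ 1 $ 2 * P 2 G x
          + F x * P 2 (\<lambda>x. S x $ 2 $ 2) x) / G x
        + F x * P 2 G x * S x $ 2 $ 2 / (G x * G x) - \<Gamma> 2 2 x $ 1 * det_rate (g x) (S x) / G x"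
    unfolding conn2_rate_def r2 b aux[OF e(3)] pS pd_entry[OF x] ..
  have c: "2 * r x * frame_rate x = F x * S x $ 2 $ 2 / G x - S x $ 1 $ 2"
    using e(6) by (simp add: frame_rate_def)
  have pnum: "P i (\<lambda>x. F x * S x $ 2 $ 2 / G x - S x $ 1 $ 2) x
      = (P i F x * S x $ 2 $ 2 + F x * P i (\<lambda>x. S x $ 2 $ 2) x) / G x - F x * S x $ 2 $ 2 * P i G x / (G x * G x)
        - P i (\<lambda>x. S x $ 1 $ 2) x" for i
    unfolding pd_diff[OF x dq(1) d(2)] pd_divide[OF x dq(2) d(1) G_nonzero[OF x]] pd_mult[OF x d(1) d(2)] ..
  have fr: "frame_rate = (\<lambda>x. (F x * S x $ 2 $ 2 / G x - S x $ 1 $ 2) / (2 * r x))"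
    by (simp add: frame_rate_def fun_eq_iff)
  have c1: "2 * r x * P 1 frame_rate x = (P 1 F x * S x $ 2 $ 2 + F x * P 1 (\<lambda>x. S x $ 2 $ 2) x) / G x
      - F x * S x $ 2 $ 2 * P 1 G x / (G x * G x) - P 1 (\<lambda>x. S x $ 1 $ 2) x
      - (\<Gamma> 1 1 x $ 1 + \<Gamma> 1 2 x $ 2) * (F x * S x $ 2 $ 2 / G x - S x $ 1 $ 2)"
    unfolding fr pd_over_r[OF x C1_parts(1)] pnum by (simp add: mult.commute)
  have c2: "2 * r x * P 2 frame_rate x = (P 2 F x * S x $ 2 $ 2 + F x * P 2 (\<lambda>x. S x $ 2 $ 2) x) / G x
      - F x * S x $ 2 $ 2 * P 2 G x / (G x * G x) - P 2 (\<lambda>x. S x $ 1 $ 2) x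
      - (\<Gamma> 1 2 x $ 1 + \<Gamma> 2 2 x $ 2) * (F x * S x $ 2 $ 2 / G x - S x $ 1 $ 2)"
    unfolding fr pd_over_r[OF x C1_parts(1)] pnum by (simp add: mult.commute)
  have dquot: "(\<lambda>x. (S x $ 2 $ 2 * P 1 V x - S x $ 1 $ 2 * P 2 V x) / (2 * r x)) differentiable
      (at x within ref_tri)"
      "(\<lambda>x. (S x $ 1 $ 2 * P 1 V x - S x $ 1 $ 1 * P 2 V x) / (2 * r x)) differentiable (at x within ref_tri)"
    by (intro C1_differentiable[OF _ x] C1_divide C1_parts C1_mult C1_const C1_r r_nonzero; assumption)+
  have dfV: "(\<lambda>x. frame_rate x * P i V x) differentiable (at x within ref_tri)" for i
    by (intro C1_differentiable[OF _ x] C1_parts C1_mult C1_V)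
  have dm: "(\<lambda>x. S x $ i $ j * P k V x) differentiable (at x within ref_tri)" for i j k
    by (intro C1_differentiable[OF _ x] C1_mult S C1_V)
  have e2: "2 * r x * P 1 \<eta>2 x = (- P 1 (\<lambda>x. S x $ 1 $ 2) x * P 2 V x - S x $ 1 $ 2 * P 1 (P 2 V) x
        + P 1 (\<lambda>x. S x $ 2 $ 2) x * P 1 V x + S x $ 2 $ 2 * P 1 (P 1 V) x)
      - (S x $ 2 $ 2 * P 1 V x - S x $ 1 $ 2 * P 2 V x) * (\<Gamma> 1 1 x $ 1 + \<Gamma> 1 2 x $ 2)
      - 2 * r x * (P 1 frame_rate x * P 2 V x + frame_rate x * P 1 (P 2 V) x)"
    unfolding \<eta>2_def[abs_def] pd_diff[OF x dquot(1) dfV] right_diff_distrib[of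
        "2 * r x"] pd_over_r[OF x C1_parts(3)]
      pd_diff[OF x dm dm] pd_mult[OF x d(2) d(3)] pd_mult[OF x d(4) d(3)]
    by simp
  have e1: "2 * r x * P 2 \<eta>1 x = (- P 2 (\<lambda>x. S x $ 1 $ 1) x * P 2 V x - S x $ 1 $ 1 * P 2 (P 2 V) x
        + P 2 (\<lambda>x. S x $ 1 $ 2) x * P 1 V x + S x $ 1 $ 2 * P 1 (P 2 V) x)
      - (S x $ 1 $ 2 * P 1 V x - S x $ 1 $ 1 * P 2 V x) * (\<Gamma> 1 2 x $ 1 + \<Gamma> 2 2 x $ 2)
      - 2 * r x * (P 2 frame_rate x * P 1 V x + frame_rate x * P 1 (P 2 V) x)"
    unfolding \<eta>1_def[abs_def] pd_diff[OF x dquot(2) dfV] right_diff_distrib[of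
        "2 * r x"] pd_over_r[OF x C1_parts(4)]
      pd_diff[OF x dm dm] pd_mult[OF x d(2) d(3)] pd_mult[OF x d(4) d(3)] C2_pd_commute[OF V x, of 1 2]
    by simp
  let ?H = "hessian ref_tri g V x"
  have H21: "?H $ 2 $ 1 = ?H $ 1 $ 2"
    unfolding hessian_components christoffel_sym[OF x] C2_pd_commute[OF V x, of 1 2] ..
  have "- (P 1 V x * conn2_rate (g x) (P 1 g x) (P 2 g x) (S x) (P 1 S x) (P 2 S x)
          - P 2 V x * conn1_rate (g x) (P 1 g x) (P 2 g x) (S x) (P 1 S x) (P 2 S x))
      + (S x $ 2 $ 2 * ?H $ 1 $ 1 - 2 * S x $ 1 $ 2 * ?H $ 1 $ 2 + S x $ 1 $ 1 * ?H $ 2 $ 2) / (2 * r x)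
      = P 1 \<eta>2 x - P 2 \<eta>1 x"
    by (rule variation_algebra[OF e(2,4,7,6) metric_compatible[OF x] _ b1 b2 c c1 c2 e2 e1])
      (simp_all add: hessian_components det_rate_def)
  moreover have "1 / 2 * (inner_g (g x) (S_op (g x) (S x)) ?H * area_density g x)
      = - ((S x $ 2 $ 2 * ?H $ 1 $ 1 - 2 * S x $ 1 $ 2 * ?H $ 1 $ 2 + S x $ 1 $ 1 * ?H $ 2 $ 2) / (2 * r x))"
  proof -
    have aux: "1 / 2 * (- Y / y * a) = - (Y / (2 * a))" if "a * a = y" "a > 0" for Y a y :: real
      using that by (auto simp: field_simps)
    have two: "S x $ 1 $ 2 * (?H $ 1 $ 2 + ?H $ 1 $ 2) = 2 * S x $ 1 $ 2 * ?H $ 1 $ 2" by simp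
    show ?thesis
      unfolding inner_g_S_op[OF pos[OF x] S_sym[OF x]] H21 area_density_def two by (rule aux[OF e(7,6)])
  qed
  ultimately show ?thesis by linarith
qed

text \<open>The rotation rate of the frame cancels between \<open>\<eta>\<close> and the difference of rates. What remains is half of
\<open>\<sigma>(d, J \<nabla>V) - 2 rot d dV(d)\<close>; splitting \<open>\<nabla>V\<close> into its tangential and normal parts leaves the term with
\<open>\<sigma>(d, d) dV(n)\<close>.\<close>

lemma boundary_identity:
  fixes k :: 3 and s :: real
  assumes s: "s \<in> {0..1}"
  defines "x \<equiv> ref_path k s" and "d \<equiv> side_dir k"
  shows "\<eta>1 x * d $ 1 + \<eta>2 x * d $ 2 + side_derivative V k s * (rot (g x) (S x) (axis 2 1) - rot (g x) (S x) d)
    = - 1 / 2 * edge_flux g S V k s"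
proof -
  have x: "x \<in> ref_tri" unfolding x_def by (rule ref_path_in_ref_tri[OF s])
  have d0: "d \<noteq> 0" by (simp add: d_def side_dir_nonzero)
  note e = pos_entries[OF x]
  have n: "side_normal g k x = right_normal (g x) d"
    by (simp add: side_normal_def d_def side_dir_def)
  define n1 where "n1 = F x * d $ 1 + G x * d $ 2"
  define n2 where "n2 = E x * d $ 1 + F x * d $ 2"
  define q where "q = bil (g x) d d"
  have q: "q > 0" "q = n2 * d $ 1 + n1 * d $ 2"
    using bil_pos[OF pos[OF x] d0] by (simp_all add: q_def bil_2 n1_def n2_def e(1) algebra_simps)
  have sq: "sqrt q > 0" "sqrt q * sqrt q = q" using q(1) by simp_all
  have L: "frechet_derivative V (at x within ref_tri) w = w $ 1 * P 1 V x + w $ 2 * P 2 V x" for w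
  proof -
    have "frechet_derivative V (at x within ref_tri) = (\<lambda>w. w $ 1 *\<^sub>R P 1 V x + w $ 2 *\<^sub>R P 2 V x)"
      using has_derivative_unique_on_convex[OF convex_ref_tri interior_ref_tri x _ has_derivative_pd]
        C1_differentiable[OF C1_V(1) x] frechet_derivative_works by blast
    then show ?thesis by simp
  qed
  define X where "X = S x $ 1 $ 1 * d $ 1 + S x $ 1 $ 2 * d $ 2"
  define Y where "Y = S x $ 1 $ 2 * d $ 1 + S x $ 2 $ 2 * d $ 2"
  have Bd: "bil (S x) d d = X * d $ 1 + Y * d $ 2"
    by (simp add: bil_2 X_def Y_def S_sym[OF x] algebra_simps)
  have dVn: "frechet_derivative V (at x within ref_tri) (right_normal (g x) d)
      = (n1 * P 1 V x - n2 * P 2 V x) / (r x * sqrt q)"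
  proof -
    have "a / c * p + (- b) / c * w = (a * p - b * w) / c" for a b c p w :: real
      by (simp add: diff_divide_distrib)
    then show ?thesis unfolding L right_normal_components[OF pos[OF x] d0] n1_def n2_def q_def .
  qed
  have speed: "side_speed g k s = sqrt q"
    by (simp add: side_speed_def velocity_ref_path[OF s] len_def q_def d_def x_def)
  have "edge_flux g S V k s
      = - bil (S x) d d / q * ((n1 * P 1 V x - n2 * P 2 V x) / (r x * sqrt q)) * sqrt q"
    unfolding edge_flux_def Let_def x_def[symmetric] n S_op_normal_normal[OF pos[OF x] d0 S_sym[where x
        = x, OF x]] dVn speed q_def ..
  also have "\<dots> = - (X * d $ 1 + Y * d $ 2) * (n1 * P 1 V x - n2 * P 2 V x) / (q * r x)"
    unfolding Bd using sq q(1) e(6) by simp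
  finally have rhs: "edge_flux g S V k s
      = - (X * d $ 1 + Y * d $ 2) * (n1 * P 1 V x - n2 * P 2 V x) / (q * r x)" .
  have rot2: "rot (g x) (S x) (axis 2 1) = frame_rate x"
    using e(4,6) by (simp add: rot_def axis_def bil_2 frame_rate_def field_simps)
  have rotd: "rot (g x) (S x) d = (Y * n2 - X * n1) / (2 * r x * q)"
    by (simp add: rot_def X_def Y_def n1_def n2_def q_def)
  have dV: "side_derivative V k s = d $ 1 * P 1 V x + d $ 2 * P 2 V x"
    by (simp add: side_derivative_def d_def x_def)
  have \<eta>d: "\<eta>1 x * d $ 1 + \<eta>2 x * d $ 2 = (Y * P 1 V x - X * P 2 V x) / (2 * r x) - frame_rate x * (d $ 1 * P
      1 V x + d $ 2 * P 2 V x)"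
    by (simp add: \<eta>1_def \<eta>2_def X_def Y_def add_divide_distrib diff_divide_distrib algebra_simps)
  have "\<eta>1 x * d $ 1 + \<eta>2 x * d $ 2 + side_derivative V k s * (rot (g x) (S x) (axis 2 1) - rot (g x) (S x) d)
      = (Y * P 1 V x - X * P 2 V x) / (2 * r x) - (d $ 1 * P 1 V x
          + d $ 2 * P 2 V x) * ((Y * n2 - X * n1) / (2 * r x * q))"
    unfolding \<eta>d dV rot2 rotd by (simp add: algebra_simps)
  also have "\<dots> = (q * (Y * P 1 V x - X * P 2 V x) - (d $ 1 * P 1 V x
      + d $ 2 * P 2 V x) * (Y * n2 - X * n1)) / (2 * (q * r x))"
  proof -
    have "A / (2 * R) - B * (C / (2 * R * Q)) = (Q * A - B * C) / (2 * (Q * R))" if "R > 0" "Q > 0"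
        for A B C R Q :: real
      using that by (simp add: field_simps)
    from this[OF e(6) q(1)] show ?thesis .
  qed
  also have "q * (Y * P 1 V x - X * P 2 V x) - (d $ 1 * P 1 V x + d $ 2 * P 2 V x) * (Y * n2 - X * n1)
      = (X * d $ 1 + Y * d $ 2) * (n1 * P 1 V x - n2 * P 2 V x)"
    unfolding q(2) by algebra
  also have "\<dots> / (2 * (q * r x)) = - 1 / 2 * (- (X * d $ 1 + Y * d $ 2) * (n1 * P 1 V x - n2 * P 2 V x) / (q *
      r x))"
  proof -
    have "Z * W / (2 * U) = - 1 / 2 * (- Z * W / U)" for Z W U :: real by simp
    then show ?thesis .
  qed
  finally show ?thesis unfolding rhs .
qed

end

section \<open>The time derivative for one triangle\<close>

lemma continuous_on_det_entries:
  fixes A :: "'a::topological_space \<Rightarrow> real^2^2"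
  assumes "\<And>i j. continuous_on U (\<lambda>p. A p $ i $ j)"
  shows "continuous_on U (\<lambda>p. det (A p))"
  unfolding det_2 by (intro continuous_on_diff continuous_on_mult assms)

lemma continuous_on_conn_rate:
  fixes A B1 B2 S S1 S2 :: "'a::topological_space \<Rightarrow> real^2^2"
  assumes pd: "\<And>p. p \<in> U \<Longrightarrow> pos_def (A p)"
    and c: "\<And>i j. continuous_on U (\<lambda>p. A p $ i $ j)" "\<And>i j. continuous_on U (\<lambda>p. B1 p $ i $ j)"
      "\<And>i j. continuous_on U (\<lambda>p. B2 p $ i $ j)" "\<And>i j. continuous_on U (\<lambda>p. S p $ i $ j)"
      "\<And>i j. continuous_on U (\<lambda>p. S1 p $ i $ j)" "\<And>i j. continuous_on U (\<lambda>p. S2 p $ i $ j)"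
  shows "continuous_on U (\<lambda>p. conn1_rate (A p) (B1 p) (B2 p) (S p) (S1 p) (S2 p))"
    and "continuous_on U (\<lambda>p. conn2_rate (A p) (B1 p) (B2 p) (S p) (S1 p) (S2 p))"
proof -
  have nz: "A p $ 2 $ 2 \<noteq> 0" "A p $ 2 $ 2 * A p $ 2 $ 2 \<noteq> 0" "2 * sqrt (det (A p)) \<noteq> 0" "2 * det (A p) \<noteq> 0" if
      "p \<in> U" for p
    using pos_def_entries[OF pd[OF that]] det_pos_def[OF pd[OF that]] by auto
  show "continuous_on U (\<lambda>p. conn1_rate (A p) (B1 p) (B2 p) (S p) (S1 p) (S2 p))"
    "continuous_on U (\<lambda>p. conn2_rate (A p) (B1 p) (B2 p) (S p) (S1 p) (S2 p))"
    unfolding conn1_rate_def conn2_rate_def conn1_def conn2_def det_rate_def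
    by (intro continuous_on_mult continuous_on_add continuous_on_diff continuous_on_divide continuous_on_real_sqrt
        continuous_on_const continuous_on_det_entries c ballI nz; assumption)+
qed

lemma continuous_on_rot:
  fixes A S :: "'a::topological_space \<Rightarrow> real^2^2"
  assumes pd: "\<And>p. p \<in> U \<Longrightarrow> pos_def (A p)" and d: "d \<noteq> 0"
    and c: "\<And>i j. continuous_on U (\<lambda>p. A p $ i $ j)" "\<And>i j. continuous_on U (\<lambda>p. S p $ i $ j)"
  shows "continuous_on U (\<lambda>p. rot (A p) (S p) d)"
proof -
  have nz: "2 * sqrt (det (A p)) * bil (A p) d d \<noteq> 0" if "p \<in> U" for p
    using det_pos_def[OF pd[OF that]] bil_pos[OF pd[OF that] d] by simp
  have b: "continuous_on U (\<lambda>p. bil (A p) d d)"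
    unfolding bil_2 by (intro continuous_on_mult continuous_on_add continuous_on_const c)
  show ?thesis
    unfolding rot_def
    by (intro continuous_on_mult continuous_on_add continuous_on_diff continuous_on_divide continuous_on_real_sqrt
        continuous_on_const continuous_on_det_entries c b ballI nz; assumption)
qed

locale metric_family =
  fixes H :: "real \<Rightarrow> real^2 \<Rightarrow> real^2^2" and V :: "real^2 \<Rightarrow> real"
  assumes entry: "Ck_on 2 ({0..1} \<times> ref_tri) (\<lambda>(t, x). H t x $ i $ j)"
    and pos_H: "t \<in> {0..1} \<Longrightarrow> x \<in> ref_tri \<Longrightarrow> pos_def (H t x)"
    and C2_V: "C2 V"
begin

text \<open>The velocity is taken entrywise, as the entries are what \<open>C2_family\<close> speaks about. It is the derivative of the
matrix by \<open>matrix_derivative\<close>.\<close>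

definition rate :: "real \<Rightarrow> real^2 \<Rightarrow> real^2^2" where
  "rate t x = (\<chi> i j. vector_derivative (\<lambda>r. H r x $ i $ j) (at t within {0..1}))"

abbreviation "beta1 t x \<equiv> conn1 (H t x) (pd ref_tri 1 (H t) x) (pd ref_tri 2 (H t) x)"
abbreviation "beta2 t x \<equiv> conn2 (H t x) (pd ref_tri 1 (H t) x) (pd ref_tri 2 (H t) x)"
abbreviation "beta1_rate t x \<equiv> conn1_rate (H t x) (pd ref_tri 1 (H t) x) (pd ref_tri 2 (H t) x) (rate t x) (pd
    ref_tri 1 (rate t) x) (pd ref_tri 2 (rate t) x)"
abbreviation "beta2_rate t x \<equiv> conn2_rate (H t x) (pd ref_tri 1 (H t) x) (pd ref_tri 2 (H t) x) (rate t x) (pd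
    ref_tri 1 (rate t) x) (pd ref_tri 2 (rate t) x)"

abbreviation "turning k t s \<equiv> side_derivative V k s *
  (rot (H t (ref_path k s)) (rate t (ref_path k s)) (axis 2 1) - rot (H t (ref_path k s)) (rate t (ref_path k
      s)) (side_dir k))"

lemma rate_entry: "rate t x $ i $ j = vector_derivative (\<lambda>r. H r x $ i $ j) (at t within {0..1})"
  by (simp add: rate_def)

lemma rate_sym:
  assumes t: "t \<in> {0..1}" and x: "x \<in> ref_tri"
  shows "rate t x $ 2 $ 1 = rate t x $ 1 $ 2"
proof -
  have "((\<lambda>r. H r x $ 1 $ 2) has_real_derivative rate t x $ 1 $ 2) (at t within {0..1})"
    unfolding rate_entry by (rule C2_family_deriv(1)[OF entry t x])
  then have "((\<lambda>r. H r x $ 2 $ 1) has_real_derivative rate t x $ 1 $ 2) (at t within {0..1})"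
    by (rule has_field_derivative_transform_within[OF _ zero_less_one t])
      (use pos_def_entries(1)[OF pos_H[OF _ x]] in auto)
  then show ?thesis
    unfolding rate_entry[of t x 2 1]
    by (intro vector_derivative_within_closed_interval zero_less_one t)
      (simp add: has_real_derivative_iff_has_vector_derivative)
qed

lemma metric_at: "t \<in> {0..1} \<Longrightarrow> triangle_metric (H t)"
  by unfold_locales (auto intro!: C2_family_C2[OF entry] pos_H)

lemma variation_at: "t \<in> {0..1} \<Longrightarrow> triangle_variation (H t) (rate t) V"
  unfolding triangle_variation_def triangle_variation_axioms_def rate_entry
  using metric_at C2_family_C2(2)[OF entry] rate_sym[unfolded rate_entry] C2_V by blast

lemma rate_C1: "t \<in> {0..1} \<Longrightarrow> C1 (\<lambda>x. rate t x $ i $ j)"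
  unfolding rate_entry by (rule C2_family_C2(2)[OF entry])

lemma entry_derivative:
  assumes "t \<in> {0..1}" "x \<in> ref_tri"
  shows "((\<lambda>r. H r x $ i $ j) has_real_derivative rate t x $ i $ j) (at t within {0..1})"
    "((\<lambda>r. pd ref_tri k (H r) x $ i $ j) has_real_derivative pd ref_tri k (rate t) x $ i $ j) (at t within {0..1})"
proof -
  show "((\<lambda>r. H r x $ i $ j) has_real_derivative rate t x $ i $ j) (at t within {0..1})"
    unfolding rate_entry by (rule C2_family_deriv(1)[OF entry assms])
  have "((\<lambda>r. pd ref_tri k (\<lambda>x. H r x $ i $ j) x) has_real_derivative pd ref_tri k (rate t) x $ i $ j)
      (at t within {0..1})"
    unfolding C1_component_matrix[OF assms(2) rate_C1[OF assms(1)]] unfolding rate_entry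
    by (rule C2_family_deriv(2)[OF entry assms])
  then show "((\<lambda>r. pd ref_tri k (H r) x $ i $ j) has_real_derivative pd ref_tri k (rate t) x $ i $ j)
      (at t within {0..1})"
    by (rule has_field_derivative_transform_within[OF _ zero_less_one assms(1)])
      (simp add: triangle_metric.pd_entry[OF metric_at assms(2)])
qed

lemma entry_continuous:
  "continuous_on ({0..1} \<times> ref_tri) (\<lambda>p. H (fst p) (snd p) $ i $ j)"
  "continuous_on ({0..1} \<times> ref_tri) (\<lambda>p. rate (fst p) (snd p) $ i $ j)"
  "continuous_on ({0..1} \<times> ref_tri) (\<lambda>p. pd ref_tri k (H (fst p)) (snd p) $ i $ j)"
  "continuous_on ({0..1} \<times> ref_tri) (\<lambda>p. pd ref_tri k (rate (fst p)) (snd p) $ i $ j)"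
proof -
  note c = C2_family_continuous[OF entry, unfolded case_prod_beta]
  show "continuous_on ({0..1} \<times> ref_tri) (\<lambda>p. H (fst p) (snd p) $ i $ j)"
    "continuous_on ({0..1} \<times> ref_tri) (\<lambda>p. rate (fst p) (snd p) $ i $ j)"
    unfolding rate_entry by (rule c)+
  show "continuous_on ({0..1} \<times> ref_tri) (\<lambda>p. pd ref_tri k (H (fst p)) (snd p) $ i $ j)"
    using c(3)[of k i j]
    by (rule continuous_on_eq) (auto simp: triangle_metric.pd_entry[OF metric_at])
  show "continuous_on ({0..1} \<times> ref_tri) (\<lambda>p. pd ref_tri k (rate (fst p)) (snd p) $ i $ j)"
    using c(4)[of k i j]
    by (rule continuous_on_eq) (auto simp: C1_component_matrix[OF _ rate_C1] rate_entry)
qed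

lemma area_derivative:
  assumes t: "t \<in> {0..1}"
  shows "((\<lambda>t. integral ref_tri (\<lambda>x. pd ref_tri 1 V x * beta2 t x
        - pd ref_tri 2 V x * beta1 t x)) has_real_derivative
      integral ref_tri (\<lambda>x.
        pd ref_tri 1 V x * beta2_rate t x
        - pd ref_tri 2 V x * beta1_rate t x))
    (at t within {0..1})"
proof (rule has_derivative_integral_compact[OF compact_ref_tri t])
  have V: "C1 (pd ref_tri i V)" for i using C2_V by (simp add: C2_def)
  show "((\<lambda>t. pd ref_tri 1 V x * beta2 t x
        - pd ref_tri 2 V x * beta1 t x) has_real_derivative
      pd ref_tri 1 V x * beta2_rate t x
      - pd ref_tri 2 V x * beta1_rate t x)
    (at t within {0..1})" if "t \<in> {0..1}" "x \<in> ref_tri" for t x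
    using has_derivative_conn[where A = "\<lambda>r. H r x" and X = "\<lambda>r. pd ref_tri 1 (H r) x" and Y =
        "\<lambda>r. pd ref_tri 2 (H r) x",
        OF pos_H[OF that] entry_derivative(1)[OF that] rate_sym[OF that] entry_derivative(2)[OF that]
            entry_derivative(2)[OF that]]
    by (intro DERIV_diff DERIV_cmult)
  have cV: "continuous_on ({0..1::real} \<times> ref_tri) (\<lambda>p. pd ref_tri i V (snd p))" for i
    by (rule continuous_on_compose2[OF C1_continuous[OF V]]) (auto intro!: continuous_intros)
  have p: "pos_def (H (fst p) (snd p))" if "p \<in> {0..1} \<times> ref_tri" for p using that pos_H by auto
  show "continuous_on ({0..1} \<times> ref_tri) (\<lambda>(t, x).
        pd ref_tri 1 V x * beta2_rate t x
        - pd ref_tri 2 V x * beta1_rate t x)"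
    unfolding case_prod_beta
    by (intro continuous_on_diff continuous_on_mult cV continuous_on_conn_rate p entry_continuous; assumption)
  show "continuous_on ref_tri (\<lambda>x. pd ref_tri 1 V x * beta2 t x
        - pd ref_tri 2 V x * beta1 t x)" if "t \<in> {0..1}" for t
    using triangle_metric.C1_conn[OF metric_at[OF that]]
    by (intro continuous_on_diff continuous_on_mult C1_continuous V)
qed

lemma side_angle_derivative:
  fixes k :: 3
  assumes t: "t \<in> {0..1}"
  defines "d \<equiv> side_dir k"
  shows "((\<lambda>t. integral {0..1} (\<lambda>s. side_derivative V k s * coangle (H t (ref_path k s)) (axis 2 1) d))
      has_real_derivative
      integral {0..1} (\<lambda>s. side_derivative V k s *
        (rot (H t (ref_path k s)) (rate t (ref_path k s)) (axis 2 1) - rot (H t (ref_path k s)) (rate t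
            (ref_path k s)) d)))
    (at t within {0..1})"
proof (rule has_derivative_integral_compact[OF compact_Icc t])
  have V: "C1 V" "C1 (pd ref_tri i V)" for i using C2_V by (simp_all add: C2_def)
  have d0: "d \<noteq> 0" "axis 2 1 \<noteq> (0 :: real^2)" by (simp_all add: d_def side_dir_nonzero axis_eq_0_iff)
  show "((\<lambda>t. side_derivative V k s * coangle (H t (ref_path k s)) (axis 2 1) d) has_real_derivative
      side_derivative V k s * (rot (H t (ref_path k s)) (rate t (ref_path k s)) (axis 2 1) - rot (H t
          (ref_path k s)) (rate t (ref_path k s)) d))
    (at t within {0..1})" if "t \<in> {0..1}" "s \<in> {0..1}" for t s
    by (rule DERIV_cmult, rule has_derivative_coangle)
      (intro that d0 pos_H ref_path_in_ref_tri entry_derivative rate_sym; assumption)+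
  have cs: "continuous_on {0..1} (side_derivative V k)"
    unfolding side_derivative_def
    by (intro continuous_on_add continuous_on_mult continuous_on_const continuous_on_side C1_continuous[OF V(2)])
  have path: "continuous_on ({0..1::real} \<times> {0..1}) (\<lambda>p. (fst p, ref_path k (snd p)))"
    unfolding ref_path_line by (intro continuous_intros)
  have cpath: "continuous_on ({0..1::real} \<times> {0..1}) (\<lambda>p. f (fst p) (ref_path k (snd p)))"
    if "continuous_on ({0..1} \<times> ref_tri) (\<lambda>p. f (fst p) (snd p))" for f :: "real \<Rightarrow> real^2 \<Rightarrow> real"
    using continuous_on_compose2[OF that path] ref_path_in_ref_tri by force
  have p: "pos_def (H (fst p) (ref_path k (snd p)))" if "p \<in> {0..1} \<times> {0..1}" for p
    using that by (auto intro!: pos_H ref_path_in_ref_tri)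
  have cs2: "continuous_on ({0..1::real} \<times> {0..1}) (\<lambda>p. side_derivative V k (snd p))"
    by (rule continuous_on_compose2[OF cs]) (auto intro!: continuous_intros)
  show "continuous_on ({0..1} \<times> {0..1}) (\<lambda>(t, s). side_derivative V k s *
      (rot (H t (ref_path k s)) (rate t (ref_path k s)) (axis 2 1) - rot (H t (ref_path k s)) (rate t
          (ref_path k s)) d))"
    unfolding case_prod_beta
    by (intro continuous_on_diff continuous_on_mult cs2 continuous_on_rot d0 p cpath entry_continuous; assumption)
  show "continuous_on {0..1} (\<lambda>s. side_derivative V k s * coangle (H t (ref_path k s)) (axis 2 1) d)" if
      "t \<in> {0..1}" for t
  proof -
    have "continuous_on {0..1} (\<lambda>s. - coangle (H t (ref_path k s)) (axis 2 1) d)"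
      unfolding d_def by (rule DERIV_continuous_on, rule triangle_metric.has_derivative_coangle_side[OF
          metric_at[OF that]])
    from continuous_on_minus[OF this] show ?thesis by (intro continuous_on_mult cs) simp
  qed
qed

text \<open>The frame direction \<open>\<partial>\<^sub>2\<close> cancels, and the rates of the two sides at the corner are those of the interior
angle between them, since a direction and its opposite turn at the same rate.\<close>

lemma corner_defect_derivative:
  assumes t: "t \<in> {0..1}"
  shows "((\<lambda>t. corner_defect (H t (ref_vertex m)) m) has_real_derivative 0) (at t within {0..1})"
proof -
  let ?v = "ref_vertex m"
  let ?R = "rot (H t ?v) (rate t ?v)"
  have D: "((\<lambda>t. coangle (H t ?v) u w) has_real_derivative ?R u - ?R w) (at t within {0..1})" if "u \<noteq> 0"
      "w \<noteq> 0" for u w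
    by (rule has_derivative_coangle) (intro that t pos_H ref_vertex_in_ref_tri entry_derivative rate_sym;
        assumption?)+
  have nz: "axis 2 1 \<noteq> (0 :: real^2)" "side_dir k \<noteq> 0" "- side_dir k \<noteq> 0" for k
    by (simp_all add: side_dir_nonzero axis_eq_0_iff)
  have "?R (- side_dir (m + 1)) = ?R (side_dir (m + 1))"
    using rot_scaleR[of "-1" "H t ?v" "rate t ?v" "side_dir (m + 1)"] by simp
  then have "- (?R (axis 2 1) - ?R (side_dir (m + 1))) + (?R (axis 2 1) - ?R (side_dir (m + 2)))
      + (?R (side_dir (m + 2)) - ?R (- side_dir (m + 1))) - 0 = 0" by simp
  moreover have "((\<lambda>t. corner_defect (H t ?v) m) has_real_derivative
      - (?R (axis 2 1) - ?R (side_dir (m + 1))) + (?R (axis 2 1) - ?R (side_dir (m + 2)))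
      + (?R (side_dir (m + 2)) - ?R (- side_dir (m + 1))) - 0) (at t within {0..1})"
    unfolding corner_defect_def by (intro DERIV_diff DERIV_add DERIV_minus D nz DERIV_const)
  ultimately show ?thesis by simp
qed

lemma continuous_boundary_parts:
  fixes k :: 3
  assumes t: "t \<in> {0..1}"
  shows "continuous_on {0..1} (\<lambda>s. triangle_variation.\<eta>1 (H t) (rate t) V (ref_path k s) * side_dir k $ 1
      + triangle_variation.\<eta>2 (H t) (rate t) V (ref_path k s) * side_dir k $ 2)"
    and "continuous_on {0..1} (\<lambda>s. turning k t s)"
    and "continuous_on {0..1} (edge_flux (H t) (rate t) V k)"
proof -
  interpret T: triangle_variation "H t" "rate t" V by (rule variation_at[OF t])
  have pos: "pos_def (H t x)" if "x \<in> ref_tri" for x by (rule pos_H[OF t that])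
  show ce: "continuous_on {0..1} (\<lambda>s. T.\<eta>1 (ref_path k s) * side_dir k $ 1 + T.\<eta>2 (ref_path k s) * side_dir k $ 2)"
    by (intro continuous_on_add continuous_on_mult continuous_on_const continuous_on_side C1_continuous T.C1_\<eta>)
  have cr: "continuous_on {0..1} (\<lambda>s. rot (H t (ref_path k s)) (rate t (ref_path k s)) w)" if "w \<noteq> 0" for w
    by (rule continuous_on_rot)
      (intro that pos ref_path_in_ref_tri continuous_on_side C1_continuous T.C1_entry rate_C1 t; assumption)+
  show crt: "continuous_on {0..1} (\<lambda>s. turning k t s)"
    unfolding side_derivative_def
    by (intro continuous_on_mult continuous_on_add continuous_on_diff continuous_on_const continuous_on_side
        C1_continuous T.C1_V cr)
      (simp_all add: side_dir_nonzero axis_eq_0_iff)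
  have "continuous_on {0..1} (\<lambda>s. - 2 * ((T.\<eta>1 (ref_path k s) * side_dir k $ 1
      + T.\<eta>2 (ref_path k s) * side_dir k $ 2)
      + turning k t s))"
    by (intro continuous_on_mult continuous_on_add continuous_on_const ce crt)
  then show "continuous_on {0..1} (edge_flux (H t) (rate t) V k)"
  proof (rule continuous_on_eq)
    fix s :: real assume s: "s \<in> {0..1}"
    have half: "- 2 * (- 1 / 2 * n) = n" for n :: real by simp
    show "- 2 * ((T.\<eta>1 (ref_path k s) * side_dir k $ 1 + T.\<eta>2 (ref_path k s) * side_dir k $ 2)
      + turning k t s)
      = edge_flux (H t) (rate t) V k s"
      unfolding T.boundary_identity[OF s] by (rule half)
  qed
qed

text \<open>The functional is differentiated in the form of \<open>triangle_functional_eq\<close>; the form \<open>\<eta>\<close> then enters the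
area term by \<open>interior_identity\<close> and leaves through the sides by Green's theorem and \<open>boundary_identity\<close>.\<close>

lemma triangle_functional_derivative:
  assumes t: "t \<in> {0..1}"
  shows "((\<lambda>t. triangle_functional (H t) V) has_real_derivative
    1 / 2 * (tri_integral (H t) (\<lambda>x. inner_g (H t x) (S_op (H t x) (rate t x)) (hessian ref_tri (H t) V x))
      - (\<Sum>k\<in>UNIV. integral {0..1} (edge_flux (H t) (rate t) V k))))
    (at t within {0..1})"
proof -
  interpret T: triangle_variation "H t" "rate t" V by (rule variation_at[OF t])
  let ?c = "\<lambda>x. pd ref_tri 1 V x * beta2_rate t x
        - pd ref_tri 2 V x * beta1_rate t x"
  let ?h = "\<lambda>x. inner_g (H t x) (S_op (H t x) (rate t x)) (hessian ref_tri (H t) V x) * area_density (H t) x"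
  let ?rt = "\<lambda>k s. turning k t s"
  let ?e = "\<lambda>k s. T.\<eta>1 (ref_path k s) * side_dir k $ 1 + T.\<eta>2 (ref_path k s) * side_dir k $ 2"
  let ?n = "edge_flux (H t) (rate t) V"
  have C1V: "C1 V" using C2_V by (simp add: C2_def)
  have pos: "pos_def (H t x)" if "x \<in> ref_tri" for x by (rule pos_H[OF t that])
  have D: "((\<lambda>t. - integral ref_tri (\<lambda>x. pd ref_tri 1 V x * beta2 t x
        - pd ref_tri 2 V x * beta1 t x)
      + (\<Sum>k\<in>UNIV. integral {0..1} (\<lambda>s. side_derivative V k s * coangle (H t (ref_path k s)) (axis 2 1)
          (side_dir k)))
      + (\<Sum>k\<in>UNIV. V (ref_vertex k) * corner_defect (H t (ref_vertex k)) k)) has_real_derivative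
      - integral ref_tri ?c + (\<Sum>k\<in>UNIV. integral {0..1} (?rt k)) + (\<Sum>k\<in>UNIV. V (ref_vertex k) * 0))
          (at t within {0..1})"
    by (intro DERIV_add DERIV_minus DERIV_sum area_derivative side_angle_derivative DERIV_cmult
        corner_defect_derivative t)
  have intdiv: "(\<lambda>x. pd ref_tri 1 T.\<eta>2 x - pd ref_tri 2 T.\<eta>1 x) integrable_on ref_tri"
    by (intro continuous_integrable_compact(1)[OF compact_ref_tri] continuous_on_diff C1_continuous_pd T.C1_\<eta>)
  have slices: "continuous_on ref_tri (\<lambda>x. H t x $ i $ j)" "continuous_on ref_tri (\<lambda>x. rate t x $ i $ j)"
      "continuous_on ref_tri (\<lambda>x. pd ref_tri k (H t) x $ i $ j)" "continuous_on ref_tri (\<lambda>x. pd ref_tri k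
          (rate t) x $ i $ j)" for i j k
    using continuous_on_slice[OF entry_continuous(1) t] continuous_on_slice[OF entry_continuous(2) t]
      continuous_on_slice[OF entry_continuous(3) t] continuous_on_slice[OF entry_continuous(4) t] by simp_all
  have cont_c: "continuous_on ref_tri ?c"
    by (intro continuous_on_diff continuous_on_mult C1_continuous[OF T.C1_V(2)] continuous_on_conn_rate pos
        slices; assumption)
  have "continuous_on ref_tri (\<lambda>x. 2 * (- ?c x - (pd ref_tri 1 T.\<eta>2 x - pd ref_tri 2 T.\<eta>1 x)))"
    by (intro continuous_on_mult continuous_on_diff continuous_on_minus continuous_on_const cont_c
        C1_continuous_pd T.C1_\<eta>)
  then have "continuous_on ref_tri ?h"
  proof (rule continuous_on_eq)
    fix x assume "x \<in> ref_tri"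
    have "2 * (a - b) = h" if "a = 1 / 2 * h + b" for a b h :: real using that by simp
    from this[OF T.interior_identity[OF \<open>x \<in> ref_tri\<close>]]
    show "2 * (- ?c x - (pd ref_tri 1 T.\<eta>2 x - pd ref_tri 2 T.\<eta>1 x)) = ?h x" .
  qed
  then have inth: "?h integrable_on ref_tri"
    by (rule continuous_integrable_compact(1)[OF compact_ref_tri])
  have "- integral ref_tri ?c = integral ref_tri (\<lambda>x. - ?c x)"
    by (rule Henstock_Kurzweil_Integration.integral_neg[symmetric])
  also have "\<dots> = integral ref_tri (\<lambda>x. 1 / 2 * ?h x + (pd ref_tri 1 T.\<eta>2 x - pd ref_tri 2 T.\<eta>1 x))"
    by (rule integral_cong) (rule T.interior_identity)
  also have "\<dots> = 1 / 2 * integral ref_tri ?h + integral ref_tri (\<lambda>x. pd ref_tri 1 T.\<eta>2 x - pd ref_tri 2 T.\<eta>1 x)"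
    unfolding Henstock_Kurzweil_Integration.integral_add[OF integrable_on_mult_right[OF inth] intdiv]
      Henstock_Kurzweil_Integration.integral_mult_right ..
  also have "\<dots> = 1 / 2 * integral ref_tri ?h + (\<Sum>k\<in>UNIV. integral {0..1} (?e k))"
    unfolding green_ref_tri[OF T.C1_\<eta>] ..
  finally have area: "- integral ref_tri ?c = 1 / 2 * integral ref_tri ?h + (\<Sum>k\<in>UNIV. integral {0..1} (?e k))" .
  have side: "integral {0..1} (?e k) + integral {0..1} (?rt k) = - 1 / 2 * integral {0..1} (?n k)" for k
  proof -
    note ce = continuous_boundary_parts(1)[OF t, of k] and crt = continuous_boundary_parts(2)[OF t, of k]
    have "integral {0..1} (?e k) + integral {0..1} (?rt k) = integral {0..1} (\<lambda>s. ?e k s + ?rt k s)"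
      by (rule Henstock_Kurzweil_Integration.integral_add[symmetric]) (intro integrable_continuous_real ce crt)+
    also have "\<dots> = integral {0..1} (\<lambda>s. - 1 / 2 * ?n k s)"
      by (rule integral_cong) (rule T.boundary_identity)
    also have "\<dots> = - 1 / 2 * integral {0..1} (?n k)" by (rule Henstock_Kurzweil_Integration.integral_mult_right)
    finally show ?thesis .
  qed
  have "- integral ref_tri ?c + (\<Sum>k\<in>UNIV. integral {0..1} (?rt k)) + (\<Sum>k\<in>UNIV. V (ref_vertex k) * 0)
      = 1 / 2 * integral ref_tri ?h + (\<Sum>k\<in>UNIV. integral {0..1} (?e k) + integral {0..1} (?rt k))"
    unfolding area by (simp add: sum.distrib)
  also have "\<dots> = 1 / 2 * (integral ref_tri ?h - (\<Sum>k\<in>UNIV. integral {0..1} (?n k)))"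
    unfolding side sum_distrib_left[symmetric] by (simp add: right_diff_distrib)
  finally have eq: "- integral ref_tri ?c + (\<Sum>k\<in>UNIV. integral {0..1} (?rt k)) + (\<Sum>k\<in>UNIV. V (ref_vertex k) * 0)
      = 1 / 2 * (integral ref_tri ?h - (\<Sum>k\<in>UNIV. integral {0..1} (?n k)))" .
  show ?thesis
    unfolding tri_integral_def
    by (rule has_field_derivative_transform_within[OF D[unfolded eq] zero_less_one t])
      (simp add: triangle_metric.triangle_functional_eq[OF metric_at C1V])
qed

end

section \<open>Boundary, edges and corners of a triangulation\<close>

lemma Ck_on_differentiable: "Ck_on (Suc k) S f \<Longrightarrow> x \<in> S \<Longrightarrow> f differentiable (at x within S)"
  unfolding Ck_on.simps using differentiableI by blast

lemma openin_quadrant_positive: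
  assumes S: "openin (top_of_set quadrant) S" and x: "x \<in> S" and pos: "\<And>i. x $ i \<noteq> 0"
  shows "x \<in> interior S"
proof -
  obtain U where U: "open U" "S = quadrant \<inter> U" using S by (auto simp: openin_open)
  let ?P = "{y :: real^2. 0 < y $ 1 \<and> 0 < y $ 2}"
  have "open ?P" by (intro open_Collect_conj open_Collect_less continuous_intros)
  moreover have "x \<in> ?P \<inter> U"
    using x pos U(2) by (auto simp: quadrant_def less_le)
  moreover have "?P \<inter> U \<subseteq> S" unfolding U(2) by (auto simp: quadrant_def forall_2)
  ultimately show ?thesis using U(1) by (meson interiorI open_Int)
qed

lemma chart_onD:
  assumes "chart_on M c"
  shows "openin (top_of_set M) (fst c)" "fst c \<subseteq> M" "snd c ` fst c \<subseteq> quadrant" "continuous_on (fst c) (snd c)"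
    "homeomorphism (fst c) (snd c ` fst c) (snd c) (chart_inv c)" "inj_on (snd c) (fst c)"
    "\<And>p. p \<in> fst c \<Longrightarrow> chart_inv c (snd c p) = p"
proof -
  show o: "openin (top_of_set M) (fst c)" and h: "homeomorphism (fst c) (snd c ` fst c) (snd c) (chart_inv c)"
    using assms by (auto simp: chart_on_def)
  show "fst c \<subseteq> M" using openin_imp_subset[OF o] .
  have "openin (top_of_set quadrant) (snd c ` fst c)" using assms by (simp add: chart_on_def)
  from openin_imp_subset[OF this] show "snd c ` fst c \<subseteq> quadrant" .
  show "continuous_on (fst c) (snd c)" using h by (simp add: homeomorphism_def)
  show inv: "\<And>p. p \<in> fst c \<Longrightarrow> chart_inv c (snd c p) = p" using h by (simp add: homeomorphism_def)
  show "inj_on (snd c) (fst c)" using inv by (metis inj_on_inverseI)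
qed

lemma openin_overlap:
  assumes c: "chart_on M c" and c': "chart_on M c'"
  shows "openin (top_of_set quadrant) (overlap c c')"
proof -
  have "openin (top_of_set M) (fst c \<inter> fst c')"
    using chart_onD(1)[OF c] chart_onD(1)[OF c'] by (rule openin_Int)
  then have "openin (top_of_set (fst c)) (fst c \<inter> fst c')"
    by (rule openin_subset_trans) (use chart_onD(2)[OF c] in auto)
  then have "openin (top_of_set (snd c ` fst c)) (snd c ` (fst c \<inter> fst c'))"
    using homeomorphism_imp_open_map[OF chart_onD(5)[OF c]] by blast
  then show ?thesis
    using c unfolding overlap_def chart_on_def by (metis openin_trans)
qed

text \<open>Being an interior point does not depend on the chart: where no coordinate vanishes in one chart, a
vanishing coordinate in another chart would be a local minimum of a component of the
transition map, and the Jacobian would have a zero row.\<close>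

lemma depth_zero_not_boundary:
  assumes surf: "oriented_corner_surface M \<A>" and c: "c \<in> \<A>" "p \<in> fst c" and nz: "\<And>i. snd c p $ i \<noteq> 0"
  shows "p \<notin> mboundary \<A>"
proof
  assume "p \<in> mboundary \<A>"
  then have "\<exists>c'\<in>\<A>. p \<in> fst c' \<and> (card {i. snd c' p $ i = 0} = 1 \<or> card {i. snd c' p $ i = 0} = 2)"
    unfolding mboundary_def depth_set_def by blast
  then obtain c' where c': "c' \<in> \<A>" "p \<in> fst c'" and "card {i. snd c' p $ i = 0} = 1 \<or> card {i. snd c' p $ i
      = 0} = 2"
    by blast
  then have "{i. snd c' p $ i = 0} \<noteq> {}" by (metis card.empty zero_neq_one zero_neq_numeral)
  then obtain i where i: "snd c' p $ i = 0" by blast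
  have ch: "chart_on M c" "chart_on M c'" and sm: "smooth_on (overlap c c') (transition c c')"
    and J: "\<And>x. x \<in> overlap c c' \<Longrightarrow> det (jac (overlap c c') (transition c c') x) > 0"
    using surf c(1) c'(1) by (auto simp: oriented_corner_surface_def)
  define x where "x = snd c p"
  let ?O = "overlap c c'" and ?\<tau> = "transition c c'"
  have x: "x \<in> ?O" using c c' by (auto simp: overlap_def x_def)
  have xi: "x \<in> interior ?O"
    by (rule openin_quadrant_positive[OF openin_overlap[OF ch] x]) (simp add: x_def nz)
  have at: "at x within ?O = at x" by (rule at_within_interior[OF xi])
  have "Ck_on (Suc 0) ?O ?\<tau>" using sm by (simp add: smooth_on_def)
  then have "?\<tau> differentiable (at x within ?O)" using x by (rule Ck_on_differentiable)
  then have L: "(?\<tau> has_derivative frechet_derivative ?\<tau> (at x within ?O)) (at x)"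
    unfolding frechet_derivative_works by (simp add: at)
  let ?L = "frechet_derivative ?\<tau> (at x within ?O)"
  have "((\<lambda>y. ?\<tau> y $ i) has_derivative (\<lambda>v. ?L v $ i)) (at x)"
    by (rule bounded_linear.has_derivative[OF bounded_linear_vec_nth L])
  moreover have "?\<tau> x $ i \<le> ?\<tau> y $ i" if "y \<in> interior ?O" for y
  proof -
    have "y \<in> ?O" using that interior_subset by blast
    then obtain q where q: "q \<in> fst c" "q \<in> fst c'" "y = snd c q" by (auto simp: overlap_def)
    have "?\<tau> y = snd c' q" using q chart_onD(7)[OF ch(1)] by (simp add: transition_def)
    then have "?\<tau> y \<in> quadrant" using chart_onD(3)[OF ch(2)] q by auto
    moreover have "?\<tau> x $ i = 0" using i c chart_onD(7)[OF ch(1)] by (simp add: transition_def x_def)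
    ultimately show ?thesis by (simp add: quadrant_def)
  qed
  ultimately have zero: "(\<lambda>v. ?L v $ i) = (\<lambda>v. 0)"
    using differential_zero_maxmin[OF xi open_interior] by blast
  have row: "jac ?O ?\<tau> x $ i $ j = 0" for j
    using fun_cong[OF zero, of "axis j 1"] by (simp add: jac_def matrix_def)
  have "det (jac ?O ?\<tau> x) = 0"
    unfolding det_2 using row[of 1] row[of 2] exhaust_2[of i] by auto
  then show False using J[OF x] by simp
qed

lemma mboundary_subset: "oriented_corner_surface M \<A> \<Longrightarrow> mboundary \<A> \<subseteq> M"
  by (auto simp: oriented_corner_surface_def mboundary_def depth_set_def)

lemma openin_manifold_interior:
  assumes surf: "oriented_corner_surface M \<A>"
  shows "openin (top_of_set M) (M - mboundary \<A>)"
proof (subst openin_subopen, intro ballI)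
  fix p assume p: "p \<in> M - mboundary \<A>"
  then obtain c where c: "c \<in> \<A>" "p \<in> fst c" using surf by (auto simp: oriented_corner_surface_def)
  then have ch: "chart_on M c" using surf by (auto simp: oriented_corner_surface_def)
  have nz: "snd c p $ i \<noteq> 0" for i
  proof
    assume "snd c p $ i = 0"
    then have ne: "{i. snd c p $ i = 0} \<noteq> {}" by auto
    have "card {i. snd c p $ i = 0} \<le> card (UNIV :: 2 set)" by (rule card_mono) auto
    then have "card {i. snd c p $ i = 0} \<le> 2" by simp
    moreover have "card {i. snd c p $ i = 0} \<noteq> 0" using ne by simp
    ultimately have "card {i. snd c p $ i = 0} = 1 \<or> card {i. snd c p $ i = 0} = 2" by linarith
    then show False using p c by (auto simp: mboundary_def depth_set_def)
  qed
  let ?N = "fst c \<inter> snd c -` {x. x $ 1 \<noteq> 0 \<and> x $ 2 \<noteq> 0}"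
  have "open {x :: real^2. x $ 1 \<noteq> 0 \<and> x $ 2 \<noteq> 0}"
    by (intro open_Collect_conj open_Collect_neq continuous_intros)
  then have "openin (top_of_set (fst c)) ?N"
    using continuous_openin_preimage_gen[OF chart_onD(4)[OF ch]] by blast
  then have "openin (top_of_set M) ?N" using chart_onD(1)[OF ch] by (rule openin_trans)
  moreover have "p \<in> ?N" using c nz by auto
  moreover have "?N \<subseteq> M - mboundary \<A>"
  proof
    fix q assume q: "q \<in> ?N"
    then have "q \<notin> mboundary \<A>"
      by (intro depth_zero_not_boundary[OF surf c(1)]) (auto, metis exhaust_2)
    then show "q \<in> M - mboundary \<A>" using q chart_onD(2)[OF ch] by auto
  qed
  ultimately show "\<exists>N. openin (top_of_set M) N \<and> p \<in> N \<and> N \<subseteq> M - mboundary \<A>" by blast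
qed

lemma closure_stratum:
  assumes surf: "oriented_corner_surface M \<A>" and S: "S \<in> boundary_strata \<A>"
  shows "closure S \<inter> M \<subseteq> mboundary \<A>"
proof -
  obtain U where U: "open U" "M - mboundary \<A> = M \<inter> U"
    using openin_manifold_interior[OF surf] by (auto simp: openin_open)
  have "S \<subseteq> mboundary \<A>"
    using S in_components_subset by (fastforce simp: boundary_strata_def mboundary_def)
  then have "S \<inter> U = {}" using U(2) mboundary_subset[OF surf] by blast
  then have "closure S \<inter> U = {}" using U(1) by (metis Int_commute open_Int_closure_eq_empty)
  then show ?thesis using U(2) by blast
qed

lemma boundary_point_stratum: "p \<in> mboundary \<A> \<Longrightarrow> \<exists>S\<in>boundary_strata \<A>. p \<in> S"
  unfolding mboundary_def boundary_strata_def by (metis UnE UnI1 UnI2 UnionE Union_components)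

lemma tri_face_interior_subset: "tri_face_interior \<phi> T K \<subseteq> tri_face \<phi> T K"
  unfolding tri_face_def tri_face_interior_def using rel_interior_subset by blast

lemma hull_ref_vertex_subset: "convex hull (ref_vertex ` K) \<subseteq> ref_tri"
  unfolding ref_tri_def by (rule hull_mono) auto

lemma tri_face_interior_nonempty: "K \<noteq> {} \<Longrightarrow> tri_face_interior \<phi> T K \<noteq> {}"
  unfolding tri_face_interior_def by (simp add: rel_interior_eq_empty)

lemma triangle_subset:
  assumes "smooth_triangulation M \<A> \<T> \<phi>" "T \<in> \<T>"
  shows "\<phi> T ` ref_tri \<subseteq> M" "tri_face \<phi> T K \<subseteq> M" "inj_on (\<phi> T) ref_tri" "continuous_on ref_tri (\<phi> T)"
  using assms hull_ref_vertex_subset by (fastforce simp: smooth_triangulation_def smooth_triangle_def tri_face_def)+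

text \<open>An open edge that meets the boundary meets a stratum. The closure of that stratum contains the whole
edge and lies in the boundary, because the interior of the surface is open.\<close>

lemma edges_boundary_or_interior:
  fixes M :: "'m::t2_space set"
  assumes surf: "oriented_corner_surface M \<A>" and tri: "smooth_triangulation M \<A> \<T> \<phi>"
  shows "edges \<T> \<phi> = boundary_edges \<A> \<T> \<phi> \<union> interior_edges M \<A> \<T> \<phi>"
    and "boundary_edges \<A> \<T> \<phi> \<inter> interior_edges M \<A> \<T> \<phi> = {}"
proof -
  have ne: "- {k} \<noteq> ({} :: 3 set)" for k
    using exhaust_3[of k] by (metis Compl_empty_eq double_complement UNIV_I singletonD zero_neq_one)
  have "e \<in> boundary_edges \<A> \<T> \<phi>" if e: "e \<in> edges \<T> \<phi>" "e \<notin> interior_edges M \<A> \<T> \<phi>" for e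
  proof -
    obtain T k where Tk: "T \<in> \<T>" "e = tri_face \<phi> T (- {k})" using e(1) by (auto simp: edges_def)
    have eM: "e \<subseteq> M" using triangle_subset(2)[OF tri Tk(1)] Tk(2) by simp
    have "\<not> tri_face_interior \<phi> T (- {k}) \<subseteq> M - mboundary \<A>"
      using e(2) Tk by (auto simp: interior_edges_def)
    then obtain p where p: "p \<in> tri_face_interior \<phi> T (- {k})" "p \<in> mboundary \<A>"
      using eM tri_face_interior_subset[of \<phi> T "- {k}"] Tk(2) by blast
    then obtain S where S: "S \<in> boundary_strata \<A>" "p \<in> S" using boundary_point_stratum by blast
    then have "tri_face \<phi> T (- {k}) \<subseteq> closure S"
      using tri Tk(1) p(1) unfolding smooth_triangulation_def by blast
    then have "e \<subseteq> mboundary \<A>" using closure_stratum[OF surf S(1)] eM Tk(2) by blast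
    then show ?thesis using e(1) by (simp add: boundary_edges_def)
  qed
  moreover have "boundary_edges \<A> \<T> \<phi> \<subseteq> edges \<T> \<phi>" "interior_edges M \<A> \<T> \<phi> \<subseteq> edges \<T> \<phi>"
    by (auto simp: boundary_edges_def interior_edges_def edges_def)
  ultimately show "edges \<T> \<phi> = boundary_edges \<A> \<T> \<phi> \<union> interior_edges M \<A> \<T> \<phi>" by blast
  show "boundary_edges \<A> \<T> \<phi> \<inter> interior_edges M \<A> \<T> \<phi> = {}"
  proof (rule ccontr)
    assume "boundary_edges \<A> \<T> \<phi> \<inter> interior_edges M \<A> \<T> \<phi> \<noteq> {}"
    then obtain T k where "tri_face \<phi> T (- {k}) \<subseteq> mboundary \<A>" "tri_face_interior \<phi> T (- {k}) \<subseteq> M - mboundary \<A>"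
      by (auto simp: boundary_edges_def interior_edges_def)
    then have "tri_face_interior \<phi> T (- {k}) = {}" using tri_face_interior_subset[of \<phi> T "- {k}"] by blast
    then show False using tri_face_interior_nonempty[OF ne] by metis
  qed
qed

lemma finite_edges: "finite \<T> \<Longrightarrow> finite (edges \<T> \<phi>)" and finite_verts: "finite \<T> \<Longrightarrow> finite (verts \<T> \<phi>)"
proof -
  assume f: "finite \<T>"
  have "edges \<T> \<phi> = (\<lambda>(T, k). tri_face \<phi> T (- {k})) ` (\<T> \<times> UNIV)" by (auto simp: edges_def)
  then show "finite (edges \<T> \<phi>)" using f by simp
  have "verts \<T> \<phi> = (\<lambda>(T, k). \<phi> T (ref_vertex k)) ` (\<T> \<times> UNIV)" by (auto simp: verts_def)
  then show "finite (verts \<T> \<phi>)" using f by simp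
qed

lemma sum_over_edges:
  fixes f :: "'m set \<Rightarrow> 3 \<Rightarrow> real"
  assumes f: "finite \<T>"
  shows "(\<Sum>e\<in>edges \<T> \<phi>. \<Sum>(T, k)\<in>sides \<T> \<phi> e. f T k) = (\<Sum>T\<in>\<T>. \<Sum>k\<in>UNIV. f T k)"
proof -
  have "(\<Sum>e\<in>edges \<T> \<phi>. \<Sum>(T, k)\<in>sides \<T> \<phi> e. f T k)
      = (\<Sum>e\<in>edges \<T> \<phi>. \<Sum>p\<in>{p \<in> \<T> \<times> UNIV. (case p of (T, k) \<Rightarrow> tri_face \<phi> T (- {k})) = e}. case p of (T, k) \<Rightarrow> f T k)"
    by (intro sum.cong refl) (auto simp: sides_def)
  also have "\<dots> = (\<Sum>p\<in>\<T> \<times> UNIV. case p of (T, k) \<Rightarrow> f T k)"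
    by (rule sum.group) (use f finite_edges[OF f] in \<open>auto simp: edges_def\<close>)
  finally show ?thesis by (simp add: sum.cartesian_product)
qed

lemma sum_over_verts:
  fixes f :: "'m set \<Rightarrow> 3 \<Rightarrow> real"
  assumes f: "finite \<T>"
  shows "(\<Sum>p\<in>verts \<T> \<phi>. \<Sum>(T, k)\<in>angles_at \<T> \<phi> p. f T k) = (\<Sum>T\<in>\<T>. \<Sum>k\<in>UNIV. f T k)"
proof -
  have "(\<Sum>p\<in>verts \<T> \<phi>. \<Sum>(T, k)\<in>angles_at \<T> \<phi> p. f T k)
      = (\<Sum>q\<in>verts \<T> \<phi>. \<Sum>p\<in>{p \<in> \<T> \<times> UNIV. (case p of (T, k) \<Rightarrow> \<phi> T (ref_vertex k)) = q}. case p of (T, k) \<Rightarrow> f T k)"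
    by (intro sum.cong refl) (auto simp: angles_at_def)
  also have "\<dots> = (\<Sum>p\<in>\<T> \<times> UNIV. case p of (T, k) \<Rightarrow> f T k)"
    by (rule sum.group) (use f finite_verts[OF f] in \<open>auto simp: verts_def\<close>)
  finally show ?thesis by (simp add: sum.cartesian_product)
qed

text \<open>This is the differentiability of an inverse function in the form needed at end points of intervals:
\<open>\<psi>\<close> is obtained by solving \<open>h (\<psi> u) = f u\<close> for a regular \<open>h\<close>.\<close>

lemma has_derivative_inverse_chain:
  fixes h \<psi> :: "real \<Rightarrow> real"
  assumes h: "(h has_real_derivative b) (at (\<psi> s) within I)" and b: "b \<noteq> 0"
    and \<psi>: "continuous (at s within I) \<psi>" "\<psi> ` I \<subseteq> I" "s \<in> I"
    and c: "((\<lambda>u. h (\<psi> u)) has_real_derivative a) (at s within I)"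
  shows "(\<psi> has_real_derivative a / b) (at s within I)"
proof -
  \<comment> \<open>The difference quotient of \<open>h\<close> is continuous at \<open>\<psi> s\<close> with nonzero value \<open>b\<close> (Caratheodory).\<close>
  define q where "q y = (if y = \<psi> s then b else (h y - h (\<psi> s)) / (y - \<psi> s))" for y
  have q: "h y - h (\<psi> s) = q y * (y - \<psi> s)" for y by (simp add: q_def)
  have "((\<lambda>y. (h y - h (\<psi> s)) / (y - \<psi> s)) \<longlongrightarrow> b) (at (\<psi> s) within I)"
    using h by (simp add: has_field_derivative_iff)
  then have "(q \<longlongrightarrow> b) (at (\<psi> s) within I)"
    by (rule Lim_transform_within[OF _ zero_less_one]) (auto simp: q_def)
  then have "continuous (at (\<psi> s) within I) q"
    by (simp add: continuous_within q_def)
  then have "continuous (at (\<psi> s) within \<psi> ` I) q"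
    using \<psi>(2) continuous_within_subset by blast
  from continuous_within_compose[OF \<psi>(1) this]
  have "((\<lambda>u. q (\<psi> u)) \<longlongrightarrow> b) (at s within I)"
    by (simp add: continuous_within comp_def q_def)
  moreover have "((\<lambda>u. (h (\<psi> u) - h (\<psi> s)) / (u - s)) \<longlongrightarrow> a) (at s within I)"
    using c by (simp add: has_field_derivative_iff)
  ultimately have lim: "((\<lambda>u. ((h (\<psi> u) - h (\<psi> s)) / (u - s)) / q (\<psi> u)) \<longlongrightarrow> a / b) (at s within I)"
    using b by (intro tendsto_divide)
  have "eventually (\<lambda>u. q (\<psi> u) \<noteq> 0) (at s within I)"
    using \<open>((\<lambda>u. q (\<psi> u)) \<longlongrightarrow> b) (at s within I)\<close> b by (rule tendsto_imp_eventually_ne)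
  then have "eventually (\<lambda>u. ((h (\<psi> u) - h (\<psi> s)) / (u - s)) / q (\<psi> u) = (\<psi> u - \<psi> s) / (u - s)) (at s within I)"
    by eventually_elim (simp add: q)
  from Lim_transform_eventually[OF lim this] show ?thesis by (simp add: has_field_derivative_iff)
qed

lemma inj_on_ref_path: "inj_on (ref_path k) {0..1}"
  by (rule inj_onI) (simp add: ref_path_line side_dir_nonzero)

lemma ref_path_image: "ref_path k ` {0..1} = convex hull (ref_vertex ` (- {k}))"
proof -
  have "x = k \<or> x = k + 1 \<or> x = k + 2" for x using exhaust_3[of k] exhaust_3[of x] by auto
  moreover have "k + 1 \<noteq> k" "k + 2 \<noteq> k" using exhaust_3[of k] by auto
  ultimately have "- {k} = {k + 1, k + 2}" by auto
  then show ?thesis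
    using path_image_linepath[of "ref_vertex (k + 1)" "ref_vertex (k + 2)"]
    by (simp add: ref_path_def path_image_def segment_convex_hull)
qed

lemma chart_path_derivative:
  assumes st: "smooth_triangle M \<A> f" and c: "chart_on M c" "c \<in> \<A>" and s: "s \<in> {0..1}" and p:
      "f (ref_path k s) \<in> fst c"
  shows "\<exists>a. a \<noteq> 0 \<and> ((\<lambda>s. snd c (f (ref_path k s))) has_vector_derivative a) (at s within {0..1})"
proof -
  let ?x = "ref_path k s" and ?W = "ref_tri \<inter> f -` fst c"
  have x: "?x \<in> ref_tri" by (rule ref_path_in_ref_tri[OF s])
  have sm: "smooth_on ?W (snd c \<circ> f)" and J: "det (jac ref_tri (snd c \<circ> f) ?x) > 0"
    and fM: "f ` ref_tri \<subseteq> M" and cont: "continuous_on ref_tri f"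
    using st c(2) x p by (auto simp: smooth_triangle_def)
  obtain Q where Q: "open Q" "fst c = M \<inter> Q" using chart_onD(1)[OF c(1)] by (auto simp: openin_open)
  have W: "?W = ref_tri \<inter> f -` Q" using Q(2) fM by auto
  obtain U where U: "open U" "ref_tri \<inter> f -` Q = ref_tri \<inter> U"
    using continuous_openin_preimage_gen[OF cont Q(1)] by (auto simp: openin_open)
  have at: "at ?x within ?W = at ?x within ref_tri"
    by (rule at_within_nhd[of _ U]) (use U W x p Q(2) in auto)
  have "Ck_on (Suc 0) ?W (snd c \<circ> f)" using sm by (simp add: smooth_on_def)
  then have "(snd c \<circ> f) differentiable (at ?x within ?W)" by (rule Ck_on_differentiable) (use x p in auto)
  then have L: "((snd c \<circ> f) has_derivative frechet_derivative (snd c \<circ> f) (at ?x within ref_tri))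
      (at ?x within ref_tri)"
    unfolding at frechet_derivative_works .
  let ?L = "frechet_derivative (snd c \<circ> f) (at ?x within ref_tri)"
  have lin: "linear ?L" using has_derivative_linear[OF L] .
  have Ld: "?L (side_dir k) \<noteq> 0"
  proof
    assume "?L (side_dir k) = 0"
    then have "jac ref_tri (snd c \<circ> f) ?x *v side_dir k = 0" by (simp add: jac_def matrix_works[OF lin[folded
        linear_matrix_vector_mul_eq]])
    moreover have "invertible (jac ref_tri (snd c \<circ> f) ?x)" using J by (simp add: invertible_det_nz)
    ultimately show False
      using side_dir_nonzero[of k] by (metis invertible_left_inverse matrix_left_invertible_ker)
  qed
  have d: "(ref_path k has_derivative (\<lambda>h. h *\<^sub>R side_dir k)) (at s within {0..1})"
    unfolding ref_path_line[abs_def] by (auto intro!: derivative_eq_intros)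
  have "ref_path k ` {0..1} \<subseteq> ref_tri" using ref_path_in_ref_tri by auto
  from has_derivative_in_compose[OF d has_derivative_subset[OF L this]]
  have "((\<lambda>s. snd c (f (ref_path k s))) has_vector_derivative ?L (side_dir k)) (at s within {0..1})"
    by (simp add: has_vector_derivative_def linear_scale[OF lin])
  then show ?thesis using Ld by blast
qed

text \<open>Both sides parametrize the edge injectively, so the change of parameter \<open>\<psi>\<close> exists and is continuous. In
a chart around the point both parametrizations are regular curves with the same image, which makes
\<open>\<psi>\<close> differentiable.\<close>

lemma side_reparametrization:
  fixes M :: "'m::t2_space set"
  assumes surf: "oriented_corner_surface M \<A>" and tri: "smooth_triangulation M \<A> \<T> \<phi>"
    and s1: "(T, k) \<in> sides \<T> \<phi> e" and s2: "(T', k') \<in> sides \<T> \<phi> e"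
  obtains \<psi> \<psi>' where "\<And>s. s \<in> {0..1} \<Longrightarrow> (\<psi> has_real_derivative \<psi>' s) (at s within {0..1})"
    "inj_on \<psi> {0..1}" "\<psi> ` {0..1} = {0..1}"
    "\<And>s. s \<in> {0..1} \<Longrightarrow> tri_point \<phi> T' (\<phi> T (ref_path k s)) = ref_path k' (\<psi> s)"
proof -
  let ?I = "{0..1::real}"
  have TT: "T \<in> \<T>" "T' \<in> \<T>" and e: "tri_face \<phi> T (- {k}) = e" "tri_face \<phi> T' (- {k'}) = e"
    using s1 s2 by (auto simp: sides_def)
  have st: "smooth_triangle M \<A> (\<phi> T)" "smooth_triangle M \<A> (\<phi> T')"
    using tri TT by (auto simp: smooth_triangulation_def)
  define \<gamma> where "\<gamma> s = \<phi> T (ref_path k s)" for s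
  define \<gamma>' where "\<gamma>' s = \<phi> T' (ref_path k' s)" for s
  have im: "\<gamma> ` ?I = e" "\<gamma>' ` ?I = e"
    using e unfolding tri_face_def ref_path_image[symmetric] \<gamma>_def \<gamma>'_def by (auto simp: image_image)
  have cpath: "continuous_on ?I (ref_path j)" for j unfolding ref_path_line[abs_def] by (intro continuous_intros)
  have sub: "ref_path j ` ?I \<subseteq> ref_tri" for j using ref_path_in_ref_tri by auto
  have c\<gamma>: "continuous_on ?I \<gamma>" "continuous_on ?I \<gamma>'"
    unfolding \<gamma>_def \<gamma>'_def
    by (rule continuous_on_compose2[OF triangle_subset(4)[OF tri TT(1)] cpath sub]
        continuous_on_compose2[OF triangle_subset(4)[OF tri TT(2)] cpath sub])+
  have i\<gamma>: "inj_on \<gamma> ?I" "inj_on \<gamma>' ?I"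
    using triangle_subset(3)[OF tri TT(1)] triangle_subset(3)[OF tri TT(2)] inj_on_ref_path ref_path_in_ref_tri
    unfolding \<gamma>_def \<gamma>'_def inj_on_def by metis+
  define \<psi> where "\<psi> = inv_into ?I \<gamma>' \<circ> \<gamma>"
  have \<psi>I: "\<psi> s \<in> ?I" and \<gamma>\<psi>: "\<gamma>' (\<psi> s) = \<gamma> s" if "s \<in> ?I" for s
  proof -
    have "\<gamma> s \<in> \<gamma>' ` ?I" using im that by blast
    then show "\<psi> s \<in> ?I" "\<gamma>' (\<psi> s) = \<gamma> s" unfolding \<psi>_def comp_def by (rule inv_into_into, rule f_inv_into_f)
  qed
  have "continuous_on (\<gamma>' ` ?I) (inv_into ?I \<gamma>')"
    by (rule continuous_on_inv[OF c\<gamma>(2) compact_Icc]) (simp add: i\<gamma>(2))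
  then have c\<psi>: "continuous_on ?I \<psi>" unfolding \<psi>_def using im c\<gamma>(1) by (intro continuous_on_compose) auto
  have inj: "inj_on \<psi> ?I"
    using i\<gamma>(1) \<gamma>\<psi> unfolding inj_on_def by metis
  have onto: "\<psi> ` ?I = ?I"
  proof
    show "?I \<subseteq> \<psi> ` ?I"
    proof
      fix r assume r: "r \<in> ?I"
      then obtain s where s: "s \<in> ?I" "\<gamma> s = \<gamma>' r" using im by (metis image_iff)
      then have "\<psi> s = r" using r i\<gamma>(2) by (simp add: \<psi>_def)
      then show "r \<in> \<psi> ` ?I" using s by blast
    qed
  qed (use \<psi>I in auto)
  have point: "tri_point \<phi> T' (\<phi> T (ref_path k s)) = ref_path k' (\<psi> s)" if "s \<in> ?I" for s
  proof -
    have "\<phi> T (ref_path k s) = \<phi> T' (ref_path k' (\<psi> s))" using \<gamma>\<psi>[OF that] by (simp add: \<gamma>_def \<gamma>'_def)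
    then show ?thesis
      using triangle_subset(3)[OF tri TT(2)] ref_path_in_ref_tri[OF \<psi>I[OF that]] by (simp add: tri_point_def)
  qed
  have "\<exists>d. (\<psi> has_real_derivative d) (at s within ?I)" if s: "s \<in> ?I" for s
  proof -
    have "\<gamma> s \<in> M" using triangle_subset(1)[OF tri TT(1)] ref_path_in_ref_tri[OF s] by (auto simp: \<gamma>_def)
    then obtain c where c: "c \<in> \<A>" "\<gamma> s \<in> fst c" and ch: "chart_on M c"
      using surf by (auto simp: oriented_corner_surface_def)
    obtain a where a: "((\<lambda>u. snd c (\<gamma> u)) has_vector_derivative a) (at s within ?I)"
      using chart_path_derivative[OF st(1) ch c(1) s] c(2) unfolding \<gamma>_def by blast
    obtain b where b: "b \<noteq> 0" "((\<lambda>u. snd c (\<gamma>' u)) has_vector_derivative b) (at (\<psi> s) within ?I)"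
      using chart_path_derivative[OF st(2) ch c(1) \<psi>I[OF s]] c(2) \<gamma>\<psi>[OF s] unfolding \<gamma>'_def by metis
    obtain j where j: "b $ j \<noteq> 0" using b(1) by (auto simp: vec_eq_iff)
    have comp: "((\<lambda>u. f u $ j) has_real_derivative v $ j) F" if "(f has_vector_derivative v) F" for f v
        and F :: "real filter"
      using bounded_linear.has_vector_derivative[OF bounded_linear_vec_nth that]
      by (simp add: has_real_derivative_iff_has_vector_derivative)
    have "((\<lambda>u. snd c (\<gamma>' (\<psi> u)) $ j) has_real_derivative a $ j) (at s within ?I)"
      by (rule has_field_derivative_transform_within[OF comp[OF a] zero_less_one s]) (simp add: \<gamma>\<psi>)
    then have "(\<psi> has_real_derivative a $ j / b $ j) (at s within ?I)"
      using c\<psi> s onto by (intro has_derivative_inverse_chain[where \<psi> = \<psi> and h =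
          "\<lambda>u. snd c (\<gamma>' u) $ j", OF comp[OF b(2)] j])
        (auto simp: continuous_on_eq_continuous_within)
    then show ?thesis by blast
  qed
  then obtain \<psi>' where "\<And>s. s \<in> ?I \<Longrightarrow> (\<psi> has_real_derivative \<psi>' s) (at s within ?I)" by metis
  then show thesis using that inj onto point by blast
qed

section \<open>Summation over the triangles\<close>

lemma Ck_on_bounded_linear:
  assumes L: "bounded_linear L"
  shows "Ck_on k S f \<Longrightarrow> Ck_on k S (\<lambda>x. L (f x))"
proof (induction k arbitrary: f)
  case 0
  then show ?case using bounded_linear.continuous_on[OF L] by simp
next
  case (Suc k)
  then obtain D where D: "\<And>x. x \<in> S \<Longrightarrow> has_partials f D x S"
    "\<And>i. i \<in> Basis \<Longrightarrow> Ck_on k S (D i)" by auto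
  have lin: "linear L" using L by (rule bounded_linear.linear)
  have "((\<lambda>x. L (f x)) has_derivative (\<lambda>h. \<Sum>i\<in>Basis. (h \<bullet> i) *\<^sub>R L (D i x))) (at x within S)" if "x \<in> S" for x
    using bounded_linear.has_derivative[OF L D(1)[OF that]]
    by (simp add: linear_sum[OF lin] linear_scale[OF lin])
  then show ?case using Suc.IH[OF D(2)] by (auto intro!: exI[of _ "\<lambda>i x. L (D i x)"])
qed

lemma matrix_derivative:
  fixes f :: "real \<Rightarrow> real^2^2"
  assumes "\<And>i j. ((\<lambda>r. f r $ i $ j) has_real_derivative B $ i $ j) (at t within {0..1})" and t: "t \<in> {0..1}"
  shows "vector_derivative f (at t within {0..1}) = B"
proof (rule vector_derivative_within_closed_interval[OF zero_less_one t])
  show "(f has_vector_derivative B) (at t within {0..1})"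
    unfolding has_vector_derivative_def
  proof (subst has_derivative_componentwise_within, intro ballI)
    fix b :: "real^2^2" assume "b \<in> Basis"
    then obtain i j where b: "b = axis i (axis j 1)" by (auto simp: Basis_vec_def)
    show "((\<lambda>x. f x \<bullet> b) has_derivative (\<lambda>x. x *\<^sub>R B \<bullet> b)) (at t within {0..1})"
      using assms(1)[of i j] by (simp add: b inner_axis has_field_derivative_def mult.commute[of _ "B $ i $ j"])
  qed
qed

lemma continuous_derivative_unit_interval:
  fixes f :: "real \<Rightarrow> real"
  assumes "smooth_on {0..1} f"
  shows "continuous_on {0..1} (\<lambda>s. vector_derivative f (at s within {0..1}))"
proof -
  have "Ck_on (Suc 0) {0..1} f" using assms by (simp add: smooth_on_def)
  then obtain E where E: "\<forall>s\<in>{0..1}. (f has_derivative (\<lambda>h. \<Sum>i\<in>Basis. (h \<bullet> i) *\<^sub>R E i s)) (at s within {0..1})"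
    "\<forall>i\<in>Basis. Ck_on 0 {0..1} (E i)"
    unfolding Ck_on.simps(2) by blast
  have eq: "vector_derivative f (at s within {0..1}) = E 1 s" if "s \<in> {0..1}" for s
    using bspec[OF E(1) that]
    by (intro vector_derivative_within_closed_interval zero_less_one that) (simp add: has_vector_derivative_def)
  have "continuous_on {0..1} (E 1)" using E(2) by simp
  then show ?thesis by (rule continuous_on_eq) (rule eq[symmetric])
qed

locale regge_family =
  fixes M :: "'m::t2_space set" and \<A> :: "'m chart set" and \<T> :: "'m set set" and \<phi> :: "'m set \<Rightarrow> real^2 \<Rightarrow> 'm"
    and v :: "'m \<Rightarrow> real" and G :: "real \<Rightarrow> 'm set \<Rightarrow> real^2 \<Rightarrow> real^2^2"
  assumes surf: "oriented_corner_surface M \<A>" and tri: "smooth_triangulation M \<A> \<T> \<phi>"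
    and v: "T \<in> \<T> \<Longrightarrow> Ck_on 2 ref_tri (v \<circ> \<phi> T)" and fam: "smooth_regge_family \<T> \<phi> G"
begin

lemma finite_triangles: "finite \<T>"
  using tri by (simp add: smooth_triangulation_def)

lemma metric_family_triangle:
  assumes "T \<in> \<T>"
  shows "metric_family (\<lambda>t. G t T) (v \<circ> \<phi> T)"
proof
  show "C2 (v \<circ> \<phi> T)" unfolding C2_iff_Ck by (rule v[OF assms])
  show "pos_def (G t T x)" if "t \<in> {0..1}" "x \<in> ref_tri" for t x
    using fam assms that by (auto simp: smooth_regge_family_def regge_metric_def smooth_metric_on_def)
  fix i j :: 2
  have "Ck_on 2 ({0..1} \<times> ref_tri) (\<lambda>(t, x). G t T x)"
    using fam assms by (simp add: smooth_regge_family_def smooth_on_def)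
  from Ck_on_bounded_linear[OF bounded_linear_compose[OF bounded_linear_vec_nth[of j]
      bounded_linear_vec_nth[of i]] this]
  have "Ck_on 2 ({0..1} \<times> ref_tri) (\<lambda>p. (case p of (t, x) \<Rightarrow> G t T x) $ i $ j)" .
  moreover have "(\<lambda>p. (case p of (t, x) \<Rightarrow> G t T x) $ i $ j) = (\<lambda>(t, x). G t T x $ i $ j)" by auto
  ultimately show "Ck_on 2 ({0..1} \<times> ref_tri) (\<lambda>(t, x). G t T x $ i $ j)" by simp
qed

lemma time_derivative_rate:
  assumes "T \<in> \<T>" "t \<in> {0..1}" "x \<in> ref_tri"
  shows "time_derivative G t T x = metric_family.rate (\<lambda>t. G t T) t x"
  unfolding time_derivative_def
  by (rule matrix_derivative[OF metric_family.entry_derivative(1)[OF metric_family_triangle[OF assms(1)]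
      assms(2,3)] assms(2)])

definition side_flux :: "real \<Rightarrow> 'm set \<Rightarrow> 3 \<Rightarrow> real \<Rightarrow> real" where
  "side_flux t T = edge_flux (G t T) (time_derivative G t T) (v \<circ> \<phi> T)"

lemma side_flux_rate:
  assumes "T \<in> \<T>" "t \<in> {0..1}" "s \<in> {0..1}"
  shows "side_flux t T k s = edge_flux (G t T) (metric_family.rate (\<lambda>t. G t T) t) (v \<circ> \<phi> T) k s"
  unfolding side_flux_def edge_flux_def Let_def time_derivative_rate[OF assms(1,2) ref_path_in_ref_tri[OF
      assms(3)]] ..

lemma continuous_side_flux:
  assumes "T \<in> \<T>" "t \<in> {0..1}"
  shows "continuous_on {0..1} (side_flux t T k)"
  using metric_family.continuous_boundary_parts(3)[OF metric_family_triangle[OF assms(1)] assms(2), of k]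
  by (rule continuous_on_eq) (simp add: side_flux_rate[OF assms])

abbreviation "area_term t T \<equiv> tri_integral (G t T) (\<lambda>x. inner_g (G t T x) (S_op (G t T x) (time_derivative G t
    T x)) (hessian ref_tri (G t T) (v \<circ> \<phi> T) x))"

lemma functional_derivative:
  assumes T: "T \<in> \<T>" and t: "t \<in> {0..1}"
  shows "((\<lambda>t. triangle_functional (G t T) (v \<circ> \<phi> T)) has_real_derivative
      1 / 2 * (area_term t T
        - (\<Sum>k\<in>UNIV. integral {0..1} (side_flux t T k)))) (at t within {0..1})"
proof -
  have 1: "area_term t T = tri_integral (G t T) (\<lambda>x. inner_g (G t T x) (S_op (G t T x) (metric_family.rate
      (\<lambda>t. G t T) t x)) (hessian ref_tri (G t T) (v \<circ> \<phi> T) x))"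
    unfolding tri_integral_def by (rule integral_cong) (simp add: time_derivative_rate[OF T t])
  have 2: "integral {0..1} (side_flux t T k) = integral {0..1} (edge_flux (G t T) (metric_family.rate (\<lambda>t. G t
      T) t) (v \<circ> \<phi> T) k)" for k
    by (rule integral_cong) (rule side_flux_rate[OF T t])
  show ?thesis unfolding 1 2
    by (rule metric_family.triangle_functional_derivative[OF metric_family_triangle[OF T] t])
qed

text \<open>The edge integral in \<open>b_form\<close> is computed in the parametrization of one side \<open>(T, k)\<close>, with the normal
derivatives taken from all sides. If \<open>\<psi>\<close> is the change of parameter to the side \<open>(T', k')\<close>, the tangential
components of the metric at corresponding points differ by the factor \<open>\<psi>'\<^sup>2\<close> at all times, hence so do those
of its velocity. Therefore \<open>(S \<sigma>)(n, n)\<close> agrees on both sides and the speed acquires the factor \<open>|\<psi>'|\<close> of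
the substitution rule.\<close>

lemma side_transfer:
  assumes s1: "(T, k) \<in> sides \<T> \<phi> e" and s2: "(T', k') \<in> sides \<T> \<phi> e" and t: "t \<in> {0..1}"
  defines "F \<equiv> \<lambda>s. let q = \<phi> T (ref_path k s); x' = tri_point \<phi> T' q in
      S_nn \<phi> (G t) (time_derivative G t) (T, k) q * frechet_derivative (v \<circ> \<phi> T')
          (at x' within ref_tri) (side_normal (G t T') k' x')
      * side_speed (G t T) k s"
  shows "F integrable_on {0..1}" "integral {0..1} F = integral {0..1} (side_flux t T' k')"
proof -
  let ?I = "{0..1::real}"
  let ?d = "side_dir k" and ?d' = "side_dir k'"
  have T: "T \<in> \<T>" "T' \<in> \<T>" using s1 s2 by (auto simp: sides_def)
  have e: "e \<in> edges \<T> \<phi>" using s1 by (auto simp: sides_def edges_def)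
  interpret A: metric_family "\<lambda>t. G t T" "v \<circ> \<phi> T" by (rule metric_family_triangle[OF T(1)])
  interpret B: metric_family "\<lambda>t. G t T'" "v \<circ> \<phi> T'" by (rule metric_family_triangle[OF T(2)])
  obtain \<psi> \<psi>' where \<psi>: "\<And>s. s \<in> ?I \<Longrightarrow> (\<psi> has_real_derivative \<psi>' s) (at s within ?I)" "inj_on \<psi> ?I" "\<psi> ` ?I = ?I"
    and point: "\<And>s. s \<in> ?I \<Longrightarrow> tri_point \<phi> T' (\<phi> T (ref_path k s)) = ref_path k' (\<psi> s)"
    using side_reparametrization[OF surf tri s1 s2] by blast
  have F: "F s = \<bar>\<psi>' s\<bar> * side_flux t T' k' (\<psi> s)" if s: "s \<in> ?I" for s
  proof -
    define x where "x = ref_path k s"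
    define y where "y = ref_path k' (\<psi> s)"
    have \<psi>s: "\<psi> s \<in> ?I" using \<psi>(3) s by blast
    have x: "x \<in> ref_tri" and y: "y \<in> ref_tri"
      unfolding x_def y_def by (intro ref_path_in_ref_tri s \<psi>s)+
    have "((\<lambda>s. ref_path k' (\<psi> s)) has_vector_derivative \<psi>' s *\<^sub>R ?d') (at s within ?I)"
      unfolding ref_path_line
      using \<psi>(1)[OF s] by (auto intro!: derivative_eq_intros simp: has_real_derivative_iff_has_vector_derivative)
    then have "((tri_point \<phi> T' \<circ> \<phi> T \<circ> ref_path k) has_vector_derivative \<psi>' s *\<^sub>R ?d') (at s within ?I)"
      by (rule has_vector_derivative_transform[OF s, rotated]) (simp add: point)
    then have vel: "velocity (tri_point \<phi> T' \<circ> \<phi> T \<circ> ref_path k) s = \<psi>' s *\<^sub>R ?d'"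
      unfolding velocity_def by (intro vector_derivative_within_closed_interval zero_less_one s)
    have tt: "bil (G r T x) ?d ?d = (\<psi>' s)\<^sup>2 * bil (G r T' y) ?d' ?d'" if r: "r \<in> ?I" for r
    proof -
      have "single_valued_tt \<T> \<phi> (G r)"
        using fam r by (simp add: smooth_regge_family_def regge_metric_def)
      then have "bil (G r T (ref_path k s)) (velocity (ref_path k) s) (velocity (ref_path k) s)
          = bil (G r T' ((tri_point \<phi> T' \<circ> \<phi> T \<circ> ref_path k) s)) (velocity (tri_point \<phi> T' \<circ> \<phi> T \<circ> ref_path k) s)
             (velocity (tri_point \<phi> T' \<circ> \<phi> T \<circ> ref_path k) s)"
        using e s1 s2 s unfolding single_valued_tt_def Let_def by fast
      then show ?thesis
        unfolding vel velocity_ref_path[OF s]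
        unfolding comp_def point[OF s] x_def y_def
        by (simp add: bil_2 power2_eq_square algebra_simps)
    qed
    have bilD: "((\<lambda>r. bil (C r) u u) has_real_derivative bil S u u) (at t within ?I)"
      if "\<And>i j. ((\<lambda>r. C r $ i $ j) has_real_derivative S $ i $ j) (at t within ?I)" for C S and u :: "real^2"
      unfolding bil_2 by (rule derivative_eq_intros that refl)+ (simp add: algebra_simps)
    have DA: "((\<lambda>r. bil (G r T x) ?d ?d) has_real_derivative bil (A.rate t x) ?d ?d) (at t within ?I)"
      by (rule bilD[OF A.entry_derivative(1)[OF t x]])
    have "((\<lambda>r. (\<psi>' s)\<^sup>2 * bil (G r T' y) ?d' ?d') has_real_derivative (\<psi>' s)\<^sup>2 * bil (B.rate t y) ?d' ?d')
        (at t within ?I)"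
      by (rule DERIV_cmult[OF bilD[OF B.entry_derivative(1)[OF t y]]])
    then have DB: "((\<lambda>r. bil (G r T x) ?d ?d) has_real_derivative (\<psi>' s)\<^sup>2 * bil (B.rate t y) ?d' ?d')
        (at t within ?I)"
      by (rule has_field_derivative_transform_within[OF _ zero_less_one t]) (simp add: tt)
    have tt': "bil (A.rate t x) ?d ?d = (\<psi>' s)\<^sup>2 * bil (B.rate t y) ?d' ?d'"
      using vector_derivative_within_closed_interval[OF zero_less_one t] DA DB
      unfolding has_real_derivative_iff_has_vector_derivative by metis
    have pos: "bil (G t T x) ?d ?d > 0" "bil (G t T' y) ?d' ?d' > 0"
      by (intro bil_pos A.pos_H B.pos_H t x y side_dir_nonzero)+
    then have \<psi>nz: "\<psi>' s \<noteq> 0" using tt[OF t] by auto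
    have tp: "tri_point \<phi> T (\<phi> T x) = x"
      using triangle_subset(3)[OF tri T(1)] x by (simp add: tri_point_def)
    have n: "side_normal g j z = right_normal (g z) (side_dir j)" for g j z
        by (simp add: side_normal_def side_dir_def)
    have S1: "S_nn \<phi> (G t) (time_derivative G t) (T, k) (\<phi> T x) = - bil (A.rate t x) ?d ?d / bil (G t T x) ?d ?d"
      unfolding S_nn_def prod.case Let_def tp n time_derivative_rate[OF T(1) t x]
      by (rule S_op_normal_normal[OF A.pos_H[OF t x] side_dir_nonzero A.rate_sym[OF t x]])
    have S2: "bil (S_op (G t T' y) (time_derivative G t T' y)) (side_normal (G t T') k' y) (side_normal (G t
        T') k' y)
        = - bil (B.rate t y) ?d' ?d' / bil (G t T' y) ?d' ?d'"
      unfolding n time_derivative_rate[OF T(2) t y]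
      by (rule S_op_normal_normal[OF B.pos_H[OF t y] side_dir_nonzero B.rate_sym[OF t y]])
    have Seq: "S_nn \<phi> (G t) (time_derivative G t) (T, k) (\<phi> T x)
        = bil (S_op (G t T' y) (time_derivative G t T' y)) (side_normal (G t T') k' y) (side_normal (G t T') k' y)"
      unfolding S1 S2 tt[OF t] tt' using \<psi>nz by simp
    have speed: "side_speed (G t T) k s = \<bar>\<psi>' s\<bar> * side_speed (G t T') k' (\<psi> s)"
      unfolding side_speed_def len_def velocity_ref_path[OF s] velocity_ref_path[OF \<psi>s] x_def[symmetric]
          y_def[symmetric] tt[OF t]
      by (simp add: real_sqrt_mult)
    have "F s = S_nn \<phi> (G t) (time_derivative G t) (T, k) (\<phi> T x)
        * frechet_derivative (v \<circ> \<phi> T') (at y within ref_tri) (side_normal (G t T') k' y) * side_speed (G t T) k s"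
      unfolding F_def Let_def point[OF s] x_def y_def ..
    also have "\<dots> = \<bar>\<psi>' s\<bar> * side_flux t T' k' (\<psi> s)"
      unfolding Seq speed side_flux_def edge_flux_def Let_def y_def[symmetric] by simp
    finally show ?thesis .
  qed
  have sub: "(\<lambda>s. \<bar>\<psi>' s\<bar> * side_flux t T' k' (\<psi> s)) integrable_on ?I"
      "integral ?I (\<lambda>s. \<bar>\<psi>' s\<bar> * side_flux t T' k' (\<psi> s)) = integral ?I (side_flux t T' k')"
    using integral_substitution_unit_interval[of \<psi> \<psi>' "side_flux t T' k'"] \<psi> continuous_side_flux[OF T(2) t, of k']
    by blast+
  show "F integrable_on ?I"
    using sub(1) by (rule integrable_eq) (rule F[symmetric])
  have "integral ?I F = integral ?I (\<lambda>s. \<bar>\<psi>' s\<bar> * side_flux t T' k' (\<psi> s))"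
    by (rule integral_cong) (rule F)
  also have "\<dots> = integral ?I (side_flux t T' k')" by (rule sub(2))
  finally show "integral ?I F = integral ?I (side_flux t T' k')" .
qed

lemma b_form_sum:
  assumes t: "t \<in> {0..1}"
  shows "b_form \<T> \<phi> (G t) (time_derivative G t) v =
    (\<Sum>T\<in>\<T>. area_term t T
      - (\<Sum>k\<in>UNIV. integral {0..1} (side_flux t T k)))"
proof -
  have "(let side = SOME side. side \<in> sides \<T> \<phi> e in
        edge_integral \<phi> (G t) side (\<lambda>q. S_nn \<phi> (G t) (time_derivative G t) side q * dv_jump \<T> \<phi> (G t) v e q))
      = (\<Sum>(T, k)\<in>sides \<T> \<phi> e. integral {0..1} (side_flux t T k))" if e: "e \<in> edges \<T> \<phi>" for e
  proof -
    have "sides \<T> \<phi> e \<noteq> {}" using e by (auto simp: edges_def sides_def)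
    then have "(SOME side. side \<in> sides \<T> \<phi> e) \<in> sides \<T> \<phi> e" by (simp add: some_in_eq)
    then obtain T k where Tk: "(SOME side. side \<in> sides \<T> \<phi> e) = (T, k)" "(T, k) \<in> sides \<T> \<phi> e" by (metis surj_pair)
    have fin: "finite (sides \<T> \<phi> e)"
      by (rule finite_subset[of _ "\<T> \<times> UNIV"]) (use finite_triangles in \<open>auto simp: sides_def\<close>)
    let ?F = "\<lambda>p s. let q = \<phi> T (ref_path k s); x' = tri_point \<phi> (fst p) q in
      S_nn \<phi> (G t) (time_derivative G t) (T, k) q * frechet_derivative (v \<circ> \<phi> (fst p))
          (at x' within ref_tri) (side_normal (G t (fst p)) (snd p) x')
      * side_speed (G t T) k s"
    have F: "?F p integrable_on {0..1}" "integral {0..1} (?F p) = integral {0..1} (side_flux t (fst p) (snd p))"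
      if "p \<in> sides \<T> \<phi> e" for p
      using side_transfer[OF Tk(2) _ t, of "fst p" "snd p"] that by simp_all
    have "edge_integral \<phi> (G t) (T, k) (\<lambda>q. S_nn \<phi> (G t) (time_derivative G t) (T, k) q * dv_jump \<T> \<phi> (G t) v e q)
        = integral {0..1} (\<lambda>s. \<Sum>p\<in>sides \<T> \<phi> e. ?F p s)"
      unfolding edge_integral_def dv_jump_def prod.case Let_def case_prod_beta sum_distrib_left
          sum_distrib_right fst_conv snd_conv ..
    also have "\<dots> = (\<Sum>p\<in>sides \<T> \<phi> e. integral {0..1} (?F p))"
      by (rule integral_sum[OF fin F(1)])
    also have "\<dots> = (\<Sum>p\<in>sides \<T> \<phi> e. integral {0..1} (side_flux t (fst p) (snd p)))"
      by (rule sum.cong[OF refl F(2)])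
    finally show ?thesis unfolding Tk(1) Let_def case_prod_beta .
  qed
  then have "(\<Sum>e\<in>edges \<T> \<phi>. let side = SOME side. side \<in> sides \<T> \<phi> e in
        edge_integral \<phi> (G t) side (\<lambda>q. S_nn \<phi> (G t) (time_derivative G t) side q * dv_jump \<T> \<phi> (G t) v e q))
      = (\<Sum>T\<in>\<T>. \<Sum>k\<in>UNIV. integral {0..1} (side_flux t T k))"
    using sum_over_edges[OF finite_triangles, where \<phi> = \<phi> and f = "\<lambda>T k. integral {0..1} (side_flux t T k)"] by simp
  then show ?thesis unfolding b_form_def sum_subtractf by simp
qed

text \<open>The constant collects the terms without the Regge metric: the integrals of \<open>v d\<mu>\<close>, the jumps of \<open>\<mu>\<close>, and
the full angles \<open>pi\<close> and \<open>2 * pi\<close>.\<close>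

lemma alpha_minus_K:
  assumes \<mu>: "\<And>e T k. e \<in> boundary_edges \<A> \<T> \<phi> \<Longrightarrow> (T, k) \<in> sides \<T> \<phi> e
      \<Longrightarrow> smooth_on {0..1} (\<lambda>s. \<mu> e (\<phi> T (ref_path k s)))"
  shows "\<exists>C. \<forall>t\<in>{0..1}. alpha_dist \<A> \<T> \<phi> \<mu> \<mu>J (G t) v - K_dist M \<A> \<T> \<phi> (G t) v
      = C - (\<Sum>T\<in>\<T>. triangle_functional (G t T) (v \<circ> \<phi> T))"
proof -
  let ?B = "boundary_edges \<A> \<T> \<phi>" and ?N = "interior_edges M \<A> \<T> \<phi>" and ?V = "verts \<T> \<phi>" and ?D = "mboundary \<A>"
  define J where "J e T k = integral {0..1} (\<lambda>s. v (\<phi> T (ref_path k s)) * vector_derivative (\<lambda>r. \<mu> e (\<phi> T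
      (ref_path k r))) (at s within {0..1}))" for e T k
  define C where "C = (\<Sum>e\<in>?B. \<Sum>(T, k)\<in>sides \<T> \<phi> e. J e T k) - (\<Sum>p\<in>?V \<inter> ?D. v p * (pi - \<mu>J p)) - (\<Sum>p\<in>?V - ?D. v
      p * (2 * pi))"
  have "alpha_dist \<A> \<T> \<phi> \<mu> \<mu>J (G t) v - K_dist M \<A> \<T> \<phi> (G t) v = C - (\<Sum>T\<in>\<T>. triangle_functional (G t T) (v \<circ> \<phi> T))"
    if t: "t \<in> {0..1}" for t
  proof -
    define I where "I T k = integral {0..1} (\<lambda>s. v (\<phi> T (ref_path k s)) * (side_curvature (G t T) k s *
        side_speed (G t T) k s))" for T k
    define \<Theta> where "\<Theta> p = (\<Sum>(T, k)\<in>angles_at \<T> \<phi> p. vertex_angle (G t T) k)" for p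
    have split: "integral {0..1} (\<lambda>s. v (\<phi> T (ref_path k s)) *
          (vector_derivative (\<lambda>r. \<mu> e (\<phi> T (ref_path k r))) (at s within {0..1}) - side_curvature (G t T) k s
              * side_speed (G t T) k s))
        = J e T k - I T k" if e: "e \<in> ?B" "(T, k) \<in> sides \<T> \<phi> e" for e T k
    proof -
      have T: "T \<in> \<T>" using e by (auto simp: sides_def)
      interpret A: metric_family "\<lambda>t. G t T" "v \<circ> \<phi> T" by (rule metric_family_triangle[OF T])
      have "C1 (v \<circ> \<phi> T)" using A.C2_V by (simp add: C2_def)
      from continuous_on_side[OF C1_continuous[OF this], of k]
      have cv: "continuous_on {0..1} (\<lambda>s. v (\<phi> T (ref_path k s)))" by simp
      have c\<kappa>: "continuous_on {0..1} (\<lambda>s. side_curvature (G t T) k s * side_speed (G t T) k s)"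
        by (rule triangle_metric.continuous_side_curvature[OF A.metric_at[OF t]])
      show ?thesis
        unfolding right_diff_distrib J_def I_def
        by (intro Henstock_Kurzweil_Integration.integral_diff integrable_continuous_real continuous_on_mult
            cv c\<kappa> continuous_derivative_unit_interval \<mu>[OF e])
    qed
    have fE: "finite (edges \<T> \<phi>)" and fV: "finite ?V"
      using finite_edges[OF finite_triangles] finite_verts[OF finite_triangles] by auto
    note part = edges_boundary_or_interior[OF surf tri]
    have \<alpha>: "alpha_dist \<A> \<T> \<phi> \<mu> \<mu>J (G t) v
        = (\<Sum>e\<in>?B. \<Sum>(T, k)\<in>sides \<T> \<phi> e. J e T k) - (\<Sum>e\<in>?B. \<Sum>(T, k)\<in>sides \<T> \<phi> e. I T k)
          - (\<Sum>p\<in>?V \<inter> ?D. v p * (pi - \<mu>J p)) + (\<Sum>p\<in>?V \<inter> ?D. v p * \<Theta> p)"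
    proof -
      have "(\<Sum>e\<in>?B. \<Sum>(T, k)\<in>sides \<T> \<phi> e. integral {0..1} (\<lambda>s. v (\<phi> T (ref_path k s)) *
          (vector_derivative (\<lambda>r. \<mu> e (\<phi> T (ref_path k r))) (at s within {0..1}) - side_curvature (G t T) k s
              * side_speed (G t T) k s)))
        = (\<Sum>e\<in>?B. \<Sum>p\<in>sides \<T> \<phi> e. J e (fst p) (snd p) - I (fst p) (snd p))"
        by (intro sum.cong refl) (auto simp: split)
      then show ?thesis
        unfolding alpha_dist_def \<Theta>_def[symmetric]
        by (simp add: sum_subtractf case_prod_beta right_diff_distrib sum.distrib)
    qed
    have K: "K_dist M \<A> \<T> \<phi> (G t) v = (\<Sum>T\<in>\<T>. tri_integral (G t T) (\<lambda>x. v (\<phi> T x) * gauss_curvature ref_tri (G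
        t T) x))
        + (\<Sum>e\<in>?N. \<Sum>(T, k)\<in>sides \<T> \<phi> e. I T k) + (\<Sum>p\<in>?V - ?D. v p * (2 * pi)) - (\<Sum>p\<in>?V - ?D. v p * \<Theta> p)"
      unfolding K_dist_def I_def \<Theta>_def by (simp add: sum_subtractf right_diff_distrib)
    have edge: "(\<Sum>e\<in>?B. \<Sum>(T, k)\<in>sides \<T> \<phi> e. I T k) + (\<Sum>e\<in>?N. \<Sum>(T, k)\<in>sides \<T> \<phi> e. I T k) = (\<Sum>T\<in>\<T>. \<Sum>k\<in>UNIV. I T k)"
      unfolding sum_over_edges[OF finite_triangles, where \<phi> = \<phi> and f = I, symmetric] part(1)
      using fE part by (intro sum.union_disjoint[symmetric]) (auto simp: part(1))
    have vert: "(\<Sum>p\<in>?V \<inter> ?D. v p * \<Theta> p) + (\<Sum>p\<in>?V - ?D. v p * \<Theta> p) = (\<Sum>T\<in>\<T>. \<Sum>k\<in>UNIV. v (\<phi> T (ref_vertex k)) *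
        vertex_angle (G t T) k)"
    proof -
      have "(\<Sum>p\<in>?V \<inter> ?D. v p * \<Theta> p) + (\<Sum>p\<in>?V - ?D. v p * \<Theta> p) = (\<Sum>p\<in>?V. v p * \<Theta> p)"
        using fV by (simp add: sum.Int_Diff[of ?V _ ?D])
      also have "\<dots> = (\<Sum>p\<in>?V. \<Sum>(T, k)\<in>angles_at \<T> \<phi> p. v (\<phi> T (ref_vertex k)) * vertex_angle (G t T) k)"
        unfolding \<Theta>_def sum_distrib_left by (intro sum.cong refl) (auto simp: angles_at_def)
      also have "\<dots> = (\<Sum>T\<in>\<T>. \<Sum>k\<in>UNIV. v (\<phi> T (ref_vertex k)) * vertex_angle (G t T) k)"
        by (rule sum_over_verts[OF finite_triangles])
      finally show ?thesis .
    qed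
    have "(\<Sum>T\<in>\<T>. triangle_functional (G t T) (v \<circ> \<phi> T))
        = (\<Sum>T\<in>\<T>. tri_integral (G t T) (\<lambda>x. v (\<phi> T x) * gauss_curvature ref_tri (G t T) x))
          + (\<Sum>T\<in>\<T>. \<Sum>k\<in>UNIV. I T k) - (\<Sum>T\<in>\<T>. \<Sum>k\<in>UNIV. v (\<phi> T (ref_vertex k)) * vertex_angle (G t T) k)"
      by (simp add: triangle_functional_def I_def sum.distrib sum_subtractf)
    then show ?thesis unfolding \<alpha> K C_def edge[symmetric] vert[symmetric] by linarith
  qed
  then show ?thesis by blast
qed

end

theorem theorem19:
  fixes M :: "'m::t2_space set"
    and \<A> :: "'m chart set"
    and g :: "'m chart \<Rightarrow> real^2 \<Rightarrow> real^2^2"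
    and e1 e2 :: "'m chart \<Rightarrow> real^2 \<Rightarrow> real^2"
    and \<T> :: "'m set set"
    and \<phi> :: "'m set \<Rightarrow> real^2 \<Rightarrow> 'm"
    and \<mu> :: "'m set \<Rightarrow> 'm \<Rightarrow> real"
    and \<mu>J :: "'m \<Rightarrow> real"
    and v :: "'m \<Rightarrow> real"
    and G :: "real \<Rightarrow> 'm set \<Rightarrow> real^2 \<Rightarrow> real^2^2"
    and t :: real
  assumes "oriented_corner_surface M \<A>"
    and "compact M"
    and "simply_connected M"
    and "smooth_riemannian_metric \<A> g"
    and "oriented_orthonormal_frame \<A> g e1 e2"
    and "coexact_connection \<A> g e1 e2"
    and "smooth_triangulation M \<A> \<T> \<phi>"
    and "normal_angle \<A> \<T> \<phi> g e1 e2 \<mu>"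
    and "angle_jump \<A> \<T> \<phi> \<mu> \<mu>J"
    and "continuous_on M v"
    and "\<And>T. T \<in> \<T> \<Longrightarrow> Ck_on 2 ref_tri (v \<circ> \<phi> T)"
    and "smooth_regge_family \<T> \<phi> G"
    and "t \<in> {0..1}"
  shows "((\<lambda>t. alpha_dist \<A> \<T> \<phi> \<mu> \<mu>J (G t) v - K_dist M \<A> \<T> \<phi> (G t) v)
          has_real_derivative
          - (1/2) * b_form \<T> \<phi> (G t) (time_derivative G t) v) (at t within {0..1})"
proof -
  interpret regge_family M \<A> \<T> \<phi> v G
    using assms by unfold_locales auto
  have "smooth_on {0..1} (\<lambda>s. \<mu> e (\<phi> T (ref_path k s)))"
    if "e \<in> boundary_edges \<A> \<T> \<phi>" "(T, k) \<in> sides \<T> \<phi> e" for e T k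
    using \<open>normal_angle \<A> \<T> \<phi> g e1 e2 \<mu>\<close> that unfolding normal_angle_def by blast
  from alpha_minus_K[where \<mu> = \<mu> and \<mu>J = \<mu>J, OF this]
  obtain C where C: "\<forall>t\<in>{0..1}. alpha_dist \<A> \<T> \<phi> \<mu> \<mu>J (G t) v - K_dist M \<A> \<T> \<phi> (G t) v
      = C - (\<Sum>T\<in>\<T>. triangle_functional (G t T) (v \<circ> \<phi> T))" by blast
  let ?A = "\<lambda>T. area_term t T
      - (\<Sum>k\<in>UNIV. integral {0..1} (side_flux t T k))"
  have "((\<lambda>t. C - (\<Sum>T\<in>\<T>. triangle_functional (G t T) (v \<circ> \<phi> T))) has_real_derivative 0 - (\<Sum>T\<in>\<T>. 1 / 2 * ?A T))
      (at t within {0..1})"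
    by (intro DERIV_diff DERIV_const DERIV_sum functional_derivative \<open>t \<in> {0..1}\<close>)
  also have "0 - (\<Sum>T\<in>\<T>. 1 / 2 * ?A T) = - (1 / 2) * b_form \<T> \<phi> (G t) (time_derivative G t) v"
    unfolding b_form_sum[OF \<open>t \<in> {0..1}\<close>] sum_distrib_left[symmetric] by simp
  finally show ?thesis
    by (rule has_field_derivative_transform_within[OF _ zero_less_one \<open>t \<in> {0..1}\<close>]) (rule bspec[OF C, symmetric])
qed

end
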